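(* Let $k_{\max}=k_{\max}(x)$ be a positive-integer-valued function with $\log k_{\max}(x)/\log x\to 0$ as $x\to\infty$. Choose $\alpha$ uniformly at random from $\{1,\ldots,x\}$. Then \[ \lim_{x\to\infty}\mathbb{P}\big(\forall\, 8\le k\le k_{\max}:\ L_k^{(\alpha)} \text{ is irreducible over }\mathbb{Q}\text{ and } G_{L_k^{(\alpha)}}=S_k\big)=1 . \]
   Context: The generalized Laguerre polynomial of degree $k$ and parameter $\alpha$ is \[ L_k^{(\alpha)}(x)=\sum_{j=0}^{k}\frac{(k+\alpha)(k-1+\alpha)\cdots(j+1+\alpha)}{(k-j)!\,j!}(-x)^j , \] the polynomial solution of $xy''+(\alpha+1-x)y'+ky=0$. For $g\in\mathbb{Q}[x]$ of degree $k$, $G_g$ denotes the Galois group over $\mathbb{Q}$ of the splitting field of $g$, viewed as a permutation group on the roots of $g$ (so $G_g\le S_k$). *)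

theory Defs
  imports "HOL-Analysis.Analysis" "HOL-Computational_Algebra.Polynomial"
    "HOL-Combinatorics.Permutations"
begin

definition laguerre :: "nat \<Rightarrow> nat \<Rightarrow> rat poly" where
  "laguerre k a = (\<Sum>j\<le>k. monom
      ((\<Prod>i\<in>{j+1..k}. (of_nat i + of_nat a)) / (of_nat (fact (k-j)) * of_nat (fact j))
        * (-1)^j) j)"

definition croots :: "rat poly \<Rightarrow> complex set" where
  "croots g = {z. poly (map_poly of_rat g) z = 0}"

definition is_subfield :: "complex set \<Rightarrow> bool" where
  "is_subfield F \<longleftrightarrow> 0 \<in> F \<and> 1 \<in> F \<and>
     (\<forall>x\<in>F. \<forall>y\<in>F. x + y \<in> F \<and> x * y \<in> F) \<and>
     (\<forall>x\<in>F. - x \<in> F \<and> inverse x \<in> F)"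

text \<open>Splitting field of g over Q, as a subfield of C: the smallest subfield
  containing all complex roots of g (every subfield contains Q).\<close>
definition splitting_field :: "rat poly \<Rightarrow> complex set" where
  "splitting_field g = \<Inter> {F. is_subfield F \<and> croots g \<subseteq> F}"

text \<open>Field automorphisms of a subfield K (automatically fixing Q).\<close>
definition field_aut :: "complex set \<Rightarrow> (complex \<Rightarrow> complex) \<Rightarrow> bool" where
  "field_aut K \<sigma> \<longleftrightarrow> bij_betw \<sigma> K K \<and> \<sigma> 1 = 1 \<and>
     (\<forall>x\<in>K. \<forall>y\<in>K. \<sigma> (x + y) = \<sigma> x + \<sigma> y \<and> \<sigma> (x * y) = \<sigma> x * \<sigma> y)"

definition galois_group :: "rat poly \<Rightarrow> (complex \<Rightarrow> complex) set" where
  "galois_group g = {\<pi>. \<pi> permutes croots g \<and>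
     (\<exists>\<sigma>. field_aut (splitting_field g) \<sigma> \<and> (\<forall>z\<in>croots g. \<sigma> z = \<pi> z))}"

definition sym_group_on :: "complex set \<Rightarrow> (complex \<Rightarrow> complex) set" where
  "sym_group_on R = {\<pi>. \<pi> permutes R}"

end

theory Submission
  imports Defs "HOL-Computational_Algebra.Computational_Algebra" "HOL-Real_Asymp.Real_Asymp"
begin

text \<open>
  For a prime \<open>p > k\<close> dividing \<open>\<alpha> + j\<close> exactly once, the \<open>p\<close>-adic Newton polygon of \<open>L_k\<close> has one
  edge of slope \<open>1 / j\<close>, and the remaining \<open>k - j\<close> roots are units with distinct residues by the
  differential equation. Hence some Galois automorphisms fix these \<open>k - j\<close> roots and act transitively
  on the other \<open>j\<close>. Numbers of size about \<open>x\<close> are rarely \<open>x ^ o(1)\<close>-smooth, so such primes exist for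
  all but few \<open>j \<le> k\<close>; in particular for \<open>j = 2\<close>, which gives a transposition, and for two consecutive
  \<open>j > k / 2\<close>, which makes a transitive group primitive. For transitivity one excludes factors
  of each degree \<open>d \<le> k / 2\<close>: a counting argument yields a prime \<open>p\<close>, possibly smaller than \<open>k\<close>, that divides
  one of \<open>\<alpha> + k - d + 1, \<dots>, \<alpha> + k\<close> and for which all slopes of the Newton polygon are
  below \<open>1 / d\<close>. The exceptional \<open>\<alpha>\<close> are those for which some \<open>\<alpha> + l\<close> has a large square or cube
  divisor, or \<open>\<alpha> + 2\<close> is smooth.
\<close>

section \<open>Subrings, subfields and polynomials with restricted coefficients\<close>

text \<open>\<open>galois_group\<close> is about automorphisms of subfields of the complex numbers,
  so the local arguments stay there too: a valuation ring of the complex numbers, found by Zorn's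
  lemma, extends the p-adic valuation. Only membership in this ring is used to compare valuations,
  and fractional ones are removed by passing to powers. The arithmetic conditions must serve all
  \<open>k\<close> up to \<open>kmax x\<close> at once, and \<open>kmax x\<close> may exceed every
  power of \<open>ln x\<close>. They therefore involve \<open>a\<close> and the shifts
  \<open>a + l\<close> only, never a single \<open>k\<close>. Divisibility by large squares is rare
  enough for a union bound over the shifts. For cubes the threshold is only of order
  \<open>ln x\<close>, and the union bound survives because the threshold grows with
  \<open>l\<close>. The bound for smoothness is too weak for a union over the shifts: smoothness is
  excluded at random for \<open>a + 2\<close> alone, which the transposition needs. Everywhere else
  some freedom remains in choosing the shift, and a deterministic count of smooth numbers in short
  intervals suffices.\<close>

definition is_subring :: "complex set \<Rightarrow> bool" where
  "is_subring R \<longleftrightarrow> 0 \<in> R \<and> 1 \<in> R \<and> (\<forall>x\<in>R. \<forall>y\<in>R. x + y \<in> R \<and> x * y \<in> R) \<and> (\<forall>x\<in>R. - x \<in> R)"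

lemma is_subringD:
  assumes "is_subring R"
  shows "0 \<in> R" "1 \<in> R" "x \<in> R \<Longrightarrow> y \<in> R \<Longrightarrow> x + y \<in> R" "x \<in> R \<Longrightarrow> y \<in> R \<Longrightarrow> x * y \<in> R"
    "x \<in> R \<Longrightarrow> - x \<in> R" "x \<in> R \<Longrightarrow> y \<in> R \<Longrightarrow> x - y \<in> R"
proof -
  show "x \<in> R \<Longrightarrow> y \<in> R \<Longrightarrow> x - y \<in> R"
    using assms unfolding is_subring_def by (metis diff_conv_add_uminus)
qed (use assms in \<open>auto simp: is_subring_def\<close>)

lemma subring_power: "is_subring R \<Longrightarrow> x \<in> R \<Longrightarrow> x ^ n \<in> R"
  by (induction n) (auto simp: is_subringD)

lemma subring_sum: "is_subring R \<Longrightarrow> (\<And>i. i \<in> I \<Longrightarrow> f i \<in> R) \<Longrightarrow> sum f I \<in> R"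
  by (induction I rule: infinite_finite_induct) (auto simp: is_subringD)

lemma subring_prod: "is_subring R \<Longrightarrow> (\<And>i. i \<in> I \<Longrightarrow> f i \<in> R) \<Longrightarrow> prod f I \<in> R"
  by (induction I rule: infinite_finite_induct) (auto simp: is_subringD)

lemma subring_of_nat: "is_subring R \<Longrightarrow> of_nat n \<in> R"
  by (induction n) (auto simp: is_subringD)

lemma subring_of_int: "is_subring R \<Longrightarrow> of_int n \<in> R"
  by (cases n) (auto intro!: is_subringD(5)[of R] is_subringD(6)[of R] subring_of_nat simp: is_subringD)

lemma is_subfield_subring: "is_subfield F \<Longrightarrow> is_subring F"
  by (auto simp: is_subfield_def is_subring_def)

lemma subfield_inverse: "is_subfield F \<Longrightarrow> x \<in> F \<Longrightarrow> inverse x \<in> F"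
  by (auto simp: is_subfield_def)

lemma subfield_divide: "is_subfield F \<Longrightarrow> x \<in> F \<Longrightarrow> y \<in> F \<Longrightarrow> x / y \<in> F"
  by (auto simp: is_subfield_def divide_inverse)

lemma subfield_powi: "is_subfield F \<Longrightarrow> x \<in> F \<Longrightarrow> x powi n \<in> F"
  by (auto simp: power_int_def intro!: subring_power is_subfield_subring subfield_inverse)

definition polys_over :: "complex set \<Rightarrow> complex poly set" where
  "polys_over R = {q. \<forall>i. coeff q i \<in> R}"

lemma polys_over_mono: "R \<subseteq> R' \<Longrightarrow> q \<in> polys_over R \<Longrightarrow> q \<in> polys_over R'"
  by (auto simp: polys_over_def)

text \<open>The ring generated by \<open>x\<close> over \<open>R\<close>. Over a subfield and for
  algebraic \<open>x\<close> it is already a field (\<open>adjoin_subfield\<close>), so it also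
  serves as the simple field extension.\<close>

definition adjoin :: "complex set \<Rightarrow> complex \<Rightarrow> complex set" where
  "adjoin R x = {poly q x | q. q \<in> polys_over R}"

context
  fixes R :: "complex set"
  assumes R: "is_subring R"
begin

lemma polys_over_0 [simp]: "0 \<in> polys_over R" and polys_over_1 [simp]: "1 \<in> polys_over R"
  and polys_over_add: "q \<in> polys_over R \<Longrightarrow> r \<in> polys_over R \<Longrightarrow> q + r \<in> polys_over R"
  and polys_over_diff: "q \<in> polys_over R \<Longrightarrow> r \<in> polys_over R \<Longrightarrow> q - r \<in> polys_over R"
  and polys_over_uminus: "q \<in> polys_over R \<Longrightarrow> - q \<in> polys_over R"
  and polys_over_smult: "c \<in> R \<Longrightarrow> q \<in> polys_over R \<Longrightarrow> smult c q \<in> polys_over R"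
  and polys_over_monom: "c \<in> R \<Longrightarrow> monom c n \<in> polys_over R"
  and polys_over_mult: "q \<in> polys_over R \<Longrightarrow> r \<in> polys_over R \<Longrightarrow> q * r \<in> polys_over R"
  and polys_over_pderiv: "q \<in> polys_over R \<Longrightarrow> pderiv q \<in> polys_over R"
  and polys_over_pCons: "pCons c q \<in> polys_over R \<longleftrightarrow> c \<in> R \<and> q \<in> polys_over R"
  using R by (auto simp: polys_over_def is_subringD coeff_mult coeff_pderiv coeff_pCons 
      intro!: subring_sum is_subringD(4)[OF R] is_subringD(2,3)[OF R] subring_of_nat split: nat.splits)

lemma polys_over_const: "c \<in> R \<Longrightarrow> [:c:] \<in> polys_over R"
  by (simp add: polys_over_pCons)

lemma polys_over_linear: "c \<in> R \<Longrightarrow> [:-c, 1:] \<in> polys_over R"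
  by (simp add: polys_over_pCons R is_subringD)

lemma poly_in_subring: "q \<in> polys_over R \<Longrightarrow> x \<in> R \<Longrightarrow> poly q x \<in> R"
  unfolding poly_altdef
  by (rule subring_sum[OF R]) (auto simp: polys_over_def intro!: is_subringD(4)[OF R] subring_power[OF R])

lemma polys_over_prod: "(\<And>i. i \<in> I \<Longrightarrow> f i \<in> polys_over R) \<Longrightarrow> prod f I \<in> polys_over R"
  by (induction I rule: infinite_finite_induct) (auto simp: polys_over_mult)

lemma adjoin_subring: "is_subring (adjoin R x)"
  unfolding is_subring_def
proof (intro conjI ballI)
  show "0 \<in> adjoin R x" "1 \<in> adjoin R x"
    unfolding adjoin_def mem_Collect_eq using polys_over_0 polys_over_1 by (metis poly_0, metis poly_1)
next
  fix y z assume "y \<in> adjoin R x" "z \<in> adjoin R x"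
  then obtain q r where "q \<in> polys_over R" "r \<in> polys_over R" "y = poly q x" "z = poly r x"
    by (auto simp: adjoin_def)
  then show "y + z \<in> adjoin R x" "y * z \<in> adjoin R x"
    unfolding adjoin_def using polys_over_add polys_over_mult by (metis (mono_tags, lifting) mem_Collect_eq poly_add poly_mult)+
next
  fix y assume "y \<in> adjoin R x"
  then show "- y \<in> adjoin R x" unfolding adjoin_def using polys_over_uminus 
    by (smt (verit) mem_Collect_eq poly_minus)
qed

lemma adjoin_superset: "R \<subseteq> adjoin R x"
proof
  fix c assume "c \<in> R"
  then have "[:c:] \<in> polys_over R" "c = poly [:c:] x" by (auto simp: polys_over_const)
  then show "c \<in> adjoin R x" unfolding adjoin_def by blast
qed

lemma adjoin_generator: "x \<in> adjoin R x"
proof -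
  have "[:0, 1:] \<in> polys_over R" "x = poly [:0, 1:] x" using R by (auto simp: polys_over_pCons is_subringD)
  then show ?thesis unfolding adjoin_def by blast
qed

end

text \<open>Multiplication by \<open>x ^ degree q\<close> clears the denominators and leaves the
  value of the reversed polynomial.\<close>

lemma poly_reflect_mult:
  fixes x :: complex
  assumes "is_subring R" "q \<in> polys_over R" "x \<noteq> 0" "x \<in> R"
  shows "x ^ degree q * poly q (inverse x) \<in> R"
proof -
  have "x ^ degree q * poly q (inverse x) = (\<Sum>i\<le>degree q. coeff q i * x ^ (degree q - i))"
    unfolding poly_altdef sum_distrib_left
    by (rule sum.cong) (auto simp: assms(3) power_diff field_simps)
  also have "\<dots> \<in> R"
    using assms by (intro subring_sum is_subringD(4)[OF assms(1)] subring_power) (auto simp: polys_over_def)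
  finally show ?thesis .
qed

section \<open>Valuation rings of the complex numbers\<close>

text \<open>Clearing denominators in \<open>1 / c = q (1 / y)\<close> makes a power of
  \<open>y\<close> a multiple of \<open>c\<close>. For a maximal ring avoiding \<open>1 / c\<close>
  this applies to every nonzero nonunit \<open>y\<close> and yields the last clause of
  \<open>valuation_ring_over\<close>.\<close>

lemma adjoin_eq_inverse_if_nonunit:
  assumes "c \<noteq> 0" "is_subring R" "inverse c \<in> adjoin R (inverse y)" "y \<in> R" "y \<noteq> 0"
  shows "\<exists>n. \<exists>r\<in>R. y ^ n = c * r"
proof -
  obtain q where q: "q \<in> polys_over R" "inverse c = poly q (inverse y)"
    using assms(3) by (auto simp: adjoin_def)
  have "y ^ degree q * poly q (inverse y) \<in> R"
    using poly_reflect_mult[OF assms(2) q(1) assms(5,4)] .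
  moreover have "y ^ degree q = c * (y ^ degree q * poly q (inverse y))"
    using assms(1) by (simp add: q(2)[symmetric])
  ultimately show ?thesis by blast
qed

lemma maximal_subring_without_inverse:
  assumes "is_subring R0" "inverse c \<notin> R0"
  shows "\<exists>R. is_subring R \<and> inverse c \<notin> R \<and> R0 \<subseteq> R \<and> (\<forall>R'. is_subring R' \<longrightarrow> R \<subset> R' \<longrightarrow> inverse c \<in> R')"
proof -
  let ?A = "{R. is_subring R \<and> inverse c \<notin> R \<and> R0 \<subseteq> R}"
  have "\<exists>M\<in>?A. \<forall>X\<in>?A. M \<subseteq> X \<longrightarrow> X = M"
  proof (rule subset_Zorn_nonempty)
    show "?A \<noteq> {}" using assms by blast
    fix C assume C: "C \<noteq> {}" "subset.chain ?A C"
    have sub: "\<And>X. X \<in> C \<Longrightarrow> is_subring X \<and> inverse c \<notin> X \<and> R0 \<subseteq> X" and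
      cmp: "\<And>X Y. X \<in> C \<Longrightarrow> Y \<in> C \<Longrightarrow> X \<subseteq> Y \<or> Y \<subseteq> X"
      using C(2) by (auto simp: subset_chain_def)
    have "is_subring (\<Union>C)"
      unfolding is_subring_def
    proof (intro conjI ballI)
      fix x y assume "x \<in> \<Union>C" "y \<in> \<Union>C"
      then obtain X Y where "X \<in> C" "x \<in> X" "Y \<in> C" "y \<in> Y" by blast
      then obtain Z where "Z \<in> C" "x \<in> Z" "y \<in> Z" using cmp by blast
      then show "x + y \<in> \<Union>C" "x * y \<in> \<Union>C" using sub is_subringD(3,4)[of Z x y] by blast+
    next
      obtain Z where "Z \<in> C" using C(1) by blast
      then show "0 \<in> \<Union>C" "1 \<in> \<Union>C" using sub is_subringD(1,2)[of Z] by blast+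
    next
      fix x assume "x \<in> \<Union>C"
      then obtain Z where "Z \<in> C" "x \<in> Z" by blast
      then show "- x \<in> \<Union>C" using sub is_subringD(5)[of Z x] by blast
    qed
    moreover have "inverse c \<notin> \<Union>C"
    proof
      assume "inverse c \<in> \<Union>C"
      then obtain X where "X \<in> C" "inverse c \<in> X" by (rule UnionE)
      then show False using sub by simp
    qed
    moreover have "R0 \<subseteq> \<Union>C"
    proof -
      obtain X where "X \<in> C" using C(1) by auto
      then show ?thesis using sub[of X] Union_upper[of X C] by (meson order_trans)
    qed
    ultimately show "\<Union>C \<in> ?A" by simp
  qed
  then obtain M where M: "M \<in> ?A" "\<forall>X\<in>?A. M \<subseteq> X \<longrightarrow> X = M" by (rule bexE)
  have "inverse c \<in> R'" if "is_subring R'" "M \<subset> R'" for R'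
  proof (rule ccontr)
    assume "inverse c \<notin> R'"
    moreover have "R0 \<subseteq> R'" by (rule order_trans[OF _ psubset_imp_subset[OF that(2)]]) (use M(1) in simp)
    ultimately have "R' \<in> ?A" using that(1) by simp
    then show False using M(2) that(2) by (metis psubset_eq)
  qed
  then show ?thesis using M(1) by (intro exI[of _ M]) simp
qed

text \<open>The last clause stands in for rank one: a maximal subring avoiding \<open>1 / c\<close> may have larger
  rank, but its maximal ideal is the radical of \<open>c R\<close>.\<close>

definition valuation_ring_over :: "complex \<Rightarrow> complex set \<Rightarrow> bool" where
  "valuation_ring_over c R \<longleftrightarrow> is_subring R \<and> inverse c \<notin> R \<and> (\<forall>x. x \<in> R \<or> inverse x \<in> R) \<and>
     (\<forall>x\<in>R. x \<noteq> 0 \<longrightarrow> inverse x \<notin> R \<longrightarrow> (\<exists>n. \<exists>r\<in>R. x ^ n = c * r))"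

text \<open>The relation at \<open>1 / x\<close> expresses \<open>x ^ degree s\<close> through lower powers of \<open>x\<close>;
  substituting it into \<open>q\<close> contradicts the minimality of \<open>degree q\<close>.\<close>

lemma maximal_subring_degree_reduction:
  assumes R: "is_subring R" "inverse c \<notin> R" "c \<noteq> 0" "c \<in> R"
    and unit: "\<And>s. s \<in> R \<Longrightarrow> inverse (1 - c * s) \<in> R"
    and q: "q \<in> polys_over R" "poly q x = inverse c"
      "\<And>q'. q' \<in> polys_over R \<Longrightarrow> poly q' x = inverse c \<Longrightarrow> degree q \<le> degree q'"
    and s: "s \<in> polys_over R" "poly s (inverse x) = inverse c" "degree s \<le> degree q"
    and x: "x \<noteq> 0"
  shows False
proof -
  define m where "m = degree s"
  define n where "n = degree q"
  have m: "m > 0"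
  proof (rule ccontr)
    assume "\<not> m > 0"
    then obtain a where "s = [:a:]" by (auto simp: m_def elim: degree_eq_zeroE)
    then show False using s R by (auto simp: polys_over_pCons)
  qed
  \<comment> \<open>The constant term of \<open>s\<close> is moved to the other side, where
    \<open>1 - c * coeff s 0\<close> is a unit. The remaining terms are divisible by
    \<open>1 / x\<close>, so multiplication by \<open>x ^ m\<close> expresses \<open>x ^ m\<close>
    through lower powers of \<open>x\<close>.\<close>
  define w where "w = inverse (1 - c * coeff s 0)"
  have s0: "coeff s 0 \<in> R" using s(1) by (auto simp: polys_over_def)
  have ne: "1 - c * coeff s 0 \<noteq> 0"
  proof
    assume "1 - c * coeff s 0 = 0"
    then have "inverse c = coeff s 0" using R(3) by (simp add: field_simps)
    then show False using s0 R by simp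
  qed
  have w: "w \<in> R" using unit[OF s0] by (simp add: w_def)
  obtain s0' s' where s': "s = pCons s0' s'" by (cases s)
  have s'R: "s' \<in> polys_over R" using s(1) s' R(1) by (simp add: polys_over_pCons)
  have degs': "degree s' = m - 1" using m by (auto simp: m_def s')
  have "c * poly s (inverse x) = 1" using s(2) R(3) by simp
  then have "1 - c * coeff s 0 = c * inverse x * poly s' (inverse x)"
    by (simp add: s' algebra_simps)
  moreover have "w * (1 - c * coeff s 0) = 1" using ne by (simp add: w_def)
  ultimately have e1: "1 = c * w * inverse x * poly s' (inverse x)"
    by (simp add: mult_ac)
  define h where "h = reflect_poly s'"
  have hR: "h \<in> polys_over R" using s'R R(1)
    by (auto simp: h_def polys_over_def coeff_reflect_poly is_subringD)
  have h: "poly h x = x ^ (m - 1) * poly s' (inverse x)"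
    using x by (simp add: h_def poly_reflect_poly_nz degs')
  have "x ^ m = x ^ m * (c * w * inverse x * poly s' (inverse x))" using e1 by simp
  also have "\<dots> = c * w * poly h x"
    using m x by (simp add: h power_eq_if)
  finally have xm: "x ^ m = c * w * poly h x" .
  have degh: "degree h \<le> m - 1" unfolding h_def by (metis degree_reflect_poly_le degs')
  define r where "r = lead_coeff q"
  have nm: "n \<ge> m" using s(3) by (simp add: m_def n_def)
  define q' where "q' = q - monom r n + monom (r * c * w) (n - m) * h"
  have rR: "r \<in> R" using q(1) by (auto simp: r_def polys_over_def)
  have q'R: "q' \<in> polys_over R" unfolding q'_def using R rR w q(1) hR
    by (intro polys_over_add[OF R(1)] polys_over_diff[OF R(1)] polys_over_mult[OF R(1)] polys_over_monom[OF R(1)] is_subringD(4)[OF R(1)])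
  have "x ^ n = x ^ (n - m) * x ^ m" using nm by (simp flip: power_add)
  then have "poly q' x = poly q x"
    by (simp add: q'_def poly_monom xm algebra_simps)
  then have "degree q \<le> degree q'" using q(2,3) q'R by auto
  moreover have "degree q' < n"
  proof -
    have "degree (q - monom r n) < n"
    proof -
      have "coeff (q - monom r n) i = 0" if "i \<ge> n" for i
        using that by (cases "i = n") (auto simp: r_def n_def coeff_eq_0)
      moreover have "n > 0" using nm m by simp
      ultimately show ?thesis
        by (metis degree_0 leading_coeff_0_iff not_le)
    qed
    moreover have "degree (monom (r * c * w) (n - m) * h) < n"
    proof -
      have "degree (monom (r * c * w) (n - m) * h) \<le> (n - m) + (m - 1)"
        using degree_mult_le[of "monom (r * c * w) (n - m)" h] degree_monom_le[of "r * c * w" "n - m"] degh by linarith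
      also have "\<dots> < n" using m nm by simp
      finally show ?thesis .
    qed
    ultimately show ?thesis unfolding q'_def by (rule degree_add_less)
  qed
  ultimately show False by (simp add: n_def)
qed

text \<open>A ring maximal among those avoiding \<open>1 / c\<close> is a valuation ring. If
  \<open>x\<close> and \<open>1 / x\<close> were both missing, adjoining either would produce
  \<open>1 / c\<close>; of two such relations of least degree the longer can be shortened by means
  of the other.\<close>

lemma valuation_ring_exists:
  assumes "is_subring R0" "inverse c \<notin> R0" "c \<in> R0" "c \<noteq> 0"
  shows "\<exists>R. valuation_ring_over c R"
proof -
  obtain R where R: "is_subring R" "inverse c \<notin> R" "R0 \<subseteq> R"
    and max: "\<And>R'. is_subring R' \<Longrightarrow> R \<subset> R' \<Longrightarrow> inverse c \<in> R'"
    using maximal_subring_without_inverse[OF assms(1,2)] by blast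
  have cR: "c \<in> R" using R assms by auto
  have inv_adj: "inverse c \<in> adjoin R x" if "x \<notin> R" for x
    using max[OF adjoin_subring[OF R(1)], of x] adjoin_superset[OF R(1), of x] adjoin_generator[OF R(1), of x] that
    by (metis psubsetI)
  have rank: "\<exists>n. \<exists>r\<in>R. x ^ n = c * r" if "x \<in> R" "x \<noteq> 0" "inverse x \<notin> R" for x
    using adjoin_eq_inverse_if_nonunit[OF assms(4) R(1) inv_adj[OF that(3)] that(1,2)] .
  \<comment> \<open>A nonunit \<open>1 - c s\<close> would have a power in \<open>c R\<close>, but
    all its powers are also 1 plus an element of \<open>c R\<close>; subtraction puts
    \<open>1 / c\<close> into \<open>R\<close>.\<close>
  have unit: "inverse (1 - c * s) \<in> R" if s: "s \<in> R" for s
  proof (rule ccontr)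
    assume *: "inverse (1 - c * s) \<notin> R"
    have y: "1 - c * s \<in> R" using is_subringD[OF R(1)] cR s by simp
    have "1 - c * s \<noteq> 0" using * is_subringD(1)[OF R(1)] by auto
    then obtain n r where r: "r \<in> R" "(1 - c * s) ^ n = c * r" using rank[OF y _ *] by blast
    have "\<exists>t\<in>R. (1 - c * s) ^ n = 1 + c * t" for n
    proof (induction n)
      case 0
      show ?case by (rule bexI[of _ 0]) (auto simp: is_subringD(1)[OF R(1)])
    next
      case (Suc n)
      then obtain t where t: "t \<in> R" "(1 - c * s) ^ n = 1 + c * t" by blast
      have "(1 - c * s) ^ Suc n = 1 + c * (t - s * (1 + c * t))" using t(2) by (simp add: algebra_simps)
      moreover have "t - s * (1 + c * t) \<in> R" using t s cR is_subringD[OF R(1)] by simp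
      ultimately show ?case by blast
    qed
    then obtain t where t: "t \<in> R" "(1 - c * s) ^ n = 1 + c * t" by blast
    have "inverse c = r - t" using t r assms(4) by (simp add: field_simps)
    then show False using R t r is_subringD(6)[OF R(1), of r t] by auto
  qed
  have total: "x \<in> R \<or> inverse x \<in> R" for x
  proof (rule ccontr)
    assume *: "\<not> (x \<in> R \<or> inverse x \<in> R)"
    then have x0: "x \<noteq> 0" using is_subringD(1)[OF R(1)] by auto
    have ex: "\<exists>q. q \<in> polys_over R \<and> poly q y = inverse c" if "y \<notin> R" for y
      using inv_adj[OF that] by (auto simp: adjoin_def)
    define P where "P y q \<longleftrightarrow> q \<in> polys_over R \<and> poly q y = inverse c" for y q
    have exm: "\<exists>q. P y q \<and> (\<forall>q'. P y q' \<longrightarrow> degree q \<le> degree q')" if y: "y \<notin> R" for y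
      using ex_has_least_nat[of "P y" _ degree] ex[OF y] unfolding P_def by blast
    obtain q where q: "P x q" "\<And>q'. P x q' \<Longrightarrow> degree q \<le> degree q'" using exm[of x] * by blast
    obtain s where s: "P (inverse x) s" "\<And>q'. P (inverse x) q' \<Longrightarrow> degree s \<le> degree q'"
      using exm[of "inverse x"] * by blast
    show False
    proof (cases "degree s \<le> degree q")
      case True
      show ?thesis
        using q s True by (intro maximal_subring_degree_reduction[OF R(1,2) assms(4) cR unit, of q x s]) (auto simp: P_def x0)
    next
      case False
      show ?thesis
        using q s False by (intro maximal_subring_degree_reduction[OF R(1,2) assms(4) cR unit, of s "inverse x" q]) (auto simp: P_def x0)
    qed
  qed
  show ?thesis unfolding valuation_ring_over_def using R total rank by blast
qed

section \<open>Taylor expansion with remainder in the coefficient ring\<close>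

lemma poly_taylor_1:
  assumes "is_subring R" "q \<in> polys_over R" "x \<in> R" "y \<in> R"
  shows "\<exists>r\<in>R. poly q x = poly q y + (x - y) * r"
  using assms(2)
proof (induction q)
  case 0
  then show ?case using is_subringD(1)[OF assms(1)] by (intro bexI[of _ 0]) auto
next
  case (pCons a q)
  then obtain r where r: "r \<in> R" "poly q x = poly q y + (x - y) * r"
    using polys_over_pCons[OF assms(1)] by auto
  have "poly q y \<in> R" using pCons assms polys_over_pCons[OF assms(1)] poly_in_subring[OF assms(1)] by auto
  then have "poly q y + x * r \<in> R" using r assms is_subringD[OF assms(1)] by auto
  moreover have "poly (pCons a q) x = poly (pCons a q) y + (x - y) * (poly q y + x * r)"
    unfolding poly_pCons r(2) by (simp add: algebra_simps)
  ultimately show ?case by blast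
qed

text \<open>The recursion only adds and multiplies, so the quadratic remainder has its coefficient
  in \<open>R\<close> and no division by 2 occurs. The squared error drives Newton's
  iteration.\<close>

lemma poly_taylor_2:
  assumes "is_subring R" "q \<in> polys_over R" "x \<in> R" "y \<in> R"
  shows "\<exists>r\<in>R. poly q x = poly q y + (x - y) * poly (pderiv q) y + (x - y)\<^sup>2 * r"
  using assms(2)
proof (induction q)
  case 0
  then show ?case using is_subringD(1)[OF assms(1)] by (intro bexI[of _ 0]) auto
next
  case (pCons a q)
  then have q: "q \<in> polys_over R" using polys_over_pCons[OF assms(1)] by auto
  then obtain r where r: "r \<in> R" "poly q x = poly q y + (x - y) * poly (pderiv q) y + (x - y)\<^sup>2 * r"
    using pCons by auto
  have "poly (pderiv q) y \<in> R" using q assms poly_in_subring[OF assms(1)] polys_over_pderiv[OF assms(1)] by auto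
  then have "poly (pderiv q) y + x * r \<in> R" using r assms is_subringD[OF assms(1)] by auto
  moreover have "poly (pCons a q) x = poly (pCons a q) y + (x - y) * poly (pderiv (pCons a q)) y
      + (x - y)\<^sup>2 * (poly (pderiv q) y + x * r)"
    unfolding poly_pCons r(2) by (simp add: pderiv_pCons algebra_simps power2_eq_square)
  ultimately show ?case by blast
qed

text \<open>\<open>R\<close> is one choice of an extension of the p-adic valuation to all complex
  numbers. No value group is formed: for \<open>y \<noteq> 0\<close>, \<open>x / y \<in> R\<close>
  says that \<open>x\<close> has at least the valuation of \<open>y\<close>.\<close>

locale valuation_ring =
  fixes p :: nat and R :: "complex set"
  assumes prime_p: "prime p" and valuation: "valuation_ring_over (of_nat p) R"
begin

text \<open>The maximal ideal, that is, the elements of positive valuation. Zero is added by hand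
  because \<open>inverse 0 = 0\<close> belongs to \<open>R\<close>.\<close>

definition M :: "complex set" where "M = {x \<in> R. x = 0 \<or> inverse x \<notin> R}"

lemma R: "is_subring R" and inverse_p: "inverse (of_nat p) \<notin> R"
  and total: "x \<in> R \<or> inverse x \<in> R"
  using valuation by (auto simp: valuation_ring_over_def)

lemmas R_intros = is_subringD[OF R] subring_power[OF R] subring_sum[OF R] subring_prod[OF R]
  subring_of_nat[OF R] subring_of_int[OF R]

lemma p_nonzero [simp]: "p \<noteq> 0" "(of_nat p :: complex) \<noteq> 0"
  using prime_p by auto

lemma M_imp_R: "x \<in> M \<Longrightarrow> x \<in> R" by (simp add: M_def)

lemma zero_in_M [simp]: "0 \<in> M" by (simp add: M_def R_intros)

lemma one_notin_M [simp]: "1 \<notin> M" by (simp add: M_def R_intros)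

lemma p_in_M: "of_nat p \<in> M" by (simp add: M_def R_intros inverse_p)

lemma not_in_R_imp: "x \<notin> R \<Longrightarrow> inverse x \<in> M"
  using total[of x] by (simp add: M_def)

lemma unitD: "x \<in> R \<Longrightarrow> x \<notin> M \<Longrightarrow> x \<noteq> 0" "x \<in> R \<Longrightarrow> x \<notin> M \<Longrightarrow> inverse x \<in> R"
  by (auto simp: M_def)

lemma unit_inverse: "x \<in> R \<Longrightarrow> x \<notin> M \<Longrightarrow> inverse x \<notin> M"
  by (auto simp: M_def)

lemma M_mult: assumes "x \<in> M" "y \<in> R" shows "x * y \<in> M"
proof -
  have "inverse x = y * inverse (x * y)" if "x * y \<noteq> 0" using that by simp
  then have "x * y = 0 \<or> inverse (x * y) \<notin> R" using assms R_intros(4)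
    by (metis (mono_tags, lifting) M_def mem_Collect_eq mult_zero_left)
  then show ?thesis using assms R_intros(4) by (auto simp: M_def)
qed

lemma M_mult': "y \<in> R \<Longrightarrow> x \<in> M \<Longrightarrow> y * x \<in> M"
  using M_mult by (simp add: mult.commute)

lemma M_prime: assumes "x * y \<in> M" "x \<in> R" "y \<in> R" shows "x \<in> M \<or> y \<in> M"
proof (rule ccontr)
  assume *: "\<not> ?thesis"
  then have "inverse x * inverse y \<in> R" using unitD assms R_intros(4) by blast
  moreover have "x * y \<noteq> 0" using * unitD assms by auto
  ultimately show False using assms(1) by (auto simp: M_def)
qed

text \<open>Of two nonzero elements one divides the other in \<open>R\<close>; taking it out leaves
  a cofactor in \<open>R\<close>.\<close>

lemma M_add: assumes "x \<in> M" "y \<in> M" shows "x + y \<in> M"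
proof (cases "x = 0 \<or> y = 0")
  case False
  have "x * inverse y \<in> R \<or> y * inverse x \<in> R" using total[of "x * inverse y"] by (simp add: mult.commute)
  then show ?thesis
  proof
    assume "x * inverse y \<in> R"
    then have "y * (x * inverse y + 1) \<in> M" using assms R_intros by (intro M_mult) auto
    moreover have "y * (x * inverse y + 1) = x + y" using False by (simp add: field_simps)
    ultimately show ?thesis by simp
  next
    assume "y * inverse x \<in> R"
    then have "x * (y * inverse x + 1) \<in> M" using assms R_intros by (intro M_mult) auto
    moreover have "x * (y * inverse x + 1) = x + y" using False by (simp add: field_simps)
    ultimately show ?thesis by simp
  qed
qed (use assms in auto)

lemma M_uminus: "x \<in> M \<Longrightarrow> - x \<in> M"
  using M_mult[of x "-1"] R_intros(2,5) by simp

lemma M_diff: "x \<in> M \<Longrightarrow> y \<in> M \<Longrightarrow> x - y \<in> M"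
  using M_add[of x "- y"] M_uminus by simp

lemma M_sum: "(\<And>i. i \<in> I \<Longrightarrow> f i \<in> M) \<Longrightarrow> sum f I \<in> M"
  by (induction I rule: infinite_finite_induct) (auto simp: M_add)

lemma M_power: "x \<in> M \<Longrightarrow> n > 0 \<Longrightarrow> x ^ n \<in> M"
  by (cases n) (auto intro: M_mult R_intros M_imp_R)

lemma M_prod_imp: "finite I \<Longrightarrow> (\<And>i. i \<in> I \<Longrightarrow> f i \<in> R) \<Longrightarrow> prod f I \<in> M \<Longrightarrow> \<exists>i\<in>I. f i \<in> M"
proof (induction I rule: finite_induct)
  case (insert i I)
  then have "f i \<in> M \<or> prod f I \<in> M" by (intro M_prime) (auto intro!: R_intros)
  then show ?case using insert by auto
qed auto

lemma M_prod_mset_imp: "(\<And>i. i \<in># I \<Longrightarrow> f i \<in> R) \<Longrightarrow> (\<Prod>i\<in>#I. f i) \<in> M \<Longrightarrow> \<exists>i. i \<in># I \<and> f i \<in> M"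
proof (induction I)
  case (add i I)
  have "(\<Prod>i\<in>#J. f i) \<in> R" if "\<And>i. i \<in># J \<Longrightarrow> f i \<in> R" for J
    using that by (induction J) (auto intro!: R_intros)
  then have "f i \<in> M \<or> (\<Prod>i\<in>#I. f i) \<in> M" using add by (intro M_prime) auto
  then show ?case using add by auto
qed auto

lemma M_power_imp: "x ^ n \<in> M \<Longrightarrow> x \<in> R \<Longrightarrow> x \<in> M"
  using M_prod_imp[of "{..<n}" "\<lambda>_. x"] by auto

lemma unit_prod: "(\<And>i. i \<in> I \<Longrightarrow> f i \<in> R \<and> f i \<notin> M) \<Longrightarrow> finite I \<Longrightarrow> prod f I \<in> R \<and> prod f I \<notin> M"
  using M_prod_imp[of I f] subring_prod[OF R, of I f] by (metis (no_types))

text \<open>By Bezout an integer prime to \<open>p\<close> and lying in \<open>M\<close> would put 1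
  into \<open>M\<close>.\<close>

lemma of_int_notin_M: assumes "\<not> int p dvd c" shows "of_int c \<notin> M"
proof
  assume c: "of_int c \<in> M"
  have "prime (int p)" using prime_p by simp
  then have "coprime c (int p)" using assms by (metis coprime_commute prime_imp_coprime)
  then obtain u v where "c * u + int p * v = 1"
    using bezout_int[of c "int p"] by (auto simp: mult.commute)
  then have "(of_int c * of_int u + of_nat p * of_int v :: complex) = 1"
    by (metis of_int_1 of_int_add of_int_mult of_int_of_nat_eq)
  moreover have "(of_int c * of_int u + of_nat p * of_int v :: complex) \<in> M"
    using c p_in_M by (intro M_add M_mult R_intros)
  ultimately show False by simp
qed

lemma of_nat_notin_M: "\<not> p dvd c \<Longrightarrow> of_nat c \<notin> M"
  using of_int_notin_M[of "int c"] by simp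

lemma of_int_in_M: "int p dvd c \<Longrightarrow> of_int c \<in> M"
  by (auto elim!: dvdE intro!: M_mult p_in_M R_intros)

lemma M_imp_power: "x \<in> M \<Longrightarrow> \<exists>n. \<exists>r\<in>R. x ^ n = of_nat p * r"
proof (cases "x = 0")
  case True
  then show ?thesis by (intro exI[of _ 1] bexI[of _ 0]) (auto simp: R_intros)
next
  assume "x \<in> M" "x \<noteq> 0"
  then show ?thesis using valuation unfolding valuation_ring_over_def M_def by blast
qed

lemma poly_in_R: "q \<in> polys_over R \<Longrightarrow> x \<in> R \<Longrightarrow> poly q x \<in> R"
  by (rule poly_in_subring[OF R])

lemma poly_cong_M:
  assumes "q \<in> polys_over R" "x \<in> R" "y \<in> R" "x - y \<in> M"
  shows "poly q x - poly q y \<in> M"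
  using poly_taylor_1[OF R assms(1,2,3)] assms(4) by (auto intro: M_mult)

text \<open>Valuation rings are integrally closed: for \<open>x\<close> outside \<open>R\<close>,
  division of the equation by the top power of \<open>x\<close> turns all lower terms into elements
  of \<open>M\<close> and the leading term into 1.\<close>

lemma root_in_R:
  assumes "q \<in> polys_over R" "lead_coeff q = 1" "poly q x = 0"
  shows "x \<in> R"
proof (rule ccontr)
  assume x: "x \<notin> R"
  then have x0: "x \<noteq> 0" using R_intros(1) by auto
  have y: "inverse x \<in> M" using not_in_R_imp[OF x] .
  define n where "n = degree q"
  have "0 = poly q x" using assms by simp
  also have "\<dots> = (\<Sum>i<n. coeff q i * x ^ i) + x ^ n"
    unfolding poly_altdef n_def using assms(2) by (simp add: lessThan_Suc_atMost[symmetric])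
  finally have "0 = inverse x ^ n * ((\<Sum>i<n. coeff q i * x ^ i) + x ^ n)" by simp
  also have "\<dots> = (\<Sum>i<n. coeff q i * inverse x ^ (n - i)) + 1"
    using x0 by (simp add: distrib_left sum_distrib_left power_diff field_simps flip: power_mult_distrib)
  finally have "(\<Sum>i<n. coeff q i * inverse x ^ (n - i)) = -1" by (simp add: eq_neg_iff_add_eq_0)
  moreover have "(\<Sum>i<n. coeff q i * inverse x ^ (n - i)) \<in> M"
    using assms(1) y by (intro M_sum M_mult' M_power) (auto simp: polys_over_def)
  ultimately show False using M_uminus[of "-1"] by auto
qed

end

lemma valuation_ring_prime_exists:
  assumes "prime p"
  shows "\<exists>R. valuation_ring p R"
proof -
  have sub: "is_subring (\<int> :: complex set)" by (auto simp: is_subring_def)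
  have "inverse (of_nat p) \<notin> (\<int> :: complex set)"
  proof
    assume "inverse (of_nat p) \<in> (\<int> :: complex set)"
    then obtain z where "inverse (of_nat p) = (of_int z :: complex)" by (auto elim: Ints_cases)
    then have "of_int (int p * z) = (1 :: complex)" using assms by (simp add: field_simps)
    then have "int p * z = 1" by (simp only: of_int_eq_1_iff)
    then show False using assms by (metis abs_of_nat abs_zmult_eq_1 not_prime_1 of_nat_1_eq_iff)
  qed
  then show ?thesis using valuation_ring_exists[OF sub, of "of_nat p"] assms
    by (auto simp: valuation_ring_def)
qed

section \<open>Minimal polynomials and unramified subfields\<close>

text \<open>The leading term of \<open>q\<close> is cancelled by a multiple of \<open>g\<close> with
  coefficients in \<open>F\<close>, so quotient and remainder never leave
  \<open>polys_over F\<close>.\<close>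

lemma polys_over_division:
  assumes F: "is_subfield F" and g: "g \<in> polys_over F" "g \<noteq> 0" and q: "q \<in> polys_over F"
  shows "\<exists>s r. s \<in> polys_over F \<and> r \<in> polys_over F \<and> q = s * g + r \<and> (r = 0 \<or> degree r < degree g)"
  using q
proof (induction "degree q" arbitrary: q rule: less_induct)
  case less
  note FR = is_subfield_subring[OF F]
  show ?case
  proof (cases "q = 0 \<or> degree q < degree g")
    case True
    then show ?thesis using less.prems by (intro exI[of _ 0] exI[of _ q]) (auto simp: FR)
  next
    case False
    define c where "c = lead_coeff q / lead_coeff g"
    have c: "c \<in> F" using less.prems g F unfolding c_def by (intro subfield_divide) (auto simp: polys_over_def)
    define t where "t = monom c (degree q - degree g)"
    have tF: "t \<in> polys_over F" using c FR by (simp add: t_def polys_over_monom)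
    have "lead_coeff q \<noteq> 0" using False by simp
    then have "c \<noteq> 0" using g by (simp add: c_def)
    then have deg: "degree (t * g) = degree q" using g False
      by (subst degree_mult_eq) (auto simp: t_def degree_monom_eq)
    have "coeff (t * g) (degree q) = lead_coeff (t * g)" using deg by simp
    also have "\<dots> = lead_coeff t * lead_coeff g" by (rule lead_coeff_mult)
    also have "\<dots> = lead_coeff q" using g by (simp add: t_def c_def lead_coeff_monom del: coeff_monom)
    finally have lead: "coeff (t * g) (degree q) = lead_coeff q" .
    define q' where "q' = q - t * g"
    have q'F: "q' \<in> polys_over F" using less.prems tF g FR by (simp add: q'_def polys_over_diff polys_over_mult)
    have "q' = 0 \<or> degree q' < degree q"
    proof (cases "degree q = 0")
      case True
      have "degree q' \<le> degree q" unfolding q'_def by (rule degree_diff_le) (simp_all add: deg)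
      then have "degree q' = 0" using True by simp
      moreover have "coeff q' 0 = 0" using lead True by (simp add: q'_def)
      ultimately show ?thesis by (metis leading_coeff_0_iff)
    next
      case False
      have "degree q' \<le> degree q" unfolding q'_def by (rule degree_diff_le) (simp_all add: deg)
      moreover have "coeff q' (degree q) = 0" using lead by (simp add: q'_def)
      ultimately show ?thesis using False by (metis le_neq_implies_less leading_coeff_0_iff)
    qed
    then obtain s r where "s \<in> polys_over F" "r \<in> polys_over F" "q' = s * g + r" "r = 0 \<or> degree r < degree g"
      using less.hyps[of q'] q'F polys_over_0[OF FR] by (metis add.right_neutral mult_zero_left)
    then show ?thesis using tF FR
      by (intro exI[of _ "s + t"] exI[of _ r]) (auto simp: q'_def polys_over_add algebra_simps)
  qed
qed

definition is_minpoly :: "complex set \<Rightarrow> complex \<Rightarrow> complex poly \<Rightarrow> bool" where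
  "is_minpoly F w g \<longleftrightarrow> g \<in> polys_over F \<and> lead_coeff g = 1 \<and> poly g w = 0 \<and>
     (\<forall>q\<in>polys_over F. poly q w = 0 \<longrightarrow> q \<noteq> 0 \<longrightarrow> degree g \<le> degree q)"

definition algebraic_over :: "complex set \<Rightarrow> complex \<Rightarrow> bool" where
  "algebraic_over F w \<longleftrightarrow> (\<exists>g\<in>polys_over F. g \<noteq> 0 \<and> poly g w = 0)"

lemma minpoly_exists:
  assumes F: "is_subfield F" and "algebraic_over F w"
  shows "\<exists>g. is_minpoly F w g"
proof -
  define P where "P g \<longleftrightarrow> g \<in> polys_over F \<and> g \<noteq> 0 \<and> poly g w = 0" for g
  obtain g where g: "P g" "\<And>q. P q \<Longrightarrow> degree g \<le> degree q"
    using ex_has_least_nat[of P _ degree] assms(2) unfolding P_def algebraic_over_def by blast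
  define c where "c = inverse (lead_coeff g)"
  have "c \<in> F" using g F by (auto simp: c_def P_def polys_over_def intro: subfield_inverse)
  moreover have "c \<noteq> 0" using g by (auto simp: c_def P_def)
  ultimately have "is_minpoly F w (smult c g)"
    using g polys_over_smult[OF is_subfield_subring[OF F]] unfolding is_minpoly_def P_def
    by (auto simp: c_def)
  then show ?thesis by blast
qed

lemma minpoly_degree_pos: "is_minpoly F w g \<Longrightarrow> degree g > 0"
  unfolding is_minpoly_def by (rule ccontr) (auto elim!: degree_eq_zeroE)

lemma minpoly_nonzero: "is_minpoly F w g \<Longrightarrow> g \<noteq> 0"
  by (auto simp: is_minpoly_def)

lemma minpoly_dvd:
  assumes F: "is_subfield F" and g: "is_minpoly F w g" and q: "q \<in> polys_over F" "poly q w = 0"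
  shows "\<exists>s\<in>polys_over F. q = s * g"
proof -
  obtain s r where sr: "s \<in> polys_over F" "r \<in> polys_over F" "q = s * g + r" "r = 0 \<or> degree r < degree g"
    using polys_over_division[OF F _ minpoly_nonzero[OF g] q(1)] g by (auto simp: is_minpoly_def)
  have "poly r w = 0" using sr(3) q(2) g by (auto simp: is_minpoly_def)
  then have "r = 0" using sr(2,4) g unfolding is_minpoly_def by (meson leD)
  then show ?thesis using sr by auto
qed

lemma adjoin_reduced:
  assumes F: "is_subfield F" and g: "g \<in> polys_over F" "g \<noteq> 0" "poly g w = 0" and y: "y \<in> adjoin F w"
  shows "\<exists>r\<in>polys_over F. y = poly r w \<and> (r = 0 \<or> degree r < degree g)"
proof -
  obtain q where q: "q \<in> polys_over F" "y = poly q w" using y by (auto simp: adjoin_def)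
  obtain s r where sr: "s \<in> polys_over F" "r \<in> polys_over F" "q = s * g + r" "r = 0 \<or> degree r < degree g"
    using polys_over_division[OF F g(1,2) q(1)] by blast
  then show ?thesis using q g(3) by (intro bexI[of _ r]) auto
qed

text \<open>Inverses come from Euclid's algorithm: dividing the minimal polynomial as
  \<open>g = s * q + r\<close> and evaluating at \<open>w\<close> gives
  \<open>1 / q(w) = - s(w) / r(w)\<close>, and \<open>r\<close> has smaller degree than
  \<open>q\<close>.\<close>

lemma adjoin_subfield:
  assumes F: "is_subfield F" and w: "algebraic_over F w"
  shows "is_subfield (adjoin F w)"
proof -
  note FR = is_subfield_subring[OF F]
  note AR = adjoin_subring[OF FR, of w]
  obtain g where g: "is_minpoly F w g" using minpoly_exists[OF F w] by blast
  have key: "inverse (poly q w) \<in> adjoin F w"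
    if "q \<in> polys_over F" "degree q < degree g" "poly q w \<noteq> 0" for q
    using that
  proof (induction "degree q" arbitrary: q rule: less_induct)
    case less
    show ?case
    proof (cases "degree q = 0")
      case True
      then obtain c where "q = [:c:]" by (elim degree_eq_zeroE)
      then show ?thesis using less.prems(1) subfield_inverse[OF F] adjoin_superset[OF FR, of w]
        by (auto simp: polys_over_pCons[OF FR])
    next
      case False
      have q0: "q \<noteq> 0" using less.prems by auto
      obtain s r where sr: "s \<in> polys_over F" "r \<in> polys_over F" "g = s * q + r" "r = 0 \<or> degree r < degree q"
        using polys_over_division[OF F less.prems(1) q0, of g] g by (auto simp: is_minpoly_def)
      have s0: "s \<noteq> 0" using sr less.prems(2) minpoly_nonzero[OF g] by auto
      have degg: "degree g = degree s + degree q"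
      proof -
        have "degree (s * q) = degree s + degree q" using s0 q0 by (rule degree_mult_eq)
        then show ?thesis using sr(3,4) False by (auto simp: degree_add_eq_left)
      qed
      have eq: "poly s w * poly q w + poly r w = 0" using sr(3) g by (auto simp: is_minpoly_def)
      have "poly s w \<noteq> 0"
      proof
        assume "poly s w = 0"
        then have "degree g \<le> degree s" using g sr(1) s0 by (auto simp: is_minpoly_def)
        then show False using degg False by simp
      qed
      then have r0: "poly r w \<noteq> 0" using eq less.prems(3) by auto
      then have "r \<noteq> 0" by auto
      then have "inverse (poly r w) \<in> adjoin F w" using less.hyps[of r] sr r0 less.prems(2) by auto
      moreover have "poly s w \<in> adjoin F w" using sr(1) by (auto simp: adjoin_def)
      moreover have "inverse (poly q w) = - (poly s w * inverse (poly r w))"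
        using eq r0 less.prems(3) by (simp add: field_simps eq_neg_iff_add_eq_0)
      ultimately show ?thesis using is_subringD(4,5)[OF AR] by auto
    qed
  qed
  have "inverse y \<in> adjoin F w" if y: "y \<in> adjoin F w" for y
  proof (cases "y = 0")
    case True
    then show ?thesis using y by simp
  next
    case False
    obtain r where "r \<in> polys_over F" "y = poly r w" "r = 0 \<or> degree r < degree g"
      using adjoin_reduced[OF F _ minpoly_nonzero[OF g] _ y] g by (auto simp: is_minpoly_def)
    then show ?thesis using key[of r] False by auto
  qed
  then show ?thesis using AR unfolding is_subring_def is_subfield_def by blast
qed

lemma Rats_subset_subfield: assumes "is_subfield F" shows "\<rat> \<subseteq> F"
proof
  fix x :: complex assume "x \<in> \<rat>"
  then obtain a b where "x = of_int a / of_int b" by (elim Rats_cases')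
  then show "x \<in> F" using assms by (auto intro!: subfield_divide subring_of_int is_subfield_subring)
qed

lemma Rats_subfield: "is_subfield \<rat>"
  by (auto simp: is_subfield_def)

section \<open>Subfields unramified at \<open>p\<close>\<close>

context valuation_ring
begin

text \<open>With value 1 at \<open>p\<close>, the valuation takes only integral values on
  \<open>F\<close>. The elementwise form passes at once to unions of chains.\<close>

definition unramified :: "complex set \<Rightarrow> bool" where
  "unramified F \<longleftrightarrow> (\<forall>y\<in>F. y \<noteq> 0 \<longrightarrow> (\<exists>n::int. \<exists>u. u \<in> R \<and> u \<notin> M \<and> y = of_nat p powi n * u))"

lemma unramified_Rats: "unramified \<rat>"
proof -
  have int: "\<exists>n::int. \<exists>u. u \<in> R \<and> u \<notin> M \<and> of_int a = of_nat p powi n * u" if a: "a \<noteq> 0" for a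
  proof -
    have nu: "\<not> is_unit (int p)" using prime_p by (auto dest: prime_gt_1_nat)
    then obtain b where b: "a = int p ^ multiplicity (int p) a * b" "\<not> int p dvd b"
      using multiplicity_decompose'[OF a nu] by metis
    have "of_int a = (of_nat p powi int (multiplicity (int p) a) * of_int b :: complex)"
      by (subst b(1)) simp
    moreover have "of_int b \<in> R" "of_int b \<notin> M" using of_int_notin_M[OF b(2)] R_intros by auto
    ultimately show ?thesis by blast
  qed
  show ?thesis unfolding unramified_def
  proof (intro ballI impI)
    fix y :: complex assume "y \<in> \<rat>" "y \<noteq> 0"
    then obtain a b where ab: "y = of_int a / of_int b" by (elim Rats_cases')
    then have "a \<noteq> 0" "b \<noteq> 0" using \<open>y \<noteq> 0\<close> by auto
    then obtain n u m v where 1: "u \<in> R" "u \<notin> M" "of_int a = of_nat p powi n * u"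
      "v \<in> R" "v \<notin> M" "of_int b = of_nat p powi m * v" using int by meson
    have "y = of_nat p powi (n - m) * (u * inverse v)"
      unfolding ab 1 by (simp add: power_int_diff field_simps)
    moreover have "u * inverse v \<in> R" using 1 unitD R_intros by blast
    moreover have "u * inverse v \<notin> M" using 1 unitD unit_inverse M_prime by blast
    ultimately show "\<exists>n::int. \<exists>u. u \<in> R \<and> u \<notin> M \<and> y = of_nat p powi n * u" by blast
  qed
qed

text \<open>A maximal unramified subfield takes the place of the maximal unramified extension of the
  \<open>p\<close>-adic numbers, without any completion.\<close>

lemma maximal_unramified_exists:
  "\<exists>L. is_subfield L \<and> unramified L \<and> (\<forall>L'. is_subfield L' \<longrightarrow> unramified L' \<longrightarrow> L \<subseteq> L' \<longrightarrow> L' = L)"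
proof -
  let ?A = "{F. is_subfield F \<and> unramified F}"
  have "\<exists>M\<in>?A. \<forall>X\<in>?A. M \<subseteq> X \<longrightarrow> X = M"
  proof (rule subset_Zorn_nonempty)
    show "?A \<noteq> {}" using Rats_subfield unramified_Rats by auto
    fix C assume C: "C \<noteq> {}" "subset.chain ?A C"
    have sub: "is_subfield X" "unramified X" if "X \<in> C" for X
      using C(2) that by (auto simp: subset_chain_def)
    have cmp: "X \<subseteq> Y \<or> Y \<subseteq> X" if "X \<in> C" "Y \<in> C" for X Y
      using C(2) that by (auto simp: subset_chain_def)
    have "is_subfield (\<Union>C)"
      unfolding is_subfield_def
    proof (intro conjI ballI)
      fix x y assume "x \<in> \<Union>C" "y \<in> \<Union>C"
      then obtain X Y where "X \<in> C" "x \<in> X" "Y \<in> C" "y \<in> Y" by blast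
      then obtain Z where Z: "Z \<in> C" "x \<in> Z" "y \<in> Z" using cmp[of X Y] by blast
      then have "x + y \<in> Z" "x * y \<in> Z" using sub(1)[of Z] by (auto simp: is_subfield_def)
      then show "x + y \<in> \<Union>C" "x * y \<in> \<Union>C" using Z by blast+
    next
      obtain Z where Z: "Z \<in> C" using C(1) by blast
      then have "0 \<in> Z" "1 \<in> Z" using sub(1)[of Z] by (auto simp: is_subfield_def)
      then show "0 \<in> \<Union>C" "1 \<in> \<Union>C" using Z by blast+
    next
      fix x assume "x \<in> \<Union>C"
      then obtain Z where Z: "Z \<in> C" "x \<in> Z" by blast
      then have "- x \<in> Z" "inverse x \<in> Z" using sub(1)[of Z] by (auto simp: is_subfield_def)
      then show "- x \<in> \<Union>C" "inverse x \<in> \<Union>C" using Z by blast+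
    qed
    moreover have "unramified (\<Union>C)"
      unfolding unramified_def
    proof (intro ballI impI)
      fix y assume "y \<in> \<Union>C" "y \<noteq> 0"
      then obtain Z where "Z \<in> C" "y \<in> Z" by blast
      then show "\<exists>n::int. \<exists>u. u \<in> R \<and> u \<notin> M \<and> y = of_nat p powi n * u"
        using sub(2)[of Z] \<open>y \<noteq> 0\<close> unfolding unramified_def by blast
    qed
    ultimately show "\<Union>C \<in> ?A" by simp
  qed
  then obtain L where "L \<in> ?A" "\<forall>X\<in>?A. L \<subseteq> X \<longrightarrow> X = L" by (rule bexE)
  then show ?thesis by (intro exI[of _ L]) simp
qed

text \<open>Extraction of the content: the least valuation among the coefficients is an integer, so
  a power of \<open>p\<close> normalises it to 0.\<close>

lemma unramified_scale:
  assumes F: "is_subfield F" "unramified F" and q: "q \<in> polys_over F" "q \<noteq> 0"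
  shows "\<exists>n::int. \<exists>r. r \<in> polys_over F \<and> r \<in> polys_over R \<and> q = smult (of_nat p powi n) r \<and> (\<exists>i. coeff r i \<notin> M)"
proof -
  define I where "I = {i. coeff q i \<noteq> 0}"
  have I: "finite I" "I \<noteq> {}" 
  proof -
    show "finite I" unfolding I_def
      by (rule finite_subset[of _ "{..degree q}"]) (auto intro: le_degree)
    show "I \<noteq> {}" using q(2) leading_coeff_0_iff[of q] unfolding I_def by blast
  qed
  have "\<forall>i\<in>I. \<exists>n::int. \<exists>u. u \<in> R \<and> u \<notin> M \<and> coeff q i = of_nat p powi n * u"
    using F(2) q(1) by (auto simp: I_def unramified_def polys_over_def)
  then obtain n :: "nat \<Rightarrow> int" and u where nu: "\<And>i. i \<in> I \<Longrightarrow> u i \<in> R \<and> u i \<notin> M \<and> coeff q i = of_nat p powi n i * u i"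
    by metis
  define N where "N = Min (n ` I)"
  have "N \<in> n ` I" unfolding N_def using I by (intro Min_in) auto
  then obtain i0 where i0: "i0 \<in> I" "n i0 = N" by blast
  have le: "N \<le> n i" if "i \<in> I" for i using I that by (auto simp: N_def)
  define r where "r = smult (of_nat p powi (-N)) q"
  have pF: "of_nat p powi k \<in> F" for k
    using F(1) by (intro subfield_powi subring_of_nat is_subfield_subring)
  have "r \<in> polys_over F" unfolding r_def using pF q(1) F(1) by (intro polys_over_smult is_subfield_subring)
  moreover have q_eq: "q = smult (of_nat p powi N) r" by (simp add: r_def power_int_minus)
  moreover have coeff_r: "coeff r i = of_nat p ^ nat (n i - N) * u i" if "i \<in> I" for i
  proof -
    have "coeff r i = of_nat p powi (n i - N) * u i"
      using nu[OF that] by (simp add: r_def power_int_diff power_int_minus field_simps)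
    then show ?thesis using le[OF that] by (simp add: power_int_def)
  qed
  have "r \<in> polys_over R" unfolding polys_over_def
  proof safe
    fix i show "coeff r i \<in> R"
    proof (cases "i \<in> I")
      case True
      then show ?thesis using nu[OF True] by (simp add: coeff_r R_intros)
    qed (auto simp: r_def I_def R_intros)
  qed
  moreover have "coeff r i0 \<notin> M" using nu[OF i0(1)] i0 by (simp add: coeff_r)
  ultimately show ?thesis by blast
qed

text \<open>If \<open>a\<close> in \<open>F\<close> is close enough to \<open>u\<close>, then
  \<open>poly r a\<close> and \<open>poly r u\<close> differ by a unit factor, and the former lies
  in the unramified field. How close is enough is read off from \<open>1 / poly r u\<close>, which
  is again a power of \<open>p\<close> times an integral polynomial value at
  \<open>u\<close>.\<close>

lemma unramified_adjoin_limit: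
  assumes F: "is_subfield F" "unramified F" and u: "u \<in> R" "algebraic_over F u"
    and lim: "\<And>N::nat. \<exists>a\<in>F \<inter> R. \<exists>r\<in>R. u - a = of_nat p ^ N * r"
  shows "unramified (adjoin F u)"
  unfolding unramified_def
proof (intro ballI impI)
  fix y assume y: "y \<in> adjoin F u" "y \<noteq> 0"
  have scale: "\<exists>n::int. \<exists>r. r \<in> polys_over F \<and> r \<in> polys_over R \<and> z = of_nat p powi n * poly r u"
    if z: "z \<in> adjoin F u" "z \<noteq> 0" for z
  proof -
    obtain q where q: "q \<in> polys_over F" "z = poly q u" using z by (auto simp: adjoin_def)
    then have "q \<noteq> 0" using z by auto
    then show ?thesis using unramified_scale[OF F q(1)] q(2) by force
  qed
  obtain n r where r: "r \<in> polys_over F" "r \<in> polys_over R" "y = of_nat p powi n * poly r u"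
    using scale[OF y] by blast
  define z where "z = poly r u"
  have z: "z \<noteq> 0" "z \<in> R" using y r poly_in_R u(1) by (auto simp: z_def)
  have "z \<in> adjoin F u" using r by (auto simp: z_def adjoin_def)
  then have "inverse z \<in> adjoin F u" using adjoin_subfield[OF F(1) u(2)] subfield_inverse by blast
  then obtain m s where s: "s \<in> polys_over R" "inverse z = of_nat p powi m * poly s u"
    using scale z(1) by (metis inverse_nonzero_iff_nonzero)
  \<comment> \<open>\<open>K + m > 0\<close> makes the relative error
    \<open>e = (u - a) * v / z\<close> an element of \<open>M\<close>, so that \<open>1 - e\<close>
    is a unit.\<close>
  define K where "K = nat (1 - m)"
  obtain a t where a: "a \<in> F" "a \<in> R" "t \<in> R" "u - a = of_nat p ^ K * t" using lim[of K] by auto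
  obtain v where v: "v \<in> R" "poly r u = poly r a + (u - a) * v"
    using poly_taylor_1[OF R r(2) u(1) a(2)] by blast
  define e where "e = of_nat p powi (int K + m) * poly s u * t * v"
  have "of_nat p powi (int K + m) \<in> M"
  proof -
    have "int K + m > 0" by (simp add: K_def)
    then have "of_nat p powi (int K + m) = (of_nat p :: complex) ^ nat (int K + m)" "nat (int K + m) > 0"
      by (auto simp: power_int_def)
    then show ?thesis using M_power[OF p_in_M] by simp
  qed
  then have e: "e \<in> M" unfolding e_def using s u a v poly_in_R by (intro M_mult) auto
  have "z * e = of_nat p ^ K * (z * (of_nat p powi m * poly s u)) * t * v"
    by (simp add: e_def power_int_add mult_ac)
  also have "\<dots> = of_nat p ^ K * t * v" using z(1) s(2)[symmetric] by simp
  finally have ze: "poly r a = z * (1 - e)" using v(2) a(4) by (simp add: z_def algebra_simps)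
  have e1: "1 - e \<in> R" "1 - e \<notin> M" using e M_imp_R R_intros M_add[of "1 - e" e] by auto
  have "poly r a \<in> F" using r(1) a(1) by (intro poly_in_subring[OF is_subfield_subring[OF F(1)]])
  moreover have "poly r a \<noteq> 0" using ze z(1) unitD(1)[OF e1] by simp
  ultimately obtain k w where w: "w \<in> R" "w \<notin> M" "poly r a = of_nat p powi k * w"
    using F(2) unfolding unramified_def by blast
  have "z = of_nat p powi k * (w * inverse (1 - e))"
    using ze w(3) unitD(1)[OF e1] by (simp add: field_simps)
  then have "y = of_nat p powi (n + k) * (w * inverse (1 - e))"
    using r(3) by (simp add: z_def power_int_add)
  moreover have "w * inverse (1 - e) \<in> R" using w unitD(2)[OF e1] R_intros(4) by blast
  moreover have "w * inverse (1 - e) \<notin> M" using w unitD(2)[OF e1] unit_inverse[OF e1] M_prime by blast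
  ultimately show "\<exists>n::int. \<exists>u. u \<in> R \<and> u \<notin> M \<and> y = of_nat p powi n * u" by blast
qed

text \<open>By minimality the residue of \<open>u\<close> has degree \<open>degree h\<close> over the residue field of \<open>F\<close>, so
  a polynomial of smaller degree with some unit coefficient takes a unit value at \<open>w\<close>.\<close>

lemma unramified_adjoin_residue:
  assumes F: "is_subfield F" "unramified F" and u: "u \<in> R"
    and h: "h \<in> polys_over F" "h \<in> polys_over R" "lead_coeff h = 1" "poly h u \<in> M"
    and minimal: "\<And>h'. h' \<in> polys_over F \<Longrightarrow> h' \<in> polys_over R \<Longrightarrow> lead_coeff h' = 1 \<Longrightarrow> poly h' u \<in> M \<Longrightarrow>
      degree h \<le> degree h'"
    and w: "poly h w = 0" "u - w \<in> M"
  shows "unramified (adjoin F w)"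
  unfolding unramified_def
proof (intro ballI impI)
  fix y assume y: "y \<in> adjoin F w" "y \<noteq> 0"
  have FR: "is_subring F" using F(1) by (rule is_subfield_subring)
  have wR: "w \<in> R" using root_in_R[OF h(2,3) w(1)] .
  have h0: "h \<noteq> 0" using h(3) by auto
  obtain q where q: "q \<in> polys_over F" "y = poly q w" "q = 0 \<or> degree q < degree h"
    using adjoin_reduced[OF F(1) h(1) h0 w(1) y(1)] by blast
  have q0: "q \<noteq> 0" using y q by auto
  obtain n r where r: "r \<in> polys_over F" "r \<in> polys_over R" "q = smult (of_nat p powi n) r" "\<exists>i. coeff r i \<notin> M"
    using unramified_scale[OF F q(1) q0] by blast
  have degr: "degree r < degree h" using r(3) q q0 by auto
  \<comment> \<open>\<open>i\<close> is the degree of the reduction of \<open>r\<close> modulo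
    \<open>M\<close>; \<open>h'\<close> below is a monic lift of that reduction divided by its
    leading coefficient.\<close>
  define i where "i = (GREATEST i. coeff r i \<notin> M)"
  have bound: "\<And>j. coeff r j \<notin> M \<Longrightarrow> j \<le> degree r" using le_degree zero_in_M by metis
  have i: "coeff r i \<notin> M" "\<And>j. coeff r j \<notin> M \<Longrightarrow> j \<le> i"
    using r(4) GreatestI_ex_nat[of "\<lambda>i. coeff r i \<notin> M", OF _ bound]
      Greatest_le_nat[of "\<lambda>i. coeff r i \<notin> M", OF _ bound] by (auto simp: i_def)
  define c where "c = coeff r i"
  have c: "c \<in> R" "c \<notin> M" "c \<in> F" using i r by (auto simp: c_def polys_over_def)
  define h' where "h' = (\<Sum>j\<le>i. monom (inverse c * coeff r j) j)"
  have coeff_h': "coeff h' j = (if j \<le> i then inverse c * coeff r j else 0)" for j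
    unfolding h'_def coeff_sum by (simp add: coeff_monom)
  have c0: "c \<noteq> 0" using c unitD by blast
  have degh': "degree h' = i"
  proof (rule antisym)
    show "degree h' \<le> i" by (rule degree_le) (simp add: coeff_h')
    show "i \<le> degree h'" by (rule le_degree) (use c0 in \<open>simp add: coeff_h' c_def\<close>)
  qed
  have "h' \<in> polys_over F" "h' \<in> polys_over R" "lead_coeff h' = 1"
    using c r subfield_inverse[OF F(1)] unitD(2) is_subringD[OF FR] R_intros c0
    by (auto simp: polys_over_def degh' coeff_h' c_def)
  then have "poly h' u \<notin> M" using minimal[of h'] degh' degr bound[OF i(1)] by auto
  moreover have "poly r u \<in> R" using r u poly_in_R by blast
  have unit_u: "poly r u \<notin> M"
  proof
    assume *: "poly r u \<in> M"
    define t where "t = r - smult c h'"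
    have "coeff t j \<in> M" for j using i(2)[of j] c0 by (auto simp: t_def coeff_h' simp flip: mult.assoc)
    then have "poly t u \<in> M" unfolding poly_altdef using u by (intro M_sum M_mult R_intros)
    then have "poly r u - poly t u \<in> M" using * by (intro M_diff)
    then have "c * poly h' u \<in> M" by (simp add: t_def)
    then show False using c \<open>poly h' u \<notin> M\<close> poly_in_R[OF \<open>h' \<in> polys_over R\<close> u] M_prime by blast
  qed
  have "poly r w \<notin> M"
  proof
    assume "poly r w \<in> M"
    moreover have "poly r u - poly r w \<in> M" using poly_cong_M[OF r(2) u wR w(2)] .
    ultimately have "poly r w + (poly r u - poly r w) \<in> M" by (rule M_add)
    then show False using unit_u by simp
  qed
  moreover have "poly r w \<in> R" using poly_in_R[OF r(2) wR] .
  moreover have "y = of_nat p powi n * poly r w" using q(2) r(3) by simp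
  ultimately show "\<exists>n::int. \<exists>u. u \<in> R \<and> u \<notin> M \<and> y = of_nat p powi n * u" by blast
qed

lemma complex_monic_root_product:
  fixes h :: "complex poly"
  assumes "lead_coeff h = 1"
  shows "poly h u = (\<Prod>w\<in>#proots h. u - w)"
proof -
  have "h = (\<Prod>x\<in>#proots h. [:-x, 1:])" using complex_poly_decompose_multiset[of h] assms by simp
  then have "poly h u = (\<Prod>x\<in>#proots h. poly [:-x, 1:] u)"
    by (metis (no_types, lifting) comp_apply image_mset_cong multiset.map_comp poly_prod_mset)
  then show ?thesis by simp
qed

text \<open>Take a monic integral \<open>h\<close> over \<open>L\<close> of least degree with
  \<open>h(u)\<close> in \<open>M\<close>. As \<open>h(u)\<close> is the product of
  \<open>u - w\<close> over the roots, some root \<open>w\<close> has the residue of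
  \<open>u\<close>. The field generated by \<open>w\<close> over \<open>L\<close> is unramified, so
  \<open>w\<close> is in \<open>L\<close> by maximality.\<close>

theorem maximal_unramified_residue:
  assumes L: "is_subfield L" "unramified L" "\<And>L'. is_subfield L' \<Longrightarrow> unramified L' \<Longrightarrow> L \<subseteq> L' \<Longrightarrow> L' = L"
    and f: "f \<in> polys_over L" "f \<in> polys_over R" "lead_coeff f = 1" "poly f u = 0"
  shows "\<exists>a\<in>L \<inter> R. u - a \<in> M"
proof -
  have uR: "u \<in> R" using root_in_R f by blast
  define P where "P h \<longleftrightarrow> h \<in> polys_over L \<and> h \<in> polys_over R \<and> lead_coeff h = 1 \<and> poly h u \<in> M" for h
  have "P f" using f by (simp add: P_def)
  then obtain h where h: "P h" "\<And>h'. P h' \<Longrightarrow> degree h \<le> degree h'"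
    using ex_has_least_nat[of P f degree] by blast
  have hh: "h \<in> polys_over L" "h \<in> polys_over R" "lead_coeff h = 1" "poly h u \<in> M"
    using h(1) by (auto simp: P_def)
  have h0: "h \<noteq> 0" using hh by auto
  have rootsR: "w \<in> R" if "w \<in># proots h" for w
    using that root_in_R[OF hh(2,3)] h0 by (auto simp: set_count_proots)
  have "(\<Prod>w\<in>#proots h. u - w) \<in> M" using hh complex_monic_root_product[of h u] by simp
  moreover have "u - w \<in> R" if "w \<in># proots h" for w using rootsR[OF that] uR R_intros(6) by simp
  ultimately obtain w where w: "w \<in># proots h" "u - w \<in> M"
    using M_prod_mset_imp[of "proots h" "\<lambda>w. u - w"] by blast
  have pw: "poly h w = 0" using w(1) h0 by (simp add: set_count_proots)
  have "unramified (adjoin L w)"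
    using unramified_adjoin_residue[OF L(1,2) uR hh _ pw w(2)] h(2) by (auto simp: P_def)
  moreover have "is_subfield (adjoin L w)"
    using hh(1) h0 pw by (intro adjoin_subfield L(1)) (auto simp: algebraic_over_def)
  ultimately have "adjoin L w = L" using L(3) adjoin_superset[OF is_subfield_subring[OF L(1)]] by simp
  then have "w \<in> L" using adjoin_generator[OF is_subfield_subring[OF L(1)], of w] by simp
  moreover have "w \<in> R" using w rootsR by simp
  ultimately show ?thesis using w(2) by (intro bexI[of _ w]) auto
qed

text \<open>Newton's iteration started at the residue approximation shows that the root is a limit of elements of \<open>L\<close>.\<close>

theorem maximal_unramified_simple_root:
  assumes L: "is_subfield L" "unramified L" "\<And>L'. is_subfield L' \<Longrightarrow> unramified L' \<Longrightarrow> L \<subseteq> L' \<Longrightarrow> L' = L"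
    and f: "f \<in> polys_over L" "f \<in> polys_over R" "lead_coeff f = 1" "poly f u = 0"
    and simple: "poly (pderiv f) u \<notin> M"
  shows "u \<in> L"
proof -
  have LR: "is_subring L" using L(1) by (rule is_subfield_subring)
  have uR: "u \<in> R" using root_in_R f by blast
  obtain a0 where a0: "a0 \<in> L" "a0 \<in> R" "u - a0 \<in> M" using maximal_unramified_residue[OF L f] by blast
  define e where "e = u - a0"
  have eM: "e \<in> M" using a0 by (simp add: e_def)
  then have eR: "e \<in> R" by (rule M_imp_R)
  have f'R: "pderiv f \<in> polys_over R" "pderiv f \<in> polys_over L"
    using f polys_over_pderiv R LR by auto
  \<comment> \<open>Each step squares the error, but recording one further factor \<open>e\<close>
    is enough for arbitrarily good approximation.\<close>
  have newton: "\<exists>a\<in>L \<inter> R. \<exists>r\<in>R. u - a = e ^ Suc i * r" for i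
  proof (induction i)
    case 0
    then show ?case using a0 R_intros by (intro bexI[of _ a0] bexI[of _ 1]) (auto simp: e_def)
  next
    case (Suc i)
    then obtain a r where a: "a \<in> L" "a \<in> R" "r \<in> R" "u - a = e ^ Suc i * r" by blast
    have "u - a \<in> M" using a eM eR by (auto intro!: M_mult R_intros)
    then have "poly (pderiv f) u - poly (pderiv f) a \<in> M" using poly_cong_M[OF f'R(1) uR a(2)] by simp
    then have dM: "poly (pderiv f) a \<notin> M" using simple M_add by fastforce
    define d where "d = poly (pderiv f) a"
    have d: "d \<in> R" "d \<notin> M" "d \<in> L"
      using dM f'R a poly_in_R poly_in_subring[OF LR] by (auto simp: d_def)
    obtain t where t: "t \<in> R" "poly f u = poly f a + (u - a) * d + (u - a)\<^sup>2 * t"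
      using poly_taylor_2[OF R f(2) uR a(2)] by (auto simp: d_def)
    define b where "b = a - poly f a * inverse d"
    have "b \<in> L" "b \<in> R"
      unfolding b_def using a d f poly_in_R poly_in_subring[OF LR] is_subringD(4,6)[OF LR] subfield_inverse[OF L(1)]
        R_intros(4,6) unitD(2)[OF d(1,2)] by auto
    moreover have "u - b = e ^ Suc (Suc i) * (- (e ^ i * r\<^sup>2 * t * inverse d))"
    proof -
      have d0: "d \<noteq> 0" using d unitD by blast
      have "poly f a = - (u - a) * d - (u - a)\<^sup>2 * t" using t(2) f(4) by (simp add: algebra_simps)
      then have "u - b = - ((u - a)\<^sup>2 * t * inverse d)" using d0
        by (simp add: b_def left_diff_distrib mult.assoc)
      then show ?thesis unfolding a(4) by (simp add: power2_eq_square power_add mult_ac)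
    qed
    moreover have "- (e ^ i * r\<^sup>2 * t * inverse d) \<in> R"
      using eR a t unitD(2)[OF d(1,2)] R_intros(4,5,7) by simp
    ultimately show ?case by blast
  qed
  \<comment> \<open>The rank-one clause converts closeness in powers of \<open>e\<close> into
    closeness in powers of \<open>p\<close>.\<close>
  obtain n r where n: "r \<in> R" "e ^ n = of_nat p * r" using M_imp_power[OF eM] by blast
  have "f \<noteq> 0" using f(3) by auto
  then have alg: "algebraic_over L u" using f(1,4) unfolding algebraic_over_def by (intro bexI[of _ f]) auto
  have "unramified (adjoin L u)"
  proof (rule unramified_adjoin_limit[OF L(1,2) uR alg])
    fix N
    obtain a s where a: "a \<in> L \<inter> R" "s \<in> R" "u - a = e ^ Suc (n * N) * s" using newton[of "n * N"] by blast
    have "e ^ Suc (n * N) * s = of_nat p ^ N * (r ^ N * e * s)"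
      unfolding power_Suc power_mult n(2) by (simp add: power_mult_distrib mult_ac)
    moreover have "r ^ N * e * s \<in> R" using n eR a R_intros(4,7) by simp
    ultimately show "\<exists>a\<in>L \<inter> R. \<exists>r\<in>R. u - a = of_nat p ^ N * r" using a by (intro bexI[of _ a] bexI[of _ "r ^ N * e * s"]) simp_all
  qed
  moreover have "is_subfield (adjoin L u)"
    by (rule adjoin_subfield[OF L(1) alg])
  ultimately have "adjoin L u = L" using L(3) adjoin_superset[OF LR] by simp
  then show "u \<in> L" using adjoin_generator[OF LR, of u] by simp
qed

end

section \<open>Field homomorphisms and Galois groups\<close>

text \<open>Embeddings into the complex numbers, with unrestricted image and arbitrary values off
  \<open>F\<close>. Unlike \<open>field_aut\<close>, this notion is stable under enlarging
  \<open>F\<close> by one root at a time.\<close>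

definition field_hom :: "complex set \<Rightarrow> (complex \<Rightarrow> complex) \<Rightarrow> bool" where
  "field_hom F \<sigma> \<longleftrightarrow> \<sigma> 1 = 1 \<and> (\<forall>x\<in>F. \<forall>y\<in>F. \<sigma> (x + y) = \<sigma> x + \<sigma> y \<and> \<sigma> (x * y) = \<sigma> x * \<sigma> y)"

locale subfield_hom =
  fixes F :: "complex set" and \<sigma> :: "complex \<Rightarrow> complex"
  assumes dom: "is_subfield F" and hom: "field_hom F \<sigma>"
begin

lemma FR: "is_subring F" using dom by (rule is_subfield_subring)

lemma hom_add: "x \<in> F \<Longrightarrow> y \<in> F \<Longrightarrow> \<sigma> (x + y) = \<sigma> x + \<sigma> y"
  and hom_mult: "x \<in> F \<Longrightarrow> y \<in> F \<Longrightarrow> \<sigma> (x * y) = \<sigma> x * \<sigma> y"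
  and hom_1 [simp]: "\<sigma> 1 = 1"
  using hom by (auto simp: field_hom_def)

lemma hom_0 [simp]: "\<sigma> 0 = 0"
  using hom_add[of 0 0] is_subringD(1)[OF FR] by simp

lemma hom_uminus: "x \<in> F \<Longrightarrow> \<sigma> (- x) = - \<sigma> x"
  using hom_add[of x "- x"] is_subringD(5)[OF FR] by (simp add: eq_neg_iff_add_eq_0 add.commute)

lemma hom_diff: "x \<in> F \<Longrightarrow> y \<in> F \<Longrightarrow> \<sigma> (x - y) = \<sigma> x - \<sigma> y"
  using hom_add[of x "- y"] hom_uminus[of y] is_subringD(5)[OF FR] by simp

lemma hom_nonzero: assumes "x \<in> F" "x \<noteq> 0" shows "\<sigma> x \<noteq> 0"
proof
  assume "\<sigma> x = 0"
  moreover have "\<sigma> (x * inverse x) = \<sigma> x * \<sigma> (inverse x)"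
    using assms subfield_inverse[OF dom] by (intro hom_mult)
  ultimately show False using assms by simp
qed

lemma hom_inverse: assumes "x \<in> F" shows "\<sigma> (inverse x) = inverse (\<sigma> x)"
proof (cases "x = 0")
  case False
  have "\<sigma> x * \<sigma> (inverse x) = 1"
    using hom_mult[of x "inverse x"] assms subfield_inverse[OF dom] False by simp
  then show ?thesis by (metis inverse_unique)
qed auto

lemma hom_inj: "inj_on \<sigma> F"
proof (rule inj_onI)
  fix x y assume "x \<in> F" "y \<in> F" "\<sigma> x = \<sigma> y"
  then show "x = y" using hom_nonzero[of "x - y"] hom_diff is_subringD(6)[OF FR] by auto
qed

lemma hom_sum: "(\<And>i. i \<in> I \<Longrightarrow> f i \<in> F) \<Longrightarrow> \<sigma> (sum f I) = (\<Sum>i\<in>I. \<sigma> (f i))"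
  by (induction I rule: infinite_finite_induct) (auto simp: hom_add subring_sum[OF FR])

lemma hom_of_nat: "\<sigma> (of_nat n) = of_nat n"
  by (induction n) (auto simp: hom_add subring_of_nat[OF FR] is_subringD(2)[OF FR])

lemma hom_of_int: "\<sigma> (of_int n) = of_int n"
proof (cases n)
  case (neg k)
  have "\<sigma> (- of_nat (Suc k)) = - of_nat (Suc k)"
    by (subst hom_uminus) (simp_all only: subring_of_nat[OF FR] hom_of_nat)
  then show ?thesis by (simp add: neg)
qed (simp add: hom_of_nat)

lemma hom_Rats: assumes "x \<in> \<rat>" shows "\<sigma> x = x"
proof -
  obtain a b where "x = of_int a / of_int b" using assms by (elim Rats_cases')
  then show ?thesis using subring_of_int[OF FR] subfield_inverse[OF dom]
    by (simp add: divide_inverse hom_mult hom_inverse hom_of_int)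
qed

lemma map_poly_hom_add:
  "q \<in> polys_over F \<Longrightarrow> r \<in> polys_over F \<Longrightarrow> map_poly \<sigma> (q + r) = map_poly \<sigma> q + map_poly \<sigma> r"
  by (rule poly_eqI) (auto simp: coeff_map_poly polys_over_def hom_add)

lemma map_poly_hom_mult:
  assumes "q \<in> polys_over F" "r \<in> polys_over F"
  shows "map_poly \<sigma> (q * r) = map_poly \<sigma> q * map_poly \<sigma> r"
proof (rule poly_eqI)
  fix n
  have c: "coeff q i \<in> F" "coeff r i \<in> F" for i using assms by (auto simp: polys_over_def)
  have "\<sigma> (\<Sum>i\<le>n. coeff q i * coeff r (n - i)) = (\<Sum>i\<le>n. \<sigma> (coeff q i * coeff r (n - i)))"
    using c is_subringD(4)[OF FR] by (intro hom_sum) auto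
  then show "coeff (map_poly \<sigma> (q * r)) n = coeff (map_poly \<sigma> q * map_poly \<sigma> r) n"
    by (simp add: coeff_map_poly coeff_mult hom_mult c)
qed

lemma hom_poly:
  assumes "q \<in> polys_over F" "x \<in> F"
  shows "\<sigma> (poly q x) = poly (map_poly \<sigma> q) (\<sigma> x)"
  using assms(1)
proof (induction q)
  case (pCons a q)
  then have "a \<in> F" "q \<in> polys_over F" by (auto simp: polys_over_pCons[OF FR])
  moreover have "poly q x \<in> F" using poly_in_subring[OF FR _ assms(2)] calculation(2) by simp
  ultimately show ?case using pCons assms(2) is_subringD(4)[OF FR]
    by (simp add: map_poly_pCons hom_add hom_mult)
qed auto

text \<open>Applying \<open>\<sigma>\<close> to the coefficients and evaluating at \<open>w'\<close>
  is well defined: polynomials over \<open>F\<close> with equal value at \<open>w\<close> differ by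
  a multiple of the minimal polynomial.\<close>

lemma extend_adjoin:
  assumes g: "is_minpoly F w g" and w': "poly (map_poly \<sigma> g) w' = 0"
  shows "\<exists>\<tau>. field_hom (adjoin F w) \<tau> \<and> (\<forall>x\<in>F. \<tau> x = \<sigma> x) \<and> \<tau> w = w'"
proof -
  have gF: "g \<in> polys_over F" using g by (simp add: is_minpoly_def)
  have wd: "poly (map_poly \<sigma> q) w' = poly (map_poly \<sigma> r) w'"
    if q: "q \<in> polys_over F" and r: "r \<in> polys_over F" and eq: "poly q w = poly r w" for q r
  proof -
    obtain s where s: "s \<in> polys_over F" "q - r = s * g"
      using minpoly_dvd[OF dom g, of "q - r"] q r eq polys_over_diff[OF FR] by auto
    then have "q = r + s * g" by (metis add_diff_cancel_left' diff_add_cancel add.commute)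
    then have "map_poly \<sigma> q = map_poly \<sigma> r + map_poly \<sigma> s * map_poly \<sigma> g"
      using r s(1) gF polys_over_mult[OF FR] by (simp add: map_poly_hom_add map_poly_hom_mult)
    then show ?thesis using w' by simp
  qed
  define \<tau> where "\<tau> y = poly (map_poly \<sigma> (SOME q. q \<in> polys_over F \<and> y = poly q w)) w'" for y
  have \<tau>: "\<tau> (poly q w) = poly (map_poly \<sigma> q) w'" if q: "q \<in> polys_over F" for q
  proof -
    have "(SOME r. r \<in> polys_over F \<and> poly q w = poly r w) \<in> polys_over F \<and>
      poly q w = poly (SOME r. r \<in> polys_over F \<and> poly q w = poly r w) w"
      by (rule someI[where P = "\<lambda>r. r \<in> polys_over F \<and> poly q w = poly r w"]) (use q in simp)
    then show ?thesis unfolding \<tau>_def using wd[OF q] by metis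
  qed
  have const: "\<tau> x = \<sigma> x" if "x \<in> F" for x
    using \<tau>[of "[:x:]"] that polys_over_const[OF FR] by (simp add: map_poly_pCons)
  have "\<tau> w = w'"
    using \<tau>[of "[:0, 1:]"] is_subringD[OF FR] by (simp add: map_poly_pCons polys_over_pCons[OF FR] FR)
  moreover have "field_hom (adjoin F w) \<tau>"
    unfolding field_hom_def
  proof (intro conjI ballI)
    show "\<tau> 1 = 1" using const[of 1] is_subringD(2)[OF FR] by simp
    fix x y assume "x \<in> adjoin F w" "y \<in> adjoin F w"
    then obtain q r where qr: "q \<in> polys_over F" "x = poly q w" "r \<in> polys_over F" "y = poly r w"
      by (auto simp: adjoin_def)
    show "\<tau> (x + y) = \<tau> x + \<tau> y"
      using \<tau>[of "q + r"] qr polys_over_add[OF FR] by (simp add: \<tau> map_poly_hom_add)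
    show "\<tau> (x * y) = \<tau> x * \<tau> y"
      using \<tau>[of "q * r"] qr polys_over_mult[OF FR] by (simp add: \<tau> map_poly_hom_mult)
  qed
  ultimately show ?thesis using const by blast
qed

lemma map_minpoly_root: assumes "is_minpoly F w g" shows "\<exists>w'. poly (map_poly \<sigma> g) w' = 0"
proof -
  have "coeff (map_poly \<sigma> g) (degree g) = 1"
    using assms by (simp add: coeff_map_poly is_minpoly_def)
  then have "degree (map_poly \<sigma> g) \<ge> degree g" by (intro le_degree) simp
  then have "degree (map_poly \<sigma> g) \<noteq> 0" using minpoly_degree_pos[OF assms] by simp
  then have "\<not> constant (poly (map_poly \<sigma> g))" by (simp add: constant_degree)
  then show ?thesis by (rule fundamental_theorem_of_algebra)
qed

end

lemma algebraic_over_mono: "F \<subseteq> F' \<Longrightarrow> algebraic_over F w \<Longrightarrow> algebraic_over F' w"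
  unfolding algebraic_over_def using polys_over_mono by blast

text \<open>One generator is added at a time; the fundamental theorem of algebra supplies a possible
  image for it.\<close>

lemma extend_field_hom:
  assumes "finite T" "is_subfield F" "field_hom F \<sigma>" "\<And>t. t \<in> T \<Longrightarrow> algebraic_over F t"
  shows "\<exists>F' \<tau>. is_subfield F' \<and> F \<subseteq> F' \<and> T \<subseteq> F' \<and> field_hom F' \<tau> \<and> (\<forall>x\<in>F. \<tau> x = \<sigma> x)"
  using assms(1,4)
proof (induction T rule: finite_induct)
  case empty
  then show ?case using assms by blast
next
  case (insert t T)
  then obtain F1 \<tau>1 where 1: "is_subfield F1" "F \<subseteq> F1" "T \<subseteq> F1" "field_hom F1 \<tau>1" "\<And>x. x \<in> F \<Longrightarrow> \<tau>1 x = \<sigma> x"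
    by auto
  interpret subfield_hom F1 \<tau>1 using 1 by unfold_locales
  have alg: "algebraic_over F1 t" using insert.prems algebraic_over_mono[OF 1(2)] by blast
  obtain g where g: "is_minpoly F1 t g" using minpoly_exists[OF 1(1) alg] by blast
  obtain w' where w': "poly (map_poly \<tau>1 g) w' = 0" using map_minpoly_root[OF g] by blast
  obtain \<tau> where \<tau>: "field_hom (adjoin F1 t) \<tau>" "\<And>x. x \<in> F1 \<Longrightarrow> \<tau> x = \<tau>1 x"
    using extend_adjoin[OF g w'] by blast
  have "is_subfield (adjoin F1 t)" using adjoin_subfield[OF 1(1) alg] .
  moreover have "F1 \<subseteq> adjoin F1 t" "t \<in> adjoin F1 t" using adjoin_superset[OF FR] adjoin_generator[OF FR] by auto
  moreover have "\<forall>x\<in>F. \<tau> x = \<sigma> x" using \<tau>(2) 1 by auto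
  moreover have "F \<subseteq> adjoin F1 t" by (rule order_trans[OF 1(2) adjoin_superset[OF FR]])
  moreover have "T \<subseteq> adjoin F1 t" by (rule order_trans[OF 1(3) adjoin_superset[OF FR]])
  ultimately show ?case using \<tau>(1)
    by (intro exI[of _ "adjoin F1 t"] exI[of _ \<tau>]) simp
qed

section \<open>Splitting fields and the Galois group as a permutation group\<close>

lemma splitting_field_subfield: "is_subfield (splitting_field g)"
proof -
  have *: "is_subfield (\<Inter>\<C>)" if "\<And>F. F \<in> \<C> \<Longrightarrow> is_subfield F" for \<C>
    using that unfolding is_subfield_def by simp
  show ?thesis unfolding splitting_field_def by (rule *) simp
qed

lemma croots_subset_splitting_field: "croots g \<subseteq> splitting_field g"
  by (auto simp: splitting_field_def)

lemma splitting_field_least: "is_subfield F \<Longrightarrow> croots g \<subseteq> F \<Longrightarrow> splitting_field g \<subseteq> F"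
  by (auto simp: splitting_field_def)

lemma finite_croots: assumes "g \<noteq> 0" shows "finite (croots g)"
proof -
  have "map_poly of_rat g \<noteq> (0 :: complex poly)" using assms
    by (metis leading_coeff_0_iff coeff_map_poly of_rat_0 of_rat_eq_0_iff coeff_0)
  then show ?thesis unfolding croots_def by (rule poly_roots_finite)
qed

lemma map_poly_of_rat_over_Rats: "map_poly of_rat g \<in> polys_over \<rat>"
  by (auto simp: polys_over_def coeff_map_poly)

text \<open>An embedding of any field containing the roots maps the finite root set injectively
  into, hence onto, itself. Image and preimage of the splitting field are then subfields containing
  the roots, and leastness gives both inclusions.\<close>

lemma galois_group_hom:
  assumes g: "g \<noteq> 0" and F: "is_subfield F" "croots g \<subseteq> F" "field_hom F \<tau>"
  shows "(\<lambda>z. if z \<in> croots g then \<tau> z else z) \<in> galois_group g"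
proof -
  interpret subfield_hom F \<tau> using F by unfold_locales
  let ?g = "map_poly of_rat g :: complex poly"
  let ?K = "splitting_field g"
  have KF: "?K \<subseteq> F" using splitting_field_least[OF F(1,2)] .
  have KF': "x \<in> F" if "x \<in> ?K" for x using KF that by (rule subsetD)
  have gF: "?g \<in> polys_over F" using polys_over_mono[OF Rats_subset_subfield[OF F(1)] map_poly_of_rat_over_Rats] .
  have fix_g: "map_poly \<tau> ?g = ?g"
    by (rule poly_eqI) (simp add: coeff_map_poly hom_Rats)
  have into: "\<tau> z \<in> croots g" if "z \<in> croots g" for z
    using hom_poly[OF gF, of z] that F(2) by (auto simp: croots_def fix_g)
  have img: "\<tau> ` croots g = croots g"
    by (rule endo_inj_surj[OF finite_croots[OF g]]) (use into inj_on_subset[OF hom_inj F(2)] in auto)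
  have "bij_betw \<tau> (croots g) (croots g)"
    using img inj_on_subset[OF hom_inj F(2)] by (simp add: bij_betw_def)
  then have bij: "bij_betw (\<lambda>z. if z \<in> croots g then \<tau> z else z) (croots g) (croots g)"
    by (rule bij_betw_cong[THEN iffD1, rotated]) simp
  have perm: "(\<lambda>z. if z \<in> croots g then \<tau> z else z) permutes croots g"
    by (rule bij_imp_permutes[OF bij]) simp
  note K = splitting_field_subfield[of g]
  have "?K \<subseteq> \<tau> ` ?K"
  proof (rule splitting_field_least)
    show "croots g \<subseteq> \<tau> ` ?K" using img croots_subset_splitting_field[of g] by blast
    show "is_subfield (\<tau> ` ?K)"
      unfolding is_subfield_def
    proof (intro conjI ballI)
      have "0 \<in> ?K" "1 \<in> ?K" using K by (auto simp: is_subfield_def)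
      then show "0 \<in> \<tau> ` ?K" "1 \<in> \<tau> ` ?K" using hom_0 hom_1 by (metis imageI)+
    next
      fix x y assume "x \<in> \<tau> ` ?K" "y \<in> \<tau> ` ?K"
      then obtain a b where ab: "a \<in> ?K" "b \<in> ?K" "x = \<tau> a" "y = \<tau> b" by blast
      then have "x + y = \<tau> (a + b)" "x * y = \<tau> (a * b)" using hom_add[of a b] hom_mult[of a b] KF' by simp_all
      moreover have "a + b \<in> ?K" "a * b \<in> ?K" using K ab by (auto simp: is_subfield_def)
      ultimately show "x + y \<in> \<tau> ` ?K" "x * y \<in> \<tau> ` ?K" by auto
    next
      fix x assume "x \<in> \<tau> ` ?K"
      then obtain a where a: "a \<in> ?K" "x = \<tau> a" by blast
      then have "- x = \<tau> (- a)" "inverse x = \<tau> (inverse a)" using hom_uminus[of a] hom_inverse[of a] KF' by simp_all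
      moreover have "- a \<in> ?K" "inverse a \<in> ?K" using K a by (auto simp: is_subfield_def)
      ultimately show "- x \<in> \<tau> ` ?K" "inverse x \<in> \<tau> ` ?K" by auto
    qed
  qed
  moreover have "?K \<subseteq> {x \<in> ?K. \<tau> x \<in> ?K}"
  proof (rule splitting_field_least)
    show "croots g \<subseteq> {x \<in> ?K. \<tau> x \<in> ?K}" using into croots_subset_splitting_field[of g] by blast
    show "is_subfield {x \<in> ?K. \<tau> x \<in> ?K}"
      unfolding is_subfield_def  using K[unfolded is_subfield_def] KF' 
      by (simp add: hom_add hom_mult hom_uminus hom_inverse)
  qed
  ultimately have "\<tau> ` ?K = ?K" by blast
  then have "bij_betw \<tau> ?K ?K" using inj_on_subset[OF hom_inj KF] by (simp add: bij_betw_def)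
  then have "field_aut ?K \<tau>" unfolding field_aut_def using hom_add hom_mult KF' by simp
  then show ?thesis unfolding galois_group_def using perm by auto
qed

text \<open>The source of all group elements constructed later. \<open>F\<close> need not lie in the
  splitting field: the embedding over \<open>F\<close> taking \<open>z\<close> to its conjugate
  \<open>z'\<close> is extended to all roots and then restricted to them.\<close>

lemma galois_group_move:
  assumes g: "g \<noteq> 0" and F: "is_subfield F" and z: "z \<in> croots g" and h: "is_minpoly F z h" "poly h z' = 0"
  shows "\<exists>\<pi>\<in>galois_group g. \<pi> z = z' \<and> (\<forall>u\<in>croots g \<inter> F. \<pi> u = u)"
proof -
  interpret subfield_hom F id by unfold_locales (auto simp: F field_hom_def)
  have "poly (map_poly id h) z' = 0" using h(2) by simp
  then obtain \<tau>1 where 1: "field_hom (adjoin F z) \<tau>1" "\<And>x. x \<in> F \<Longrightarrow> \<tau>1 x = x" "\<tau>1 z = z'"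
    using extend_adjoin[OF h(1), of z'] by auto
  have alg: "algebraic_over F t" if "t \<in> croots g" for t
    unfolding algebraic_over_def
  proof (intro bexI conjI)
    show "map_poly of_rat g \<in> polys_over F"
      using polys_over_mono[OF Rats_subset_subfield[OF F] map_poly_of_rat_over_Rats] .
    show "poly (map_poly of_rat g) t = 0" using that by (simp add: croots_def)
    show "map_poly of_rat g \<noteq> (0 :: complex poly)" using g
      by (metis leading_coeff_0_iff coeff_map_poly of_rat_0 of_rat_eq_0_iff coeff_0)
  qed
  have A: "is_subfield (adjoin F z)" using adjoin_subfield[OF F alg[OF z]] .
  have FA: "F \<subseteq> adjoin F z" using adjoin_superset[OF FR] .
  obtain F' \<tau> where 2: "is_subfield F'" "adjoin F z \<subseteq> F'" "croots g \<subseteq> F'" "field_hom F' \<tau>"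
    "\<And>x. x \<in> adjoin F z \<Longrightarrow> \<tau> x = \<tau>1 x"
    using extend_field_hom[OF finite_croots[OF g] A 1(1)] algebraic_over_mono[OF FA] alg by blast
  show ?thesis
  proof (rule bexI[OF _ galois_group_hom[OF g 2(1,3,4)]], intro conjI ballI)
    show "(if z \<in> croots g then \<tau> z else z) = z'" using z 2(5) 1(3) adjoin_generator[OF FR] by simp
    fix u assume "u \<in> croots g \<inter> F"
    then show "(if u \<in> croots g then \<tau> u else u) = u" using 2(5) 1(2) FA by auto
  qed
qed

lemma galois_group_permutes: "\<pi> \<in> galois_group g \<Longrightarrow> \<pi> permutes croots g"
  by (simp add: galois_group_def)

lemma galois_group_id: "id \<in> galois_group g"
  unfolding galois_group_def field_aut_def by (auto intro!: exI[of _ id] permutes_id)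

lemma galois_group_comp:
  assumes "\<pi> \<in> galois_group g" "\<rho> \<in> galois_group g"
  shows "\<pi> \<circ> \<rho> \<in> galois_group g"
proof -
  let ?K = "splitting_field g"
  obtain \<sigma> \<tau> where 1: "field_aut ?K \<sigma>" "\<And>z. z \<in> croots g \<Longrightarrow> \<sigma> z = \<pi> z"
    "field_aut ?K \<tau>" "\<And>z. z \<in> croots g \<Longrightarrow> \<tau> z = \<rho> z"
    using assms by (auto simp: galois_group_def)
  note p = galois_group_permutes[OF assms(1)] galois_group_permutes[OF assms(2)]
  have "\<tau> z \<in> ?K" if "z \<in> ?K" for z using 1(3) that by (auto simp: field_aut_def bij_betw_def)
  then have "field_aut ?K (\<sigma> \<circ> \<tau>)" using 1 by (auto simp: field_aut_def intro: bij_betw_trans)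
  moreover have "(\<sigma> \<circ> \<tau>) z = (\<pi> \<circ> \<rho>) z" if "z \<in> croots g" for z
    using that 1 p(2) by (simp add: permutes_in_image)
  ultimately show ?thesis unfolding galois_group_def using permutes_compose[OF p(2,1)] by blast
qed

lemma galois_group_inv:
  assumes "\<pi> \<in> galois_group g"
  shows "inv \<pi> \<in> galois_group g"
proof -
  let ?K = "splitting_field g"
  obtain \<sigma> where 1: "field_aut ?K \<sigma>" "\<And>z. z \<in> croots g \<Longrightarrow> \<sigma> z = \<pi> z"
    using assms by (auto simp: galois_group_def)
  note p = galois_group_permutes[OF assms]
  note K = splitting_field_subfield[of g]
  define \<tau> where "\<tau> = inv_into ?K \<sigma>"
  have bij: "bij_betw \<sigma> ?K ?K" using 1 by (simp add: field_aut_def)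
  have bij': "bij_betw \<tau> ?K ?K" unfolding \<tau>_def by (rule bij_betw_inv_into[OF bij])
  have \<tau>\<sigma>: "\<tau> (\<sigma> x) = x" if "x \<in> ?K" for x unfolding \<tau>_def using bij_betw_inv_into_left[OF bij that] .
  have \<sigma>\<tau>: "\<sigma> (\<tau> x) = x" if "x \<in> ?K" for x unfolding \<tau>_def using bij_betw_inv_into_right[OF bij that] .
  have in\<tau>: "\<tau> x \<in> ?K" if "x \<in> ?K" for x using bij' that by (auto simp: bij_betw_def)
  have Kc: "1 \<in> ?K" "\<And>x y. x \<in> ?K \<Longrightarrow> y \<in> ?K \<Longrightarrow> x + y \<in> ?K" "\<And>x y. x \<in> ?K \<Longrightarrow> y \<in> ?K \<Longrightarrow> x * y \<in> ?K"
    using K by (auto simp: is_subfield_def)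
  have \<sigma>c: "\<sigma> 1 = 1" "\<And>x y. x \<in> ?K \<Longrightarrow> y \<in> ?K \<Longrightarrow> \<sigma> (x + y) = \<sigma> x + \<sigma> y"
    "\<And>x y. x \<in> ?K \<Longrightarrow> y \<in> ?K \<Longrightarrow> \<sigma> (x * y) = \<sigma> x * \<sigma> y"
    using 1 by (auto simp: field_aut_def)
  have "field_aut ?K \<tau>"
    unfolding field_aut_def
  proof (intro conjI ballI)
    show "bij_betw \<tau> ?K ?K" by (rule bij')
    show "\<tau> 1 = 1" using \<tau>\<sigma>[of 1] Kc(1) \<sigma>c(1) by simp
    fix x y assume xy: "x \<in> ?K" "y \<in> ?K"
    show "\<tau> (x + y) = \<tau> x + \<tau> y"
      using \<tau>\<sigma>[of "\<tau> x + \<tau> y"] \<sigma>c(2)[of "\<tau> x" "\<tau> y"] in\<tau> Kc(2) \<sigma>\<tau> xy by simp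
    show "\<tau> (x * y) = \<tau> x * \<tau> y"
      using \<tau>\<sigma>[of "\<tau> x * \<tau> y"] \<sigma>c(3)[of "\<tau> x" "\<tau> y"] in\<tau> Kc(3) \<sigma>\<tau> xy by simp
  qed
  moreover have "\<tau> z = inv \<pi> z" if "z \<in> croots g" for z
  proof -
    have z': "inv \<pi> z \<in> croots g" using permutes_in_image[OF permutes_inv[OF p]] that by simp
    have "\<sigma> (inv \<pi> z) = z" using 1(2)[OF z'] p by (simp add: permutes_inverses)
    then show ?thesis using \<tau>\<sigma>[of "inv \<pi> z"] z' croots_subset_splitting_field[of g] by auto
  qed
  ultimately show ?thesis unfolding galois_group_def using permutes_inv[OF p] by blast
qed

section \<open>Laguerre polynomials\<close>

text \<open>The coefficients of \<open>(-1) ^ k * k! * L_k\<close>.\<close>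

definition lag_coeff :: "nat \<Rightarrow> nat \<Rightarrow> nat \<Rightarrow> int" where
  "lag_coeff k a j = (-1) ^ (k + j) * int (k choose j) * (\<Prod>i\<in>{j+1..k}. int (i + a))"

definition monic_laguerre :: "nat \<Rightarrow> nat \<Rightarrow> complex poly" where
  "monic_laguerre k a = (\<Sum>j\<le>k. monom (of_int (lag_coeff k a j)) j)"

lemma coeff_monic_laguerre: "coeff (monic_laguerre k a) j = of_int (lag_coeff k a j)"
  by (auto simp: monic_laguerre_def coeff_sum coeff_monom lag_coeff_def)

lemma degree_monic_laguerre [simp]: "degree (monic_laguerre k a) = k"
proof (rule antisym)
  show "degree (monic_laguerre k a) \<le> k" by (rule degree_le) (auto simp: coeff_monic_laguerre lag_coeff_def)
  show "k \<le> degree (monic_laguerre k a)" by (rule le_degree) (simp add: coeff_monic_laguerre lag_coeff_def)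
qed

lemma lead_coeff_monic_laguerre [simp]: "coeff (monic_laguerre k a) k = 1"
  by (simp add: coeff_monic_laguerre lag_coeff_def)

lemma monic_laguerre_nonzero [simp]: "monic_laguerre k a \<noteq> 0"
  by (metis coeff_0 lead_coeff_monic_laguerre zero_neq_one)

lemma map_poly_laguerre:
  "map_poly of_rat (laguerre k a) = smult ((-1) ^ k / fact k) (monic_laguerre k a)"
proof (rule poly_eqI)
  fix j
  show "coeff (map_poly of_rat (laguerre k a)) j = coeff (smult ((-1) ^ k / fact k) (monic_laguerre k a)) j"
  proof (cases "j \<le> k")
    case True
    have "of_nat (k choose j) = (fact k / (fact j * fact (k - j)) :: complex)"
      using True by (rule binomial_fact)
    moreover have "of_rat (fact n) = (fact n :: complex)" for n
      by (metis of_nat_fact of_rat_of_nat_eq)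
    ultimately show ?thesis using True
      by (simp add: laguerre_def coeff_map_poly coeff_sum coeff_monom coeff_monic_laguerre lag_coeff_def
          of_rat_divide of_rat_mult of_rat_prod of_rat_add of_rat_power power_add field_simps
          flip: power_mult_distrib)
  qed (simp add: laguerre_def coeff_map_poly coeff_sum coeff_monom coeff_monic_laguerre lag_coeff_def)
qed

lemma laguerre_nonzero: "laguerre k a \<noteq> 0"
proof
  assume "laguerre k a = 0"
  then have "smult ((-1) ^ k / fact k) (monic_laguerre k a) = 0" using map_poly_laguerre[of k a] by simp
  then show False by simp
qed

lemma croots_laguerre: "croots (laguerre k a) = {z. poly (monic_laguerre k a) z = 0}"
  by (simp add: croots_def map_poly_laguerre)

lemma monic_laguerre_over_subring: "is_subring R \<Longrightarrow> monic_laguerre k a \<in> polys_over R"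
  by (auto simp: polys_over_def coeff_monic_laguerre subring_of_int)

text \<open>The coefficient form of the differential equation; from \<open>j = k\<close> on both
  sides vanish.\<close>

lemma lag_coeff_rec:
  "int (j + 1) * int (a + 1 + j) * lag_coeff k a (j + 1) = (int j - int k) * lag_coeff k a j"
proof (cases "j < k")
  case True
  have prod: "(\<Prod>i\<in>{j+1..k}. int (i + a)) = int (a + 1 + j) * (\<Prod>i\<in>{j+2..k}. int (i + a))"
    using True by (subst prod.atLeast_Suc_atMost) (auto simp: add_ac)
  have binom: "int (j + 1) * int (k choose (j + 1)) = - (int j - int k) * int (k choose j)"
    using binomial_absorb_comp[of k j] True Suc_times_binomial_eq
    by (metis Suc_eq_plus1 binomial_absorption binomial_absorb_comp diff_Suc_1 less_imp_le_nat of_nat_diff of_nat_mult minus_diff_eq)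
  have alg: "u * v * (- s * y * A) = w * (s * x * (v * A))" if "u * y = - w * x" for u v w s x y A :: int
  proof -
    have "u * v * (- s * y * A) = - (v * s * A) * (u * y)" by (simp add: mult_ac)
    then show ?thesis by (simp add: that mult_ac)
  qed
  have "lag_coeff k a (j + 1) = - ((-1) ^ (k + j)) * int (k choose (j + 1)) * (\<Prod>i\<in>{j+2..k}. int (i + a))"
    by (simp add: lag_coeff_def)
  then show ?thesis unfolding lag_coeff_def[of k a j] prod using alg[OF binom] by simp
next
  case False
  then have "j = k \<or> k < j" by auto
  then show ?thesis by (auto simp: lag_coeff_def binomial_eq_0)
qed

lemma monic_laguerre_ode:
  fixes k a :: nat
  defines "f \<equiv> monic_laguerre k a"
  shows "[:0, 1:] * pderiv (pderiv f) + [:of_nat (a + 1), -1:] * pderiv f + smult (of_nat k) f = 0"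
proof (rule poly_eqI)
  fix j
  have rec: "(of_nat (j + 1) * of_nat (a + 1 + j) * coeff f (j + 1) :: complex) = (of_nat j - of_nat k) * coeff f j"
    unfolding f_def coeff_monic_laguerre
    using arg_cong[OF lag_coeff_rec[of j a k], of "of_int :: int \<Rightarrow> complex"] by (simp only: of_int_mult of_int_diff of_int_of_nat_eq)
  show "coeff ([:0, 1:] * pderiv (pderiv f) + [:of_nat (a + 1), -1:] * pderiv f + smult (of_nat k) f) j = coeff 0 j"
    using rec by (cases j) (auto simp: coeff_pderiv coeff_pCons algebra_simps)
qed

text \<open>Each derivative satisfies a Laguerre equation again, with \<open>a + n\<close> and
  \<open>k - n\<close>. Where \<open>x\<close> is invertible, this passes vanishing of two
  successive derivatives on to the next one; it is used both exactly and modulo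
  \<open>M\<close>.\<close>

lemma monic_laguerre_higher_ode:
  fixes k a n :: nat
  defines "D \<equiv> \<lambda>n. (pderiv ^^ n) (monic_laguerre k a)"
  shows "[:0, 1:] * D (n + 2) + [:of_nat (a + 1 + n), -1:] * D (n + 1) + smult (of_nat k - of_nat n) (D n) = 0"
proof (induction n)
  case 0
  then show ?case using monic_laguerre_ode[of k a] by (simp add: D_def numeral_2_eq_2)
next
  case (Suc n)
  define X C :: "complex poly" where "X = [:0, 1:]" and "C = [:of_nat (a + 1 + n), -1:]"
  have d: "pderiv X = 1" "pderiv C = -1" by (simp_all add: X_def C_def pderiv_pCons one_pCons)
  have dD: "pderiv (D m) = D (m + 1)" for m by (simp add: D_def)
  have C': "[:of_nat (a + 1 + Suc n), -1:] = C + 1" by (simp add: C_def one_pCons)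
  have "0 = pderiv (X * D (n + 2) + C * D (n + 1) + smult (of_nat k - of_nat n) (D n))"
    using Suc by (simp add: X_def C_def)
  also have "\<dots> = X * D (n + 3) + D (n + 2) + (C * D (n + 2) - D (n + 1)) + smult (of_nat k - of_nat n) (D (n + 1))"
    by (simp add: pderiv_add pderiv_mult pderiv_smult d dD numeral_3_eq_3)
  finally show ?case unfolding C' X_def[symmetric]
    by (simp add: numeral_3_eq_3 algebra_simps smult_diff_left smult_add_left)
qed

lemma higher_pderiv_monic_laguerre: "(pderiv ^^ k) (monic_laguerre k a) = [:fact k:]"
  by (rule poly_eqI) (auto simp: coeff_higher_pderiv coeff_pCons pochhammer_fact coeff_eq_0 split: nat.splits)

lemma lag_coeff_0: "lag_coeff k a 0 = (-1) ^ k * (\<Prod>i\<in>{1..k}. int (i + a))"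
  by (simp add: lag_coeff_def)

lemma lag_coeff_0_nonzero: "lag_coeff k a 0 \<noteq> 0"
  by (simp add: lag_coeff_0)

text \<open>Comparison with the constant term: up to a binomial coefficient, the valuation drops by
  that of \<open>(a + 1) ... (a + i)\<close>, so this product governs the slopes of the Newton
  polygon.\<close>

lemma lag_coeff_quotient:
  assumes "i \<le> k"
  shows "lag_coeff k a i * (\<Prod>l\<in>{1..i}. int (l + a)) = (-1) ^ i * int (k choose i) * lag_coeff k a 0"
proof -
  have "(\<Prod>l\<in>{1..k}. int (l + a)) = (\<Prod>l\<in>{1..i}. int (l + a)) * (\<Prod>l\<in>{i+1..k}. int (l + a))"
    using assms prod.ub_add_nat[of 1 i "\<lambda>l. int (l + a)" "k - i"] by simp
  then show ?thesis by (simp add: lag_coeff_def power_add)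
qed

lemma zero_not_root_laguerre: "poly (monic_laguerre k a) 0 \<noteq> 0"
  by (simp add: poly_0_coeff_0 coeff_monic_laguerre lag_coeff_0_nonzero)

text \<open>At a nonzero double root the differential equation forces all higher derivatives to vanish.\<close>

lemma monic_laguerre_simple_root:
  assumes z: "poly (monic_laguerre k a) z = 0"
  shows "poly (pderiv (monic_laguerre k a)) z \<noteq> 0"
proof
  assume z': "poly (pderiv (monic_laguerre k a)) z = 0"
  have z0: "z \<noteq> 0" using z zero_not_root_laguerre by metis
  define D where "D n = poly ((pderiv ^^ n) (monic_laguerre k a)) z" for n
  have "D n = 0 \<and> D (Suc n) = 0" for n
  proof (induction n)
    case 0
    then show ?case using z z' by (simp add: D_def)
  next
    case (Suc n)
    have "z * D (n + 2) + (of_nat (a + 1 + n) - z) * D (n + 1) + (of_nat k - of_nat n) * D n = 0"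
      using arg_cong[OF monic_laguerre_higher_ode[where n = n and k = k and a = a], of "\<lambda>q. poly q z"]
      by (simp add: D_def algebra_simps)
    then show ?case using Suc z0 by simp
  qed
  then have "D k = 0" by blast
  then show False by (simp add: D_def higher_pderiv_monic_laguerre)
qed

text \<open>Simplicity of the roots makes a monic divisor the same thing as its root set, so degrees
  can be counted as numbers of roots.\<close>

lemma monic_dvd_laguerre_roots:
  assumes g: "g dvd monic_laguerre k a" "lead_coeff g = 1"
  shows "g = (\<Prod>z | poly g z = 0. [:-z, 1:])" "card {z. poly g z = 0} = degree g"
    "finite {z. poly g z = 0}" "{z. poly g z = 0} \<subseteq> croots (laguerre k a)"
proof -
  obtain h where h: "monic_laguerre k a = g * h" using g(1) by (elim dvdE)
  have g0: "g \<noteq> 0" using g(2) by auto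
  show sub: "{z. poly g z = 0} \<subseteq> croots (laguerre k a)" by (auto simp: croots_laguerre h)
  have "poly (pderiv g) z \<noteq> 0" if "poly g z = 0" for z
    using monic_laguerre_simple_root[of k a z] that by (auto simp: h pderiv_mult)
  then have sq: "rsquarefree g" by (auto simp: rsquarefree_roots)
  have "order z g = 1" if "poly g z = 0" for z using sq that g0 by (rule rsquarefree_root_order)
  then have "(\<Prod>z | poly g z = 0. [:-z, 1:] ^ order z g) = (\<Prod>z | poly g z = 0. [:-z, 1:])"
    by (intro prod.cong) auto
  then show eq: "g = (\<Prod>z | poly g z = 0. [:-z, 1:])"
    using complex_poly_decompose[of g] g(2) by simp
  show "finite {z. poly g z = 0}" using poly_roots_finite[OF g0] .
  have "degree g = (\<Sum>z | poly g z = 0. degree [:-z, 1:])"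
    by (subst eq, subst degree_prod_eq_sum_degree) auto
  then show "card {z. poly g z = 0} = degree g" by simp
qed

lemma poly_0_prod_linear: "coeff (\<Prod>z\<in>Z. [:-z, 1:]) 0 = (\<Prod>z\<in>Z. - (z::complex))"
  by (simp add: poly_prod flip: poly_0_coeff_0)

section \<open>Newton polygon arguments\<close>

context valuation_ring
begin

lemma prod_linear_coeffs:
  assumes "finite S" "S \<subseteq> M"
  shows "(\<Prod>z\<in>S. [:-z, 1:]) \<in> polys_over R \<and> (\<forall>i<card S. coeff (\<Prod>z\<in>S. [:-z, 1:]) i \<in> M) \<and>
    coeff (\<Prod>z\<in>S. [:-z, 1:]) (card S) = 1"
proof -
  have over: "(\<Prod>z\<in>S. [:-z, 1:]) \<in> polys_over R"
    using assms by (intro polys_over_prod[OF R] polys_over_linear[OF R] M_imp_R) auto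
  have deg: "degree (\<Prod>z\<in>S. [:-z, 1:]) = card S" if "finite S" for S :: "complex set"
    by (subst degree_prod_eq_sum_degree) auto
  have lead: "lead_coeff (\<Prod>z\<in>S. [:-z, 1:]) = 1" by (simp add: lead_coeff_prod)
  have "\<forall>i<card S. coeff (\<Prod>z\<in>S. [:-z, 1:]) i \<in> M" using assms
  proof (induction S rule: finite_induct)
    case (insert z S)
    show ?case
    proof (intro allI impI)
      fix i assume i: "i < card (insert z S)"
      have zM: "z \<in> M" using insert.prems by simp
      have SR: "(\<Prod>z\<in>S. [:-z, 1:]) \<in> polys_over R"
        using insert.prems by (intro polys_over_prod[OF R] polys_over_linear[OF R] M_imp_R) auto
      have c: "coeff (\<Prod>z\<in>insert z S. [:-z, 1:]) i =
          - z * coeff (\<Prod>z\<in>S. [:-z, 1:]) i + (case i of 0 \<Rightarrow> 0 | Suc j \<Rightarrow> coeff (\<Prod>z\<in>S. [:-z, 1:]) j)"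
        using insert.hyps by (simp add: coeff_pCons split: nat.splits)
      have "- z * coeff (\<Prod>z\<in>S. [:-z, 1:]) i \<in> M"
        using zM SR by (intro M_mult M_uminus) (auto simp: polys_over_def)
      moreover have "(case i of 0 \<Rightarrow> 0 | Suc j \<Rightarrow> coeff (\<Prod>z\<in>S. [:-z, 1:]) j) \<in> M"
        using insert i by (auto split: nat.splits)
      ultimately show "coeff (\<Prod>z\<in>insert z S. [:-z, 1:]) i \<in> M" unfolding c by (rule M_add)
    qed
  qed simp
  then show ?thesis using over lead deg[OF assms(1)] by simp
qed

text \<open>Modulo \<open>M\<close> the polynomial is a power of the variable, one factor per root
  in \<open>M\<close>, times a polynomial with unit constant term. So the index of the first unit
  coefficient counts the roots in \<open>M\<close>.\<close>

lemma coeffs_mod_M: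
  assumes Z: "finite Z" "Z \<subseteq> R" and f: "f = (\<Prod>z\<in>Z. [:-z, 1:])"
  shows "\<forall>i<card (Z \<inter> M). coeff f i \<in> M" "coeff f (card (Z \<inter> M)) \<notin> M"
proof -
  define A where "A = (\<Prod>z\<in>Z \<inter> M. [:-z, 1:])"
  define B where "B = (\<Prod>z\<in>Z - M. [:-z, 1:])"
  define s where "s = card (Z \<inter> M)"
  have "f = (\<Prod>z\<in>(Z \<inter> M) \<union> (Z - M). [:-z, 1:])" unfolding f by (rule prod.cong) auto
  also have "\<dots> = A * B" unfolding A_def B_def using Z by (intro prod.union_disjoint) auto
  finally have fAB: "f = A * B" .
  have A: "A \<in> polys_over R" "\<And>i. i < s \<Longrightarrow> coeff A i \<in> M" "coeff A s = 1"
    using prod_linear_coeffs[of "Z \<inter> M"] Z by (auto simp: A_def s_def)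
  have B: "B \<in> polys_over R" unfolding B_def using Z by (intro polys_over_prod[OF R] polys_over_linear[OF R]) auto
  have "coeff B 0 = (\<Prod>z\<in>Z - M. - z)" unfolding B_def by (rule poly_0_prod_linear)
  also have "\<dots> \<notin> M"
  proof -
    have "- z \<in> R \<and> - z \<notin> M" if "z \<in> Z - M" for z using that Z M_uminus[of "- z"] R_intros(5) by auto
    then show ?thesis using unit_prod[of "Z - M" uminus] Z by simp
  qed
  finally have B0: "coeff B 0 \<notin> M" .
  have BR: "coeff B i \<in> R" for i using B by (simp add: polys_over_def)
  have *: "(\<Sum>j<i. coeff A j * coeff B (i - j)) \<in> M" if "i \<le> s" for i
    using that A(2) BR by (intro M_sum M_mult) auto
  have c: "coeff f i = (\<Sum>j<i. coeff A j * coeff B (i - j)) + coeff A i * coeff B 0" for i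
    unfolding fAB coeff_mult by (simp add: lessThan_Suc_atMost[symmetric])
  show "\<forall>i<card (Z \<inter> M). coeff f i \<in> M"
    using * A(2) BR unfolding s_def[symmetric] by (auto simp: c intro!: M_add M_mult)
  show "coeff f (card (Z \<inter> M)) \<notin> M"
  proof
    assume "coeff f (card (Z \<inter> M)) \<in> M"
    then have "coeff f s - (\<Sum>j<s. coeff A j * coeff B (s - j)) \<in> M" using *[of s] by (intro M_diff) (auto simp: s_def)
    then show False using B0 by (simp add: c A(3))
  qed
qed

lemma croots_laguerre_R: "croots (laguerre k a) \<subseteq> R"
  using root_in_R[OF monic_laguerre_over_subring[OF R]] by (auto simp: croots_laguerre)

lemma laguerre_coeffs_mod_M:
  shows "\<forall>i<card (croots (laguerre k a) \<inter> M). of_int (lag_coeff k a i) \<in> M"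
    "of_int (lag_coeff k a (card (croots (laguerre k a) \<inter> M))) \<notin> M"
  using coeffs_mod_M[OF finite_croots[OF laguerre_nonzero] croots_laguerre_R, of "monic_laguerre k a" k a]
    monic_dvd_laguerre_roots(1)[of "monic_laguerre k a" k a]
  by (simp_all add: croots_laguerre coeff_monic_laguerre)

lemma M_power_imp': assumes "x ^ n \<in> M" "n > 0" shows "x \<in> M"
proof (cases "x \<in> R")
  case False
  then have x0: "x \<noteq> 0" using R_intros(1) by auto
  have "inverse x ^ n \<in> R" using M_power[OF not_in_R_imp[OF False] assms(2)] M_imp_R by blast
  then have "x ^ n * inverse x ^ n \<in> M" using assms(1) M_mult by blast
  then show ?thesis using x0 by (simp flip: power_mult_distrib)
qed (use assms M_power_imp in blast)

lemma max_valuation_exists: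
  assumes "finite Z" "Z \<noteq> {}" "0 \<notin> Z"
  shows "\<exists>z0\<in>Z. \<forall>z\<in>Z. z0 / z \<in> R"
  using assms
proof (induction Z rule: finite_ne_induct)
  case (singleton z)
  then show ?case by (simp add: R_intros)
next
  case (insert x Z)
  then obtain z0 where z0: "z0 \<in> Z" "\<And>z. z \<in> Z \<Longrightarrow> z0 / z \<in> R" by auto
  have nz: "x \<noteq> 0" "z0 \<noteq> 0" using insert.prems z0 by auto
  consider "z0 / x \<in> R" | "x / z0 \<in> R" using total[of "z0 / x"] by auto
  then show ?case
  proof cases
    case 1
    then show ?thesis using z0 by (intro bexI[of _ z0]) auto
  next
    case 2
    have "x / z \<in> R" if "z \<in> Z" for z
    proof -
      have "x / z = (x / z0) * (z0 / z)" 
        by (simp only: times_divide_times_eq mult.commute[of x] nonzero_mult_divide_mult_cancel_left[OF nz(2)])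
      then show ?thesis by (rule ssubst) (rule R_intros(4)[OF 2 z0(2)[OF that]])
    qed
    then show ?thesis using nz by (intro bexI[of _ x]) (auto simp: R_intros)
  qed
qed

text \<open>Rational numbers have integral valuation, so a positive one is at least 1.\<close>

lemma rational_in_M: assumes "x \<in> \<rat>" "x \<in> M" shows "\<exists>r\<in>R. x = of_nat p * r"
proof (cases "x = 0")
  case True
  then show ?thesis using R_intros(1) by auto
next
  case False
  then obtain n :: int and u where u: "u \<in> R" "u \<notin> M" "x = of_nat p powi n * u"
    using unramified_Rats assms(1) unfolding unramified_def by blast
  have "n > 0"
  proof (rule ccontr)
    assume "\<not> n > 0"
    then have "u = x * of_nat p ^ nat (- n)" using u(3) by (simp add: power_int_def field_simps)
    then show False using assms(2) u(2) M_mult R_intros(7,10) by metis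
  qed
  then have "nat n = Suc (nat n - 1)" by simp
  then have "x = of_nat p * (of_nat p ^ (nat n - 1) * u)"
    using u(3) \<open>n > 0\<close> by (metis mult.assoc power_Suc power_int_of_nat int_nat_eq less_imp_le)
  moreover have "of_nat p ^ (nat n - 1) * u \<in> R" using u R_intros(4,7,10) by simp
  ultimately show ?thesis by blast
qed

text \<open>The slope condition says that all roots have valuation below \<open>1 / d\<close> (normalised by
  \<open>v(p) = 1\<close>). At most \<open>t < d\<close> roots are units, so the constant term of \<open>g\<close> is divisible by
  \<open>p\<close>, and some root of \<open>g\<close> would have valuation at least \<open>1 / d\<close>.\<close>

lemma no_rational_factor:
  assumes t: "t < d" "d \<le> k" "p dvd a + (k - t)"
    and slope: "\<And>i. i \<in> {1..k} \<Longrightarrow> d * multiplicity p (\<Prod>l\<in>{1..i}. l + a) < i"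
    and g: "g \<in> polys_over \<rat>" "lead_coeff g = 1" "degree g = d" "g dvd monic_laguerre k a"
  shows False
proof -
  let ?Z = "croots (laguerre k a)"
  define Zg where "Zg = {z. poly g z = 0}"
  note rg = monic_dvd_laguerre_roots[OF g(4,2), folded Zg_def]
  have d0: "d > 0" using t by simp
  \<comment> \<open>All these coefficients contain the factor \<open>a + (k - t)\<close>.\<close>
  have "of_int (lag_coeff k a i) \<in> M" if "i < k - t" for i
  proof -
    have "int p dvd int (a + (k - t))" using t(3) by (simp only: int_dvd_int_iff)
    moreover have "int (a + (k - t)) dvd (\<Prod>l\<in>{i+1..k}. int (l + a))"
      using that by (intro dvd_prodI[of _ "k - t" "\<lambda>l. int (l + a)", THEN dvd_trans[rotated]]) (auto simp: add.commute)
    ultimately show ?thesis unfolding lag_coeff_def by (intro of_int_in_M) (meson dvd_mult dvd_trans)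
  qed
  then have "card (?Z \<inter> M) \<ge> k - t"
    using laguerre_coeffs_mod_M(2)[of k a] by (meson not_le)
  moreover have "card ?Z = k" using monic_dvd_laguerre_roots(2)[of "monic_laguerre k a" k a] by (simp add: croots_laguerre)
  moreover have finZ: "finite ?Z" by (rule finite_croots[OF laguerre_nonzero])
  moreover have "card (?Z - M) = card ?Z - card (?Z \<inter> M)" using finZ by (metis Diff_Int_distrib2 Int_commute card_Diff_subset_Int finite_Int)
  ultimately have cU: "card (?Z - M) \<le> t" by simp
  have "\<not> Zg \<subseteq> ?Z - M"
  proof
    assume "Zg \<subseteq> ?Z - M"
    then have "card Zg \<le> card (?Z - M)" using finZ by (intro card_mono) auto
    then show False using cU rg(2) g(3) t by simp
  qed
  then obtain y where y: "y \<in> Zg" "y \<in> M" using rg(4) by blast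
  have ZgR: "Zg \<subseteq> R" using rg(4) croots_laguerre_R by blast
  have nz: "0 \<notin> Zg" using rg(4) zero_not_root_laguerre by (auto simp: croots_laguerre)
  have c0: "coeff g 0 = (\<Prod>z\<in>Zg. - z)" by (subst rg(1)) (rule poly_0_prod_linear)
  have "(\<Prod>z\<in>Zg. - z) = - y * (\<Prod>z\<in>Zg - {y}. - z)" using y rg(3) by (simp add: prod.remove)
  also have "\<dots> \<in> M" using y ZgR by (intro M_mult M_uminus R_intros) auto
  finally have "coeff g 0 \<in> M" using c0 by simp
  moreover have "coeff g 0 \<in> \<rat>" using g(1) by (simp add: polys_over_def)
  ultimately obtain r where r: "r \<in> R" "coeff g 0 = of_nat p * r" using rational_in_M by blast
  obtain z0 where z0: "z0 \<in> Zg" "\<And>z. z \<in> Zg \<Longrightarrow> z0 / z \<in> R"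
    using max_valuation_exists[OF rg(3) _ nz] y by blast
  \<comment> \<open>The root of largest valuation has at least the average valuation of the roots of
    \<open>g\<close>, and that is at least \<open>1 / d\<close>.\<close>
  have "z0 ^ d = (\<Prod>z\<in>Zg. (- z) * (- (z0 / z)))"
  proof -
    have "(\<Prod>z\<in>Zg. (- z) * (- (z0 / z))) = (\<Prod>z\<in>Zg. z0)" using nz by (intro prod.cong) auto
    then show ?thesis using rg(2) g(3) by simp
  qed
  also have "\<dots> = of_nat p * (r * (\<Prod>z\<in>Zg. - (z0 / z)))" unfolding prod.distrib using r(2) c0 by simp
  finally obtain w where w: "w \<in> R" "z0 ^ d = of_nat p * w" using r z0(2) by (metis R_intros(4,5,9))
  define c where "c i = (of_int (lag_coeff k a i) :: complex)" for i
  have c00: "c 0 \<noteq> 0" by (simp add: c_def lag_coeff_0_nonzero)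
  \<comment> \<open>The claim is proved for the \<open>d\<close>-th power, where the fractional
    valuation of \<open>z0\<close> turns into a factor \<open>p\<close>; the slope bound leaves at
    least one \<open>p\<close> over.\<close>
  have small: "c i * z0 ^ i / c 0 \<in> M" if i: "i \<in> {1..k}" for i
  proof -
    define P where "P = (\<Prod>l\<in>{1..i}. l + a)"
    define v where "v = multiplicity p P"
    have P0: "P \<noteq> 0" by (simp add: P_def)
    have "\<not> is_unit p" using prime_p by (auto dest: prime_gt_1_nat)
    then obtain b where b: "P = p ^ v * b" "\<not> p dvd b" using multiplicity_decompose'[OF P0, of p] v_def by metis
    have vd: "d * v < i" using slope[OF i] by (simp add: v_def P_def)
    have bM: "of_nat b \<in> R" "of_nat b \<notin> M" using of_nat_notin_M[OF b(2)] R_intros(10) by auto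
    have "lag_coeff k a i * int P = (-1) ^ i * int (k choose i) * lag_coeff k a 0"
      using lag_coeff_quotient[of i k a] i by (simp add: P_def)
    then have "c i * of_nat P = (-1) ^ i * of_nat (k choose i) * c 0"
      unfolding c_def by (metis of_int_minus of_int_1 of_int_mult of_int_of_nat_eq of_int_power)
    then have q: "c i / c 0 = (-1) ^ i * of_nat (k choose i) / of_nat P"
      using c00 P0 by (simp add: field_simps)
    have "(c i * z0 ^ i / c 0) ^ d = (c i / c 0) ^ d * (z0 ^ d) ^ i"
      by (simp add: power_mult_distrib power_divide mult.commute flip: power_mult)
    also have "\<dots> = ((-1) ^ i * of_nat (k choose i)) ^ d * w ^ i * of_nat p ^ i / (of_nat p ^ (v * d) * of_nat b ^ d)"
      unfolding q w(2) b(1) by (simp add: power_mult_distrib power_divide power_mult)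
    also have "(of_nat p :: complex) ^ i = of_nat p ^ (i - d * v) * of_nat p ^ (v * d)"
      using vd by (simp flip: power_add add: mult.commute)
    also have "((-1) ^ i * of_nat (k choose i)) ^ d * w ^ i * (of_nat p ^ (i - d * v) * of_nat p ^ (v * d)) / (of_nat p ^ (v * d) * of_nat b ^ d)
      = of_nat p ^ (i - d * v) * (((-1) ^ i * of_nat (k choose i)) ^ d * w ^ i * inverse (of_nat b) ^ d)"
      by (simp add: field_simps power_inverse)
    also have "\<dots> \<in> M"
      using vd w unitD(2)[OF bM] R_intros by (intro M_mult M_power p_in_M) auto
    finally show ?thesis using M_power_imp'[OF _ d0] by blast
  qed
  \<comment> \<open>The constant term strictly dominates all other terms at \<open>z0\<close>, so
    they cannot cancel.\<close>
  have "poly (monic_laguerre k a) z0 = 0" using z0(1) rg(4) by (auto simp: croots_laguerre)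
  then have "(\<Sum>i\<le>k. c i * z0 ^ i) = 0" by (simp add: poly_altdef coeff_monic_laguerre c_def)
  moreover have "{..k} = insert 0 {1..k}" by auto
  ultimately have "c 0 + (\<Sum>i\<in>{1..k}. c i * z0 ^ i) = 0" by simp
  then have "(\<Sum>i\<in>{1..k}. c i * z0 ^ i / c 0) = - 1"
    using c00 by (simp add: field_simps eq_neg_iff_add_eq_0 flip: sum_divide_distrib)
  moreover have "(\<Sum>i\<in>{1..k}. c i * z0 ^ i / c 0) \<in> M" using small by (rule M_sum)
  ultimately show False using M_uminus[of "-1"] by simp
qed

end

section \<open>Prime divisors in short intervals\<close>

lemma binomial_middle_le: "(2 * m + 1) choose m \<le> 4 ^ m"
proof -
  have "2 * ((2 * m + 1) choose m) = (\<Sum>i\<in>{m, m + 1}. (2 * m + 1) choose i)"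
    using binomial_symmetric[of m "2 * m + 1"] by simp
  also have "\<dots> \<le> (\<Sum>i\<le>2 * m + 1. (2 * m + 1) choose i)" by (rule sum_mono2) auto
  also have "\<dots> = 2 ^ (2 * m + 1)" by (rule choose_row_sum)
  also have "\<dots> = 2 * 4 ^ m" by (simp add: power_mult)
  finally show ?thesis by simp
qed

lemma prod_primes_dvd:
  fixes m :: nat
  assumes "finite Q" "\<And>p. p \<in> Q \<Longrightarrow> prime p \<and> p dvd m"
  shows "\<Prod>Q dvd m"
  using assms
proof (induction Q rule: finite_induct)
  case (insert p Q)
  have "coprime p (\<Prod>Q)" using insert by (intro prod_coprime_right) (metis insertCI primes_coprime)
  then show ?case using insert by (simp add: divides_mult)
qed simp

lemma sum_ln_primes_le:
  fixes m :: nat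
  assumes "finite Q" "\<And>p. p \<in> Q \<Longrightarrow> prime p \<and> p dvd m" "m > 0"
  shows "(\<Sum>p\<in>Q. ln (real p)) \<le> ln (real m)"
proof -
  have pos: "\<And>p. p \<in> Q \<Longrightarrow> p > 0" using assms(2) prime_gt_0_nat by blast
  then have "(\<Sum>p\<in>Q. ln (real p)) = ln (real (\<Prod>Q))"
    using assms(1) by (simp add: ln_prod of_nat_prod)
  also have "\<dots> \<le> ln (real m)"
  proof -
    have "\<Prod>Q \<le> m" using prod_primes_dvd[OF assms(1,2)] assms(3) by (simp add: dvd_imp_le)
    moreover have "\<Prod>Q > 0" using pos by (simp add: prod_pos)
    ultimately show ?thesis by (simp del: of_nat_prod)
  qed
  finally show ?thesis .
qed

definition primes_le :: "nat \<Rightarrow> nat set" where "primes_le n = {p. prime p \<and> p \<le> n}"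

lemma finite_primes_le [simp]: "finite (primes_le n)"
  by (rule finite_subset[of _ "{..n}"]) (auto simp: primes_le_def)

text \<open>Erdos's induction: the primes from \<open>m + 2\<close> to \<open>2 * m + 1\<close>
  divide \<open>(2 * m + 1) choose m\<close>, which is at most \<open>4 ^ m\<close>. An even
  \<open>n > 2\<close> reduces to its predecessor.\<close>

theorem primorial_le: "\<Prod>(primes_le n) \<le> 4 ^ n"
proof (induction n rule: less_induct)
  case (less n)
  consider "n \<le> 1" | "n = 2" | m where "n = 2 * m" "m > 1" | m where "n = 2 * m + 1" "m > 0"
  proof -
    have "n \<le> 1 \<or> n = 2 \<or> (\<exists>m. n = 2 * m \<and> m > 1) \<or> (\<exists>m. n = 2 * m + 1 \<and> m > 0)" by presburger
    then show ?thesis using that by blast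
  qed
  then show ?case
  proof cases
    case 1
    then have "primes_le n = {}" by (auto simp: primes_le_def dest!: prime_ge_2_nat)
    then show ?thesis by simp
  next
    case 2
    then have "primes_le n = {2}" using prime_ge_2_nat by (auto simp: primes_le_def intro: le_antisym)
    then show ?thesis using 2 by simp
  next
    case (3 m)
    have "\<not> prime n" using 3 prime_product[of 2 m] by auto
    then have "primes_le n = primes_le (n - 1)"
      using 3 by (auto simp: primes_le_def) (metis One_nat_def Suc_pred le_SucE le_0_eq neq0_conv less_numeral_extra(3) prime_gt_0_nat)
    then have "\<Prod>(primes_le n) \<le> 4 ^ (n - 1)" using less[of "n - 1"] 3 by simp
    also have "\<dots> \<le> 4 ^ n" by (rule power_increasing) auto
    finally show ?thesis .
  next
    case (4 m)
    define Q where "Q = {p. prime p \<and> m + 1 < p \<and> p \<le> n}"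
    have fin: "finite Q" by (rule finite_subset[of _ "{..n}"]) (auto simp: Q_def)
    have split: "primes_le n = primes_le (m + 1) \<union> Q" using 4 by (auto simp: primes_le_def Q_def)
    have "p dvd ((2 * m + 1) choose m)" if "p \<in> Q" for p
    proof -
      have p: "prime p" "m + 1 < p" "p \<le> 2 * m + 1" using that 4 by (auto simp: Q_def)
      have "fact m * fact (2 * m + 1 - m) * ((2 * m + 1) choose m) = (fact (2 * m + 1) :: nat)"
        by (rule binomial_fact_lemma) simp
      moreover have "p dvd fact (2 * m + 1)" using p by (simp add: prime_dvd_fact_iff del: fact_Suc)
      moreover have "\<not> p dvd fact m" "\<not> p dvd fact (2 * m + 1 - m)" using p by (simp_all add: prime_dvd_fact_iff del: fact_Suc)
      ultimately show ?thesis using p(1) by (metis prime_dvd_mult_iff)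
    qed
    then have "\<Prod>Q dvd ((2 * m + 1) choose m)" using fin by (intro prod_primes_dvd) (auto simp: Q_def)
    moreover have "0 < (2 * m + 1) choose m" by (simp add: zero_less_binomial_iff)
    ultimately have "\<Prod>Q \<le> 4 ^ m" using binomial_middle_le[of m] dvd_imp_le order_trans by blast
    moreover have "\<Prod>(primes_le (m + 1)) \<le> 4 ^ (m + 1)" using less[of "m + 1"] 4 by simp
    ultimately have "\<Prod>(primes_le (m + 1)) * \<Prod>Q \<le> 4 ^ (m + 1) * 4 ^ m" by (intro mult_mono) auto
    moreover have "\<Prod>(primes_le n) = \<Prod>(primes_le (m + 1)) * \<Prod>Q"
      unfolding split by (rule prod.union_disjoint) (use fin in \<open>auto simp: primes_le_def Q_def\<close>)
    moreover have "(4 :: nat) ^ (m + 1) * 4 ^ m = 4 ^ n" using 4 by (simp flip: power_add add: mult_2)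
    ultimately show ?thesis by simp
  qed
qed

lemma sum_ln_primes_le_ln4: "(\<Sum>p\<in>primes_le n. ln (real p)) \<le> real n * ln 4"
proof -
  have pos: "\<And>p. p \<in> primes_le n \<Longrightarrow> p > 0" by (auto simp: primes_le_def prime_gt_0_nat)
  then have "(\<Sum>p\<in>primes_le n. ln (real p)) = ln (real (\<Prod>(primes_le n)))" by (simp add: ln_prod of_nat_prod)
  also have "\<dots> \<le> ln (4 ^ n)"
  proof -
    have "real (\<Prod>(primes_le n)) \<le> real (4 ^ n)" using primorial_le[of n] by (simp only: of_nat_le_iff)
    moreover have "real (\<Prod>(primes_le n)) > 0" using pos by (simp add: prod_pos)
    ultimately show ?thesis by (simp del: of_nat_prod)
  qed
  finally show ?thesis by (simp add: ln_realpow)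
qed

lemma card_multiples: "p > 0 \<Longrightarrow> card {m \<in> {s<..s + d}. p dvd m} = (s + d) div p - s div (p :: nat)"
proof (induction d)
  case (Suc d)
  have le: "s div p \<le> (s + d) div p" by (simp add: div_le_mono)
  show ?case
  proof (cases "p dvd Suc (s + d)")
    case True
    have "{m \<in> {s<..s + Suc d}. p dvd m} = insert (Suc (s + d)) {m \<in> {s<..s + d}. p dvd m}"
      using True by (auto simp: le_Suc_eq)
    then have "card {m \<in> {s<..s + Suc d}. p dvd m} = Suc (card {m \<in> {s<..s + d}. p dvd m})" by simp
    moreover have "Suc (s + d) div p = Suc ((s + d) div p)"
      using True by (simp add: div_Suc dvd_eq_mod_eq_0)
    ultimately show ?thesis using Suc le by simp
  next
    case False
    then have "{m \<in> {s<..s + Suc d}. p dvd m} = {m \<in> {s<..s + d}. p dvd m}"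
      by (auto simp: le_Suc_eq)
    moreover have "Suc (s + d) div p = (s + d) div p"
      using False by (simp add: div_Suc dvd_eq_mod_eq_0)
    ultimately show ?thesis using Suc by simp
  qed
qed simp

lemma card_multiples_le: "p > 0 \<Longrightarrow> real (card {m \<in> {s<..s + d}. p dvd m}) \<le> real d / real p + 1"
proof -
  assume p: "p > 0"
  have "(s + d) div p \<le> s div p + d div p + 1"
  proof -
    have "(s + d) div p = s div p + d div p + (s mod p + d mod p) div p" by (rule div_add1_eq)
    moreover have "(s mod p + d mod p) div p < 2"
      by (rule less_mult_imp_div_less) (use mod_less_divisor[OF p, of s] mod_less_divisor[OF p, of d] in linarith)
    ultimately show ?thesis by simp
  qed
  then have "card {m \<in> {s<..s + d}. p dvd m} \<le> d div p + 1" using card_multiples[OF p, of s d] by simp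
  moreover have "real (d div p) \<le> real d / real p" by (rule of_nat_div_le_of_nat)
  ultimately show ?thesis by linarith
qed

text \<open>Double counting of pairs of a prime and a multiple up to \<open>n\<close>, where each
  multiple contributes at most \<open>ln n\<close>. Replacing \<open>n / p\<close> by its integer
  part costs at most \<open>ln p\<close> per prime, which \<open>sum_ln_primes_le_ln4\<close>
  controls.\<close>

theorem mertens_upper: assumes "n \<ge> 1" shows "(\<Sum>p\<in>primes_le n. ln (real p) / real p) \<le> ln (real n) + ln 4"
proof -
  have fin: "finite {p \<in> primes_le n. p dvd m}" for m by simp
  have "(\<Sum>p\<in>primes_le n. ln (real p) * real (n div p)) = (\<Sum>p\<in>primes_le n. \<Sum>m\<in>{m \<in> {0<..n}. p dvd m}. ln (real p))"
  proof (rule sum.cong)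
    fix p assume "p \<in> primes_le n"
    then have "p > 0" by (auto simp: primes_le_def prime_gt_0_nat)
    then show "ln (real p) * real (n div p) = (\<Sum>m\<in>{m \<in> {0<..n}. p dvd m}. ln (real p))"
      using card_multiples[of p 0 n] by simp
  qed simp
  also have "\<dots> = (\<Sum>m\<in>{0<..n}. \<Sum>p\<in>{p \<in> primes_le n. p dvd m}. ln (real p))"
    by (rule sum.swap_restrict) auto
  also have "\<dots> \<le> (\<Sum>m\<in>{0<..n}. ln (real n))"
  proof (rule sum_mono)
    fix m assume m: "m \<in> {0<..n}"
    have "(\<Sum>p\<in>{p \<in> primes_le n. p dvd m}. ln (real p)) \<le> ln (real m)"
      using m by (intro sum_ln_primes_le) (auto simp: primes_le_def)
    also have "\<dots> \<le> ln (real n)" using m by simp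
    finally show "(\<Sum>p\<in>{p \<in> primes_le n. p dvd m}. ln (real p)) \<le> ln (real n)" .
  qed
  finally have 1: "(\<Sum>p\<in>primes_le n. ln (real p) * real (n div p)) \<le> real n * ln (real n)" by simp
  have "real n * (\<Sum>p\<in>primes_le n. ln (real p) / real p) = (\<Sum>p\<in>primes_le n. ln (real p) * (real n / real p))"
    by (simp add: sum_distrib_left mult_ac)
  also have "\<dots> \<le> (\<Sum>p\<in>primes_le n. ln (real p) * (real (n div p) + 1))"
  proof (intro sum_mono mult_left_mono)
    fix p assume "p \<in> primes_le n"
    then have p: "p > 0" by (auto simp: primes_le_def prime_gt_0_nat)
    then show "0 \<le> ln (real p)" by simp
    have "n = p * (n div p) + n mod p" by simp
    moreover have "n mod p \<le> p" using p by (simp add: less_imp_le)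
    ultimately have "n \<le> p * (n div p) + p" by linarith
    then have "real n \<le> real (p * (n div p) + p)" by (simp only: of_nat_le_iff)
    then show "real n / real p \<le> real (n div p) + 1" using p by (simp add: field_simps)
  qed
  also have "\<dots> = (\<Sum>p\<in>primes_le n. ln (real p) * real (n div p)) + (\<Sum>p\<in>primes_le n. ln (real p))"
    by (simp add: distrib_left sum.distrib)
  also have "\<dots> \<le> real n * (ln (real n) + ln 4)" using 1 sum_ln_primes_le_ln4[of n] by (simp add: distrib_left)
  finally show ?thesis using assms by simp
qed

text \<open>Only primes dividing exactly once give an edge of slope \<open>1 / j\<close>, so
  smoothness is measured by these primes.\<close>

definition simple_primes :: "nat \<Rightarrow> nat set" where
  "simple_primes n = {p. prime p \<and> p dvd n \<and> \<not> p\<^sup>2 dvd n}"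

lemma finite_simple_primes: "n > 0 \<Longrightarrow> finite (simple_primes n)"
  by (rule finite_subset[of _ "{..n}"]) (auto simp: simple_primes_def dest: dvd_imp_le)

text \<open>The remaining primes are collected into \<open>q\<close> with exponents
  \<open>e div 2\<close>, so that \<open>q ^ 2\<close> divides \<open>n\<close>. The factor 3 comes
  from \<open>e \<le> 3 * (e div 2)\<close> for \<open>e \<ge> 2\<close>, sharp at 3.\<close>

lemma sum_ln_simple_primes_ge:
  assumes n: "n > 0" and w: "w \<ge> 1" and sq: "\<And>q. q\<^sup>2 dvd n \<Longrightarrow> real q \<le> w"
  shows "(\<Sum>p\<in>simple_primes n. ln (real p)) \<ge> ln (real n) - 3 * ln w"
proof -
  define e where "e p = multiplicity p n" for p
  define A where "A = {p \<in> prime_factors n. e p \<ge> 2}"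
  have fin: "finite (prime_factors n)" by simp
  have prime: "prime p" if "p \<in> prime_factors n" for p using that by auto
  have e1: "e p \<ge> 1" if "p \<in> prime_factors n" for p using that n unfolding e_def
    by (metis One_nat_def Suc_leI prime_factors_multiplicity mem_Collect_eq)
  have eq: "n = (\<Prod>p\<in>prime_factors n. p ^ e p)" using prime_factorization_nat[OF n] by (simp add: e_def)
  have split: "prime_factors n = simple_primes n \<union> A" "simple_primes n \<inter> A = {}"
  proof -
    have *: "p\<^sup>2 dvd n \<longleftrightarrow> e p \<ge> 2" if "prime p" for p
      using that n unfolding e_def by (intro power_dvd_iff_le_multiplicity) auto
    show "prime_factors n = simple_primes n \<union> A"
      using n * by (auto simp: simple_primes_def A_def prime_factors_dvd)
    show "simple_primes n \<inter> A = {}" using * by (auto simp: simple_primes_def A_def)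
  qed
  define q where "q = (\<Prod>p\<in>A. p ^ (e p div 2))"
  have "(\<Prod>p\<in>A. p ^ (2 * (e p div 2))) dvd (\<Prod>p\<in>A. p ^ e p)"
    by (rule prod_dvd_prod) (auto intro: le_imp_power_dvd)
  moreover have "(\<Prod>p\<in>A. p ^ e p) dvd n"
    by (subst eq, rule prod_dvd_prod_subset) (auto simp: A_def)
  moreover have "q\<^sup>2 = (\<Prod>p\<in>A. p ^ (2 * (e p div 2)))"
    unfolding q_def prod_power_distrib by (simp add: mult.commute flip: power_mult)
  ultimately have "q\<^sup>2 dvd n" by (metis dvd_trans)
  then have qw: "real q \<le> w" by (rule sq)
  have Apos: "\<And>p. p \<in> A \<Longrightarrow> real p > 0" "\<And>p. p \<in> A \<Longrightarrow> real p \<ge> 1"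
    using prime prime_gt_0_nat prime_ge_1_nat by (auto simp: A_def)
  have q0: "q > 0" using Apos by (auto simp: q_def intro!: prod_pos)
  have lnq: "ln (real q) = (\<Sum>p\<in>A. real (e p div 2) * ln (real p))"
  proof -
    have "ln (real q) = ln (\<Prod>p\<in>A. real p ^ (e p div 2))" by (simp add: q_def)
    also have "\<dots> = (\<Sum>p\<in>A. ln (real p ^ (e p div 2)))" using Apos(1) by (intro ln_prod) (auto simp: A_def)
    also have "\<dots> = (\<Sum>p\<in>A. real (e p div 2) * ln (real p))" using Apos(1) by (intro sum.cong) (auto simp: ln_realpow)
    finally show ?thesis .
  qed
  have "ln (real n) = (\<Sum>p\<in>prime_factors n. real (e p) * ln (real p))"
    by (subst eq) (use prime prime_gt_0_nat in \<open>simp add: of_nat_prod ln_prod ln_realpow del: prod_constant\<close>)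
  also have "\<dots> = (\<Sum>p\<in>simple_primes n. real (e p) * ln (real p)) + (\<Sum>p\<in>A. real (e p) * ln (real p))"
    unfolding split(1) using split finite_simple_primes[OF n] by (intro sum.union_disjoint) (auto simp: A_def)
  also have "(\<Sum>p\<in>simple_primes n. real (e p) * ln (real p)) = (\<Sum>p\<in>simple_primes n. ln (real p))"
  proof (rule sum.cong)
    fix p assume p: "p \<in> simple_primes n"
    then have "p \<in> prime_factors n" "p \<notin> A" using split by blast+
    then have "e p = 1" using e1[of p] by (auto simp: A_def)
    then show "real (e p) * ln (real p) = ln (real p)" by simp
  qed simp
  also have "(\<Sum>p\<in>A. real (e p) * ln (real p)) \<le> (\<Sum>p\<in>A. 3 * (real (e p div 2) * ln (real p)))"
  proof (rule sum_mono)
    fix p assume p: "p \<in> A"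
    then have "e p \<le> 3 * (e p div 2)" by (auto simp: A_def)
    then have "real (e p) \<le> 3 * real (e p div 2)" by linarith
    moreover have "ln (real p) \<ge> 0" using Apos(2)[OF p] by simp
    ultimately show "real (e p) * ln (real p) \<le> 3 * (real (e p div 2) * ln (real p))"
      by (metis mult.assoc mult_right_mono)
  qed
  also have "\<dots> = 3 * ln (real q)" by (simp add: lnq sum_distrib_left)
  also have "ln (real q) \<le> ln w" using qw q0 w by simp
  finally show ?thesis by linarith
qed

text \<open>Each prime \<open>p\<close> is weighted by \<open>ln p\<close> and divides at most \<open>d / p + 1\<close> elements of the interval.\<close>

theorem few_smooth_numbers:
  fixes X :: real
  assumes T: "T \<subseteq> {s<..s + d}" and P: "P \<ge> 1"
    and X: "\<And>n. n \<in> T \<Longrightarrow> X \<le> (\<Sum>p\<in>simple_primes n. ln (real p))"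
    and sub: "\<And>n. n \<in> T \<Longrightarrow> simple_primes n \<subseteq> primes_le P \<union> Q"
    and Q: "finite Q" "\<And>p. p \<in> Q \<Longrightarrow> prime p \<and> card {n \<in> T. p dvd n} \<le> 1"
  shows "X * real (card T) \<le> real d * (ln (real P) + ln 4) + real P * ln 4 + (\<Sum>p\<in>Q. ln (real p))"
proof -
  have finT: "finite T" using T finite_subset by blast
  have lnpos: "ln (real p) \<ge> 0" if "prime p" for p using prime_ge_1_nat[OF that] by simp
  have "X * real (card T) \<le> (\<Sum>n\<in>T. \<Sum>p\<in>simple_primes n. ln (real p))"
    using sum_mono[of T "\<lambda>_. X", OF X] by (simp add: mult.commute)
  also have "\<dots> \<le> (\<Sum>n\<in>T. (\<Sum>p\<in>{p \<in> primes_le P. p dvd n}. ln (real p)) + (\<Sum>p\<in>{p \<in> Q. p dvd n}. ln (real p)))"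
  proof (rule sum_mono)
    fix n assume n: "n \<in> T"
    have fin: "finite {p \<in> primes_le P. p dvd n}" "finite {p \<in> Q. p dvd n}" using Q(1) by auto
    have "(\<Sum>p\<in>simple_primes n. ln (real p)) \<le> (\<Sum>p\<in>{p \<in> primes_le P. p dvd n} \<union> {p \<in> Q. p dvd n}. ln (real p))"
      using sub[OF n] fin Q(2) lnpos by (intro sum_mono2) (auto simp: simple_primes_def primes_le_def)
    also have "\<dots> \<le> (\<Sum>p\<in>{p \<in> primes_le P. p dvd n}. ln (real p)) + (\<Sum>p\<in>{p \<in> Q. p dvd n}. ln (real p))"
    proof -
      have "(\<Sum>p\<in>{p \<in> primes_le P. p dvd n} \<inter> {p \<in> Q. p dvd n}. ln (real p)) \<ge> 0"
        using Q(2) lnpos by (intro sum_nonneg) auto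
      then show ?thesis using sum.union_inter[OF fin, of "\<lambda>p. ln (real p)"] by linarith
    qed
    finally show "(\<Sum>p\<in>simple_primes n. ln (real p)) \<le>
      (\<Sum>p\<in>{p \<in> primes_le P. p dvd n}. ln (real p)) + (\<Sum>p\<in>{p \<in> Q. p dvd n}. ln (real p))" .
  qed
  also have "\<dots> = (\<Sum>p\<in>primes_le P. \<Sum>n\<in>{n \<in> T. p dvd n}. ln (real p)) + (\<Sum>p\<in>Q. \<Sum>n\<in>{n \<in> T. p dvd n}. ln (real p))"
    using finT Q(1) by (simp add: sum.distrib sum.swap_restrict[of T] del: sum_constant)
  also have "\<dots> \<le> (\<Sum>p\<in>primes_le P. real d * (ln (real p) / real p) + ln (real p)) + (\<Sum>p\<in>Q. ln (real p))"
  proof (intro add_mono sum_mono)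
    fix p assume "p \<in> primes_le P"
    then have p: "prime p" by (simp add: primes_le_def)
    have "card {n \<in> T. p dvd n} \<le> card {m \<in> {s<..s + d}. p dvd m}" using T by (intro card_mono) auto
    then have "real (card {n \<in> T. p dvd n}) \<le> real d / real p + 1"
      using card_multiples_le[OF prime_gt_0_nat[OF p], of s d] by linarith
    then have "real (card {n \<in> T. p dvd n}) * ln (real p) \<le> (real d / real p + 1) * ln (real p)"
      using lnpos[OF p] by (rule mult_right_mono)
    then show "(\<Sum>n\<in>{n \<in> T. p dvd n}. ln (real p)) \<le> real d * (ln (real p) / real p) + ln (real p)"
      by (simp add: algebra_simps)
  next
    fix p assume p: "p \<in> Q"
    then have "real (card {n \<in> T. p dvd n}) * ln (real p) \<le> 1 * ln (real p)"
      using Q(2)[OF p] lnpos by (intro mult_right_mono) auto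
    then show "(\<Sum>n\<in>{n \<in> T. p dvd n}. ln (real p)) \<le> ln (real p)" by simp
  qed
  also have "(\<Sum>p\<in>primes_le P. real d * (ln (real p) / real p) + ln (real p)) =
      real d * (\<Sum>p\<in>primes_le P. ln (real p) / real p) + (\<Sum>p\<in>primes_le P. ln (real p))"
    by (simp add: sum.distrib sum_distrib_left)
  also have "\<dots> \<le> real d * (ln (real P) + ln 4) + real P * ln 4"
    using mertens_upper[OF P] sum_ln_primes_le_ln4[of P] by (intro add_mono mult_left_mono) auto
  finally show ?thesis by linarith
qed

section \<open>Multiplicity of a prime in a product of consecutive integers\<close>

lemma prime_dvd_shift_unique:
  fixes p :: nat
  assumes "k < p" "p dvd a + j" "p dvd a + l" "j \<le> k" "l \<le> k"
  shows "l = j"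
proof (rule ccontr)
  assume "l \<noteq> j"
  have "int p dvd int (a + l) - int (a + j)" using assms by (intro dvd_diff) (simp_all only: int_dvd_int_iff)
  then have "int p dvd int l - int j" by simp
  then have "int p \<le> \<bar>int l - int j\<bar>" using \<open>l \<noteq> j\<close> by (intro zdvd_imp_le) (auto simp: dvd_abs_iff)
  then show False using assms by auto
qed

lemma multiplicity_prod_shift:
  assumes "prime (p :: nat)" "a > 0"
  shows "multiplicity p (\<Prod>l\<in>{1..i}. l + a) = (\<Sum>l\<in>{1..i}. multiplicity p (l + a))"
  using assms by (intro prime_elem_multiplicity_prod_distrib) auto

lemma card_multiples_shift_le:
  assumes "q > 0"
  shows "real (card {l \<in> {1..i}. q dvd l + a}) \<le> real i / real q + 1"
proof -
  have "bij_betw (\<lambda>l. l + a) {l \<in> {1..i}. q dvd l + a} {m \<in> {a<..a + i}. q dvd m}"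
    by (rule bij_betwI[where g = "\<lambda>m. m - a"]) auto
  then show ?thesis using card_multiples_le[OF assms, of a i] by (simp add: bij_betw_same_card)
qed

text \<open>Each multiple of \<open>p\<close> contributes at most 2, so no error of size
  \<open>ln (i + a)\<close> arises; this serves the \<open>i\<close> that are too small to absorb
  such an error.\<close>

lemma multiplicity_prod_shift_le_cubefree:
  assumes p: "prime (p :: nat)" and a: "a > 0" and cf: "\<And>l. l \<in> {1..i} \<Longrightarrow> \<not> p ^ 3 dvd l + a"
  shows "real (multiplicity p (\<Prod>l\<in>{1..i}. l + a)) \<le> 2 * (real i / real p + 1)"
proof -
  have "multiplicity p (\<Prod>l\<in>{1..i}. l + a) = (\<Sum>l\<in>{1..i}. multiplicity p (l + a))"
    by (rule multiplicity_prod_shift[OF p a])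
  also have "\<dots> \<le> (\<Sum>l\<in>{1..i}. if p dvd l + a then 2 else 0)"
  proof (rule sum_mono)
    fix l assume l: "l \<in> {1..i}"
    have "\<not> multiplicity p (l + a) \<ge> 3" using cf[OF l] multiplicity_dvd' by blast
    then show "multiplicity p (l + a) \<le> (if p dvd l + a then 2 else 0)" by (auto simp: not_dvd_imp_multiplicity_0)
  qed
  also have "\<dots> = 2 * card {l \<in> {1..i}. p dvd l + a}" by (simp add: sum.If_cases Int_def)
  finally have "real (multiplicity p (\<Prod>l\<in>{1..i}. l + a)) \<le> real (2 * card {l \<in> {1..i}. p dvd l + a})"
    by (simp only: of_nat_le_iff)
  then show ?thesis using card_multiples_shift_le[OF prime_gt_0_nat[OF p], of i a] by simp
qed

text \<open>Legendre's formula for a shifted factorial: the exponent \<open>m\<close> contributes at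
  most \<open>i / p ^ m + 1\<close>. The geometric series gives the first term, the rounding errors
  the logarithm.\<close>

lemma multiplicity_prod_shift_le:
  assumes p: "prime (p :: nat)" and a: "a > 0"
  shows "real (multiplicity p (\<Prod>l\<in>{1..i}. l + a)) \<le> real i / (real p - 1) + ln (real (i + a)) / ln 2"
proof -
  have p2: "p \<ge> 2" using p by (rule prime_ge_2_nat)
  \<comment> \<open>A bound for the exponents that can occur, taken with base 2 for every
    \<open>p\<close>.\<close>
  define N where "N = nat \<lfloor>ln (real (i + a)) / ln 2\<rfloor>"
  have bound: "multiplicity p (l + a) \<le> N" if "l \<in> {1..i}" for l
  proof -
    have "p ^ multiplicity p (l + a) \<le> l + a" using a by (intro dvd_imp_le multiplicity_dvd) auto
    moreover have "2 ^ multiplicity p (l + a) \<le> p ^ multiplicity p (l + a)" using p2 by (rule power_mono) simp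
    ultimately have "2 ^ multiplicity p (l + a) \<le> i + a" using that by auto
    then have "real (2 ^ multiplicity p (l + a)) \<le> real (i + a)" by (simp only: of_nat_le_iff)
    then have "ln (2 ^ multiplicity p (l + a)) \<le> ln (real (i + a))" using a by simp
    then have "real (multiplicity p (l + a)) \<le> ln (real (i + a)) / ln 2" by (simp add: ln_realpow field_simps)
    then show ?thesis unfolding N_def by (simp add: le_nat_floor)
  qed
  have card: "multiplicity p (l + a) = card {m \<in> {1..N}. p ^ m dvd l + a}" if "l \<in> {1..i}" for l
  proof -
    have "{m \<in> {1..N}. p ^ m dvd l + a} = {1..multiplicity p (l + a)}"
      using bound[OF that] a p2 by (auto simp: power_dvd_iff_le_multiplicity)
    then show ?thesis by simp
  qed
  have "multiplicity p (\<Prod>l\<in>{1..i}. l + a) = (\<Sum>l\<in>{1..i}. card {m \<in> {1..N}. p ^ m dvd l + a})"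
    unfolding multiplicity_prod_shift[OF p a] by (rule sum.cong) (auto simp: card)
  also have "\<dots> = (\<Sum>l\<in>{1..i}. \<Sum>m\<in>{m \<in> {1..N}. p ^ m dvd l + a}. 1)" by simp
  also have "\<dots> = (\<Sum>m\<in>{1..N}. \<Sum>l\<in>{l \<in> {1..i}. p ^ m dvd l + a}. 1)" by (rule sum.swap_restrict) auto
  finally have "real (multiplicity p (\<Prod>l\<in>{1..i}. l + a)) = (\<Sum>m\<in>{1..N}. real (card {l \<in> {1..i}. p ^ m dvd l + a}))"
    by simp
  also have "\<dots> \<le> (\<Sum>m\<in>{1..N}. real i * (1 / real p) ^ m + 1)"
  proof (rule sum_mono)
    fix m
    have "real (card {l \<in> {1..i}. p ^ m dvd l + a}) \<le> real i / real (p ^ m) + 1"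
      using p2 by (intro card_multiples_shift_le) simp
    then show "real (card {l \<in> {1..i}. p ^ m dvd l + a}) \<le> real i * (1 / real p) ^ m + 1"
      by (simp add: power_divide)
  qed
  also have "\<dots> = real i * (\<Sum>m\<in>{1..N}. (1 / real p) ^ m) + real N" by (simp add: sum.distrib sum_distrib_left)
  also have "(\<Sum>m\<in>{1..N}. (1 / real p) ^ m) \<le> 1 / (real p - 1)"
  proof -
    have "(\<Sum>m\<in>{1..N}. (1 / real p) ^ m) + 1 / (real p - 1) * (1 / real p) ^ N = 1 / (real p - 1)" for N
    proof (induction N)
      case (Suc N)
      have "(1 / real p) ^ Suc N + 1 / (real p - 1) * (1 / real p) ^ Suc N = 1 / (real p - 1) * (1 / real p) ^ N"
        using p2 by (simp add: divide_simps)
      then show ?case using Suc by simp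
    qed simp
    moreover have "1 / (real p - 1) * (1 / real p) ^ N \<ge> 0" using p2 by simp
    ultimately show ?thesis by (metis add_increasing2 order_refl le_add_same_cancel1)
  qed
  also have "real N \<le> ln (real (i + a)) / ln 2" unfolding N_def using a by (intro of_nat_floor) simp
  finally show ?thesis by (simp add: mult_left_mono)
qed

section \<open>Permutation groups with Jordan sets\<close>

locale perm_group =
  fixes G :: "('a \<Rightarrow> 'a) set" and Z :: "'a set"
  assumes finite_Z: "finite Z"
    and permutes: "\<pi> \<in> G \<Longrightarrow> \<pi> permutes Z"
    and id_in: "id \<in> G"
    and comp_in: "\<pi> \<in> G \<Longrightarrow> \<rho> \<in> G \<Longrightarrow> \<pi> \<circ> \<rho> \<in> G"
    and inv_in: "\<pi> \<in> G \<Longrightarrow> inv \<pi> \<in> G"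
begin

definition jordan_set :: "'a set \<Rightarrow> bool" where
  "jordan_set S \<longleftrightarrow> S \<subseteq> Z \<and> (\<forall>s\<in>S. \<forall>s'\<in>S. \<exists>\<pi>\<in>G. \<pi> s = s' \<and> (\<forall>u\<in>Z - S. \<pi> u = u))"

lemma jordan_setD:
  "jordan_set S \<Longrightarrow> s \<in> S \<Longrightarrow> s' \<in> S \<Longrightarrow> \<exists>\<pi>\<in>G. \<pi> s = s' \<and> (\<forall>u\<in>Z - S. \<pi> u = u)"
  by (simp add: jordan_set_def)

text \<open>For \<open>b = a\<close> the transposition is the identity, so \<open>a\<close> is
  included. These are the classes of an equivalence relation on \<open>Z\<close> that
  \<open>G\<close> respects.\<close>

definition swap_class :: "'a \<Rightarrow> 'a set" where
  "swap_class a = {b \<in> Z. Transposition.transpose a b \<in> G}"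

lemma swap_class_self: "a \<in> Z \<Longrightarrow> a \<in> swap_class a"
  using id_in by (simp add: swap_class_def)

lemma transpose_conj: "\<pi> \<in> G \<Longrightarrow> Transposition.transpose a b \<in> G \<Longrightarrow> Transposition.transpose (\<pi> a) (\<pi> b) \<in> G"
proof -
  assume \<pi>: "\<pi> \<in> G" and ab: "Transposition.transpose a b \<in> G"
  have bij: "bij \<pi>" using permutes[OF \<pi>] by (rule permutes_bij)
  have "Transposition.transpose (\<pi> a) (\<pi> b) = \<pi> \<circ> Transposition.transpose a b \<circ> inv \<pi>"
  proof
    fix x
    obtain y where y: "x = \<pi> y" using bij by (metis bij_pointE)
    have inj: "\<pi> u = \<pi> v \<longleftrightarrow> u = v" for u v using bij by (auto simp: bij_def inj_def)
    show "Transposition.transpose (\<pi> a) (\<pi> b) x = (\<pi> \<circ> Transposition.transpose a b \<circ> inv \<pi>) x"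
      using bij by (simp add: y inv_f_f bij_is_inj Transposition.transpose_def inj)
  qed
  then show ?thesis using comp_in[OF comp_in[OF \<pi> ab] inv_in[OF \<pi>]] by simp
qed

text \<open>Conjugating \<open>(a b)\<close> by \<open>(b c)\<close> gives
  \<open>(a c)\<close>.\<close>

lemma transpose_trans:
  assumes "Transposition.transpose a b \<in> G" "Transposition.transpose b c \<in> G" shows "Transposition.transpose a c \<in> G"
proof (cases "c = a \<or> b = c \<or> a = b")
  case True
  then show ?thesis using assms id_in by auto
next
  case False
  have "Transposition.transpose (Transposition.transpose b c a) (Transposition.transpose b c b) \<in> G" using transpose_conj[OF assms(2,1)] .
  then show ?thesis using False by (auto simp: Transposition.transpose_def split: if_splits)
qed

lemma swap_class_eq: assumes "b \<in> swap_class a" shows "swap_class b = swap_class a"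
proof -
  have ab: "Transposition.transpose a b \<in> G" using assms by (simp add: swap_class_def)
  then have ba: "Transposition.transpose b a \<in> G" by (simp add: Transposition.transpose_commute)
  show ?thesis using transpose_trans[OF ab] transpose_trans[OF ba] by (auto simp: swap_class_def)
qed

lemma swap_class_image: assumes "\<pi> \<in> G" shows "\<pi> ` swap_class a \<subseteq> swap_class (\<pi> a)"
  using transpose_conj[OF assms] permutes_in_image[OF permutes[OF assms]] by (auto simp: swap_class_def)

lemma swap_class_subset: "swap_class a \<subseteq> Z" by (auto simp: swap_class_def)

lemma finite_swap_class: "finite (swap_class a)"
  using finite_subset[OF swap_class_subset finite_Z] .

text \<open>The sets \<open>swap_class a\<close> are blocks of a common size \<open>b \<ge> 2\<close>. A Jordan set is a union of blocks
  or lies inside one block; as \<open>b\<close> cannot divide both cardinalities, some block contains more than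
  half of \<open>Z\<close> and hence is \<open>Z\<close>.\<close>

theorem symmetric_if_jordan_sets:
  assumes trans: "\<And>x y. x \<in> Z \<Longrightarrow> y \<in> Z \<Longrightarrow> \<exists>\<pi>\<in>G. \<pi> x = y"
    and T: "jordan_set T" "card T = 2"
    and S: "jordan_set S" "jordan_set S'" "card S' = card S + 1" "2 * card S > card Z"
  shows "G = {\<pi>. \<pi> permutes Z}"
proof -
  obtain x y where xy: "T = {x, y}" "x \<noteq> y" using T(2) by (auto simp: card_2_iff)
  have xyZ: "x \<in> Z" "y \<in> Z" using T(1) xy by (auto simp: jordan_set_def)
  obtain \<pi> where \<pi>: "\<pi> \<in> G" "\<pi> x = y" "\<And>u. u \<in> Z - T \<Longrightarrow> \<pi> u = u"
    using jordan_setD[OF T(1), of x y] xy(1) by auto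
  have perm: "\<pi> permutes Z" using permutes[OF \<pi>(1)] .
  have "\<pi> y = x"
  proof -
    have "\<pi> y \<in> Z" using perm xyZ by (simp add: permutes_in_image)
    moreover have inj: "\<pi> u = \<pi> v \<Longrightarrow> u = v" for u v using permutes_inj[OF perm] by (auto simp: inj_def)
    moreover have "\<pi> y \<noteq> y" using inj[of x y] \<pi>(2) xy(2) by auto
    moreover have "\<pi> y = y" if "\<pi> y \<in> Z - T" using inj[of "\<pi> y" y] \<pi>(3)[OF that] by auto
    ultimately show ?thesis using xy by blast
  qed
  then have "\<pi> u = Transposition.transpose x y u" for u
    using \<pi> xy permutes_not_in[OF perm, of u] by (cases "u \<in> Z") (auto simp: Transposition.transpose_def)
  then have "\<pi> = Transposition.transpose x y" by blast
  then have "y \<in> swap_class x" using \<pi>(1) xyZ by (simp add: swap_class_def)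
  then have "{x, y} \<subseteq> swap_class x" using swap_class_self[OF xyZ(1)] by simp
  then have card_x: "card (swap_class x) \<ge> 2"
    using card_mono[OF finite_swap_class, of "{x, y}" x] xy by simp
  have le: "card (swap_class u) \<le> card (swap_class v)" if uv: "u \<in> Z" "v \<in> Z" for u v
  proof -
    obtain \<rho> where \<rho>: "\<rho> \<in> G" "\<rho> u = v" using trans[OF uv] by blast
    have "inj_on \<rho> (swap_class u)" using permutes_inj[OF permutes[OF \<rho>(1)]] by (rule inj_on_subset) simp
    then show ?thesis using swap_class_image[OF \<rho>(1), of u] \<rho>(2)
      by (metis card_inj_on_le finite_swap_class)
  qed
  define b where "b = card (swap_class x)"
  have card_b: "card (swap_class u) = b" if "u \<in> Z" for u
    using le[OF that xyZ(1)] le[OF xyZ(1) that] by (simp add: b_def)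
  have disj: "swap_class u \<inter> swap_class v = {}" if "swap_class u \<noteq> swap_class v" for u v
    using that swap_class_eq by blast
  have div: "b dvd card W" if W: "W \<subseteq> Z" "\<And>u. u \<in> W \<Longrightarrow> swap_class u \<subseteq> W" for W
  proof -
    have fin: "finite W" using W(1) finite_Z finite_subset by blast
    have U: "\<Union> (swap_class ` W) = W" using W swap_class_self by blast
    have "b * card (swap_class ` W) = card (\<Union> (swap_class ` W))"
    proof (rule card_partition)
      show "card c = b" if "c \<in> swap_class ` W" for c using that W(1) card_b by blast
      show "c \<inter> c' = {}" if "c \<in> swap_class ` W" "c' \<in> swap_class ` W" "c \<noteq> c'" for c c'
        using that disj by blast
    qed (use fin U in auto)
    then show ?thesis using U by (metis dvd_triv_left)
  qed
  have bZ: "b dvd card Z" using div[of Z] swap_class_subset by blast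
  \<comment> \<open>If a block meets \<open>W\<close> at \<open>u\<close> and leaves it at
    \<open>v\<close>, the elements moving \<open>u\<close> through \<open>W\<close> fix
    \<open>v\<close>, so all of \<open>W\<close> joins the block of \<open>v\<close>. Counting
    \<open>v\<close> as well makes the inequality strict.\<close>
  have dichotomy: "b dvd card W \<or> card W < b" if W: "jordan_set W" for W
  proof (cases "\<forall>u\<in>W. swap_class u \<subseteq> W")
    case True
    then show ?thesis using div[of W] W by (auto simp: jordan_set_def)
  next
    case False
    then obtain u v where uv: "u \<in> W" "v \<in> swap_class u" "v \<notin> W" by blast
    have vZ: "v \<in> Z" using uv(2) swap_class_subset by blast
    have "w \<in> swap_class u" if w: "w \<in> W" for w
    proof -
      obtain \<rho> where \<rho>: "\<rho> \<in> G" "\<rho> u = w" "\<And>z. z \<in> Z - W \<Longrightarrow> \<rho> z = z"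
        using jordan_setD[OF W uv(1) w] by blast
      have "\<rho> v = v" using \<rho>(3) vZ uv(3) by blast
      have "u \<in> swap_class v" using uv swap_class_eq[OF uv(2)] swap_class_self W by (auto simp: jordan_set_def)
      then have "\<rho> u \<in> swap_class (\<rho> v)" using swap_class_image[OF \<rho>(1)] by blast
      then show ?thesis using \<rho>(2) \<open>\<rho> v = v\<close> swap_class_eq[OF uv(2)] by simp
    qed
    then have "insert v W \<subseteq> swap_class u" using uv(2) by blast
    then have "card (insert v W) \<le> b"
      using card_mono[OF finite_swap_class] card_b[of u] uv(1) W unfolding jordan_set_def by (metis subsetD)
    moreover have "finite W" using W finite_Z finite_subset unfolding jordan_set_def by blast
    ultimately show ?thesis using uv(3) by simp
  qed
  have "card S < b"
  proof (rule ccontr)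
    assume not: "\<not> card S < b"
    then have "b dvd card S" using dichotomy[OF S(1)] by blast
    moreover have "b dvd card S + 1"
    proof (rule ccontr)
      assume n: "\<not> b dvd card S + 1"
      then have "card S + 1 < b" using dichotomy[OF S(2)] S(3) by simp
      then show False using not by simp
    qed
    ultimately have "b dvd 1" using dvd_add_right_iff by blast
    then show False using card_x by (simp add: b_def)
  qed
  then have "2 * b > card Z" using S(4) by linarith
  moreover obtain c where c: "card Z = b * c" using bZ by (elim dvdE)
  moreover have "card Z > 0" using xyZ finite_Z card_gt_0_iff by blast
  ultimately have "c = 1"
  proof -
    have "c > 0" using c \<open>card Z > 0\<close> by (cases c) auto
    moreover have "c < 2"
    proof (rule ccontr)
      assume "\<not> c < 2"
      then have "b * 2 \<le> b * c" by simp
      then show False using c \<open>2 * b > card Z\<close> by simp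
    qed
    ultimately show "c = 1" by simp
  qed
  then have "card (swap_class u) = card Z" if "u \<in> Z" for u using card_b[OF that] c by simp
  then have all: "swap_class u = Z" if "u \<in> Z" for u
    using that card_subset_eq[OF finite_Z swap_class_subset] by blast
  have "\<sigma> \<in> G" if "\<sigma> permutes Z" for \<sigma>
    using that finite_Z
  proof (induction rule: permutes_induct)
    case id
    then show ?case by (rule id_in)
  next
    case (swap u v \<rho>)
    then have "Transposition.transpose u v \<in> G" using all[of u] by (auto simp: swap_class_def)
    then show ?case using swap comp_in by blast
  qed
  then show ?thesis using permutes by blast
qed

end

lemma perm_group_galois: "g \<noteq> 0 \<Longrightarrow> perm_group (galois_group g) (croots g)"
  by unfold_locales (auto simp: finite_croots galois_group_permutes galois_group_id galois_group_comp galois_group_inv)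

section \<open>Jordan sets from primes larger than the degree\<close>

context valuation_ring
begin

lemma power_int_unit_cancel:
  assumes "of_nat p powi m * u = of_nat p powi n * v" "u \<in> R" "u \<notin> M" "v \<in> R" "v \<notin> M"
  shows "m = n"
proof -
  have *: False if "of_nat p powi m * u = of_nat p powi n * v" "u \<in> R" "u \<notin> M" "v \<in> R" "m < n" for m n u v
  proof -
    have "of_nat p powi n = (of_nat p powi m * of_nat p powi (n - m) :: complex)"
      by (simp flip: power_int_add)
    then have "u = of_nat p powi (n - m) * v" using that(1) by (simp add: mult.assoc)
    also have "\<dots> = of_nat p ^ nat (n - m) * v" using that(5) by (simp add: power_int_def)
    also have "\<dots> \<in> M" using that by (intro M_mult M_power p_in_M) auto
    finally show False using that by simp
  qed
  show ?thesis using *[of m u n v] *[of n v m u] assms by (metis linorder_neqE)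
qed

text \<open>The differential equation modulo \<open>M\<close>: at a unit \<open>z\<close>, a double
  root would put every derivative into \<open>M\<close>, among them the constant \<open>k!\<close>,
  which is a unit for \<open>k < p\<close>.\<close>

lemma laguerre_unit_root_simple:
  assumes "k < p" "z \<in> croots (laguerre k a)" "z \<notin> M"
  shows "poly (pderiv (monic_laguerre k a)) z \<notin> M"
proof
  assume z': "poly (pderiv (monic_laguerre k a)) z \<in> M"
  have zR: "z \<in> R" using assms(2) croots_laguerre_R by blast
  define D where "D n = poly ((pderiv ^^ n) (monic_laguerre k a)) z" for n
  have "D n \<in> M \<and> D (Suc n) \<in> M" for n
  proof (induction n)
    case 0
    then show ?case using assms(2) z' by (simp add: D_def croots_laguerre)
  next
    case (Suc n)
    have "z * D (n + 2) + (of_nat (a + 1 + n) - z) * D (n + 1) + (of_nat k - of_nat n) * D n = 0"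
      using arg_cong[OF monic_laguerre_higher_ode[where n = n and k = k and a = a], of "\<lambda>q. poly q z"]
      by (simp add: D_def algebra_simps)
    then have "z * D (n + 2) = - ((of_nat (a + 1 + n) - z) * D (n + 1) + (of_nat k - of_nat n) * D n)"
      unfolding eq_neg_iff_add_eq_0 by (simp only: add.assoc)
    also have "\<dots> \<in> M" using Suc zR by (intro M_uminus M_add M_mult' R_intros(6,10)) auto
    finally have "z * D (n + 2) \<in> M" .
    then have "inverse z * (z * D (n + 2)) \<in> M" by (rule M_mult'[OF unitD(2)[OF zR assms(3)]])
    then show ?case using Suc unitD(1)[OF zR assms(3)] by (simp flip: mult.assoc)
  qed
  then have "D k \<in> M" by blast
  then have "of_nat (fact k) \<in> M" by (simp add: D_def higher_pderiv_monic_laguerre)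
  moreover have "\<not> p dvd fact k" using prime_dvd_fact_iff[OF prime_p] assms(1) by simp
  ultimately show False using of_nat_notin_M by blast
qed

text \<open>The \<open>j\<close> roots in \<open>M\<close> have valuation \<open>1 / j\<close>, whereas the unit roots lie in an unramified
  field \<open>L\<close>. Constant terms of polynomials over \<open>L\<close> have integral valuation, so the \<open>j\<close> roots
  are conjugate over \<open>L\<close>.\<close>

theorem laguerre_jordan_set:
  assumes kp: "k < p" and j: "1 \<le> j" "j \<le> k" "p dvd a + j" "\<not> p\<^sup>2 dvd a + j"
  shows "\<exists>S. card S = j \<and> perm_group.jordan_set (galois_group (laguerre k a)) (croots (laguerre k a)) S"
proof -
  let ?Z = "croots (laguerre k a)"
  interpret PG: perm_group "galois_group (laguerre k a)" ?Z
    by (rule perm_group_galois[OF laguerre_nonzero])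
  define f where "f = monic_laguerre k a"
  define S where "S = ?Z \<inter> M"
  have other: "\<not> p dvd a + l" if "l \<in> {1..k}" "l \<noteq> j" for l
    using prime_dvd_shift_unique[OF kp j(3), of l] that j by auto
  \<comment> \<open>For \<open>i < j\<close> this is \<open>lag_coeff k a i / p\<close>, the
    \<open>p\<close> being taken from the factor \<open>a + j\<close>. As \<open>p ^ 2\<close> does
    not divide \<open>a + j\<close>, \<open>e 0\<close> remains prime to \<open>p\<close>.\<close>
  define e where "e i = (-1) ^ (k + i) * int (k choose i) * (\<Prod>l\<in>{i+1..k} - {j}. int (l + a)) * (int (a + j) div int p)" for i
  have low: "lag_coeff k a i = int p * e i" if "i < j" for i
  proof -
    have "(\<Prod>l\<in>{i+1..k}. int (l + a)) = int (j + a) * (\<Prod>l\<in>{i+1..k} - {j}. int (l + a))"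
      using that j by (intro prod.remove) auto
    moreover have "int (j + a) = int p * (int (a + j) div int p)" using j(3) by (simp add: add.commute flip: int_dvd_int_iff)
    ultimately show ?thesis by (simp only: lag_coeff_def e_def mult_ac)
  qed
  have e0: "\<not> int p dvd e 0"
  proof
    assume "int p dvd e 0"
    moreover have pp: "prime (int p)" using prime_p by simp
    ultimately have "int p dvd (-1) ^ k \<or> int p dvd (\<Prod>l\<in>{1..k} - {j}. int (l + a)) \<or> int p dvd int (a + j) div int p"
      by (auto simp: e_def prime_dvd_mult_iff)
    then show False
    proof (elim disjE)
      assume "int p dvd (-1) ^ k"
      then have "int p dvd -1" using prime_dvd_power[OF pp] by blast
      then show False using pp by auto
    next
      assume "int p dvd (\<Prod>l\<in>{1..k} - {j}. int (l + a))"
      then have "\<exists>l\<in>{1..k} - {j}. int p dvd int (l + a)" using pp by (subst (asm) prime_dvd_prod_iff) auto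
      then obtain l where "l \<in> {1..k} - {j}" "int p dvd int (l + a)" by blast
      then show False using other[of l] by (auto simp: add.commute int_dvd_int_iff simp del: of_nat_add)
    next
      assume "int p dvd int (a + j) div int p"
      then have "int p * int p dvd int p * (int (a + j) div int p)" by (rule mult_dvd_mono[OF dvd_refl])
      moreover have "int p * (int (a + j) div int p) = int (a + j)" using j(3) by (simp add: int_dvd_int_iff del: of_nat_add)
      ultimately have "int (p\<^sup>2) dvd int (a + j)" by (simp only: power2_eq_square of_nat_mult)
      then show False using j(4) by (simp only: int_dvd_int_iff)
    qed
  qed
  have cj: "of_int (lag_coeff k a j) \<notin> M"
  proof (rule of_int_notin_M, rule notI)
    assume "int p dvd lag_coeff k a j"
    moreover have pp: "prime (int p)" using prime_p by simp
    ultimately have "int p dvd (-1) ^ (k + j) \<or> int p dvd int (k choose j) \<or> int p dvd (\<Prod>l\<in>{j+1..k}. int (l + a))"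
      by (auto simp: lag_coeff_def prime_dvd_mult_iff)
    then show False
    proof (elim disjE)
      assume "int p dvd (-1) ^ (k + j)"
      then have "int p dvd -1" using prime_dvd_power[OF pp] by blast
      then show False using pp by auto
    next
      assume "int p dvd int (k choose j)"
      then have "p dvd (k choose j)" by (simp only: int_dvd_int_iff)
      moreover have "(k choose j) dvd fact k" using j(2) by (metis binomial_fact_lemma dvd_triv_right)
      ultimately show False using prime_dvd_fact_iff[OF prime_p] kp dvd_trans by (metis not_le)
    next
      assume "int p dvd (\<Prod>l\<in>{j+1..k}. int (l + a))"
      then have "\<exists>l\<in>{j+1..k}. int p dvd int (l + a)" using pp by (subst (asm) prime_dvd_prod_iff) auto
      then obtain l where "l \<in> {j+1..k}" "int p dvd int (l + a)" by blast
      then show False using other[of l] by (auto simp: add.commute int_dvd_int_iff simp del: of_nat_add)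
    qed
  qed
  have card_S: "card S = j"
  proof (rule antisym)
    show "card S \<le> j" using laguerre_coeffs_mod_M(1)[of k a] cj unfolding S_def by (meson not_le)
    show "j \<le> card S"
    proof (rule ccontr)
      assume "\<not> j \<le> card S"
      then have "of_int (lag_coeff k a (card S)) \<in> M" using low[of "card S"] by (intro of_int_in_M) auto
      then show False using laguerre_coeffs_mod_M(2)[of k a] by (simp add: S_def)
    qed
  qed
  \<comment> \<open>Splitting the equation at index \<open>j\<close> gives
    \<open>p * A + z ^ j * B = 0\<close> with units \<open>A\<close> and \<open>B\<close>, so
    \<open>z\<close> has valuation exactly \<open>1 / j\<close>.\<close>
  have zj: "\<exists>u. u \<in> R \<and> u \<notin> M \<and> z ^ j = of_nat p * u" if z: "z \<in> S" for z
  proof -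
    have zM: "z \<in> M" and zR: "z \<in> R" and z0: "poly f z = 0"
      using z M_imp_R by (auto simp: S_def croots_laguerre f_def)
    define c where "c i = (of_int (lag_coeff k a i) :: complex)" for i
    define A where "A = (\<Sum>i<j. of_int (e i) * z ^ i)"
    define B where "B = (\<Sum>i\<in>{j..k}. c i * z ^ (i - j))"
    have "(\<Sum>i\<le>k. c i * z ^ i) = 0" using z0 by (simp add: poly_altdef f_def coeff_monic_laguerre c_def)
    moreover have "{..k} = {..<j} \<union> {j..k}" using j by auto
    moreover have "(\<Sum>i\<in>{..<j} \<union> {j..k}. c i * z ^ i) = (\<Sum>i<j. c i * z ^ i) + (\<Sum>i\<in>{j..k}. c i * z ^ i)"
      by (rule sum.union_disjoint) auto
    ultimately have "(\<Sum>i<j. c i * z ^ i) + (\<Sum>i\<in>{j..k}. c i * z ^ i) = 0" by simp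
    moreover have "(\<Sum>i<j. c i * z ^ i) = of_nat p * A"
      by (simp add: A_def sum_distrib_left c_def low mult.assoc)
    moreover have "(\<Sum>i\<in>{j..k}. c i * z ^ i) = z ^ j * B"
      by (auto simp: B_def sum_distrib_left power_add[symmetric] mult.left_commute intro!: sum.cong)
    ultimately have eq: "z ^ j * B = of_nat p * (- A)" by (simp add: eq_neg_iff_add_eq_0 add.commute)
    have A': "A = of_int (e 0) + (\<Sum>i\<in>{1..<j}. of_int (e i) * z ^ i)"
    proof -
      have "{..<j} = insert 0 {1..<j}" using j by auto
      then show ?thesis by (simp add: A_def)
    qed
    have B': "B = c j + (\<Sum>i\<in>{j<..k}. c i * z ^ (i - j))"
    proof -
      have "{j..k} = insert j {j<..k}" using j by auto
      then show ?thesis by (simp add: B_def)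
    qed
    have AR: "A \<in> R" "B \<in> R" unfolding A_def B_def c_def using zR by (auto intro!: R_intros)
    have A_unit: "A \<notin> M"
    proof
      assume "A \<in> M"
      moreover have s: "(\<Sum>i\<in>{1..<j}. of_int (e i) * z ^ i) \<in> M" using zM by (intro M_sum M_mult' M_power R_intros) auto
      ultimately have "A - (\<Sum>i\<in>{1..<j}. of_int (e i) * z ^ i) \<in> M" by (rule M_diff)
      then show False using of_int_notin_M[OF e0] by (simp add: A')
    qed
    have B_unit: "B \<notin> M"
    proof
      assume "B \<in> M"
      moreover have s: "(\<Sum>i\<in>{j<..k}. c i * z ^ (i - j)) \<in> M" unfolding c_def using zM by (intro M_sum M_mult' M_power R_intros) auto
      ultimately have "B - (\<Sum>i\<in>{j<..k}. c i * z ^ (i - j)) \<in> M" by (rule M_diff)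
      then show False using cj by (simp add: B' c_def)
    qed
    have "z ^ j = of_nat p * (- A * inverse B)"
      using eq unitD(1)[OF AR(2) B_unit] by (simp add: field_simps)
    moreover have "- A * inverse B \<in> R" using AR unitD(2)[OF AR(2) B_unit] R_intros(4,5) by blast
    moreover have "- A * inverse B \<notin> M"
    proof
      assume "- A * inverse B \<in> M"
      then have "- A * inverse B * B \<in> M" by (rule M_mult[OF _ AR(2)])
      then have "- (- A * inverse B * B) \<in> M" by (rule M_uminus)
      then show False using A_unit unitD(1)[OF AR(2) B_unit] by (simp add: mult.assoc)
    qed
    ultimately show ?thesis by blast
  qed
  obtain L where L: "is_subfield L" "unramified L"
    "\<And>L'. is_subfield L' \<Longrightarrow> unramified L' \<Longrightarrow> L \<subseteq> L' \<Longrightarrow> L' = L"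
    using maximal_unramified_exists by blast
  have fL: "f \<in> polys_over L" "f \<in> polys_over R" "lead_coeff f = 1"
    using monic_laguerre_over_subring is_subfield_subring[OF L(1)] R by (auto simp: f_def)
  have UL: "u \<in> L" if u: "u \<in> ?Z - S" for u
  proof (rule maximal_unramified_simple_root[OF L fL])
    show "poly f u = 0" using u by (simp add: f_def croots_laguerre)
    show "poly (pderiv f) u \<notin> M" unfolding f_def using u by (intro laguerre_unit_root_simple[OF kp]) (auto simp: S_def)
  qed
  have move: "\<exists>\<pi>\<in>galois_group (laguerre k a). \<pi> s = s' \<and> (\<forall>u\<in>?Z - S. \<pi> u = u)"
    if s: "s \<in> S" and s': "s' \<in> S" for s s'
  proof -
    have fs: "poly f s = 0" using s by (simp add: S_def croots_laguerre f_def)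
    have "f \<noteq> 0" by (simp add: f_def)
    then have "algebraic_over L s" using fL fs unfolding algebraic_over_def by (intro bexI[of _ f]) auto
    then obtain g where g: "is_minpoly L s g" using minpoly_exists[OF L(1)] by blast
    then obtain q where "f = q * g" using minpoly_dvd[OF L(1) g fL(1) fs] by blast
    then have gdvd: "g dvd monic_laguerre k a" by (simp add: f_def)
    define Zg where "Zg = {z. poly g z = 0}"
    have glead: "lead_coeff g = 1" and gL: "g \<in> polys_over L" and gs: "poly g s = 0" using g by (auto simp: is_minpoly_def)
    note rg = monic_dvd_laguerre_roots[OF gdvd glead, folded Zg_def]
    define m where "m = card (Zg \<inter> S)"
    have "coeff g 0 = (\<Prod>z\<in>Zg. - z)" by (subst rg(1)) (rule poly_0_prod_linear)
    moreover have nz: "(\<Prod>z\<in>Zg. - z) \<noteq> 0"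
      using rg(3,4) zero_not_root_laguerre by (auto simp: croots_laguerre)
    moreover have "coeff g 0 \<in> L" using gL by (simp add: polys_over_def)
    ultimately obtain n :: int and u where u: "u \<in> R" "u \<notin> M" "(\<Prod>z\<in>Zg. - z) = of_nat p powi n * u"
      using L(2) unfolding unramified_def by metis
    have unit: "\<exists>v. v \<in> R \<and> v \<notin> M \<and> (- z) ^ j = (if z \<in> S then of_nat p else 1) * v" if z: "z \<in> Zg" for z
    proof (cases "z \<in> S")
      case True
      then obtain v where v: "v \<in> R" "v \<notin> M" "z ^ j = of_nat p * v" using zj by blast
      have "(-1) ^ j * v \<in> R" using v R_intros by auto
      moreover have "(-1) ^ j * v \<notin> M" using v M_uminus[of "- v"] by (cases "even j") auto
      moreover have "(- z) ^ j = of_nat p * ((-1) ^ j * v)" using v(3) by (simp add: power_minus[of z] mult_ac)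
      ultimately show ?thesis using True by auto
    next
      case False
      have "z \<in> croots (laguerre k a)" using z rg(4) by blast
      then have "z \<in> R" "z \<notin> M" using False croots_laguerre_R by (auto simp: S_def)
      then have "- z \<in> R" "- z \<notin> M" using R_intros(5) M_uminus[of "- z"] by auto
      then have "(- z) ^ j \<in> R" "(- z) ^ j \<notin> M" using R_intros(7) M_power_imp by blast+
      then show ?thesis using False by auto
    qed
    then obtain v where v: "\<And>z. z \<in> Zg \<Longrightarrow> v z \<in> R \<and> v z \<notin> M \<and> (- z) ^ j = (if z \<in> S then of_nat p else 1) * v z"
      by metis
    \<comment> \<open>The \<open>j\<close>-th power of the constant term of \<open>g\<close>, up to
      sign, is evaluated twice: over \<open>L\<close> its valuation is \<open>n * j\<close>, while
      each root in \<open>S\<close> contributes 1 and each unit root 0. Thus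
      \<open>n * j = m\<close> with \<open>0 < m \<le> j\<close>, which forces
      \<open>m = j\<close>.\<close>
    have "of_nat p powi (n * int j) * u ^ j = (\<Prod>z\<in>Zg. - z) ^ j"
      unfolding u(3) by (simp add: power_mult_distrib power_int_mult)
    also have "\<dots> = (\<Prod>z\<in>Zg. (if z \<in> S then of_nat p else 1) * v z)"
      unfolding prod_power_distrib using v by (intro prod.cong) auto
    also have "\<dots> = (\<Prod>z\<in>Zg. if z \<in> S then of_nat p else 1) * (\<Prod>z\<in>Zg. v z)" by (rule prod.distrib)
    also have "(\<Prod>z\<in>Zg. if z \<in> S then of_nat p else 1) = (of_nat p :: complex) powi (int m)"
      using rg(3) by (simp add: m_def flip: prod.inter_restrict)
    finally have eq: "of_nat p powi (n * int j) * u ^ j = of_nat p powi (int m) * (\<Prod>z\<in>Zg. v z)" .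
    have "u ^ j \<notin> M" using u M_power_imp by blast
    moreover have "(\<Prod>z\<in>Zg. v z) \<in> R \<and> (\<Prod>z\<in>Zg. v z) \<notin> M" using unit_prod[of Zg v] v rg(3) by blast
    ultimately have "n * int j = int m" using power_int_unit_cancel[OF eq R_intros(7)[OF u(1)]] by blast
    moreover have fS: "finite S" using finite_croots[OF laguerre_nonzero] by (simp add: S_def)
    then have "m \<le> j" using card_S card_mono[of S "Zg \<inter> S"] by (simp add: m_def)
    moreover have "m > 0" using gs s fS by (auto simp: m_def Zg_def card_gt_0_iff)
    ultimately have "m = j"
    proof -
      assume nj: "n * int j = int m" and "m \<le> j" "m > 0"
      then have "j dvd m" by (metis dvd_triv_right int_dvd_int_iff)
      then show ?thesis using \<open>m \<le> j\<close> \<open>m > 0\<close> by (simp add: dvd_imp_le order_antisym)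
    qed
    then have "Zg \<inter> S = S" using card_subset_eq[OF fS, of "Zg \<inter> S"] card_S by (simp add: m_def)
    then have "poly g s' = 0" using s' by (auto simp: Zg_def)
    moreover have "s \<in> ?Z" using s by (simp add: S_def)
    ultimately obtain \<pi> where "\<pi> \<in> galois_group (laguerre k a)" "\<pi> s = s'" "\<forall>u\<in>?Z \<inter> L. \<pi> u = u"
      using galois_group_move[OF laguerre_nonzero L(1) _ g] by blast
    then show ?thesis using UL by (intro bexI[of _ \<pi>]) auto
  qed
  have "PG.jordan_set S" unfolding PG.jordan_set_def using move by (auto simp: S_def)
  then show ?thesis using card_S by blast
qed

end

section \<open>Irreducibility and transitivity from the absence of factors of degree at most
  \<open>k / 2\<close>\<close>

lemma laguerre_no_factor:
  assumes no: "\<And>g. g \<in> polys_over \<rat> \<Longrightarrow> lead_coeff g = 1 \<Longrightarrow> g dvd monic_laguerre k a \<Longrightarrow>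
      1 \<le> degree g \<Longrightarrow> 2 * degree g \<le> k \<Longrightarrow> False"
    and g: "g \<in> polys_over \<rat>" "h \<in> polys_over \<rat>" "monic_laguerre k a = g * h" "lead_coeff g = 1"
  shows "degree g = 0 \<or> degree g = k"
proof (rule ccontr)
  assume *: "\<not> ?thesis"
  have "g \<noteq> 0" "h \<noteq> 0" using g(3) by auto
  then have deg: "degree g + degree h = k" by (metis degree_monic_laguerre degree_mult_eq g(3))
  have "lead_coeff (g * h) = lead_coeff g * lead_coeff h" by (rule lead_coeff_mult)
  then have "lead_coeff h = 1" using g(3,4) by (metis degree_monic_laguerre lead_coeff_monic_laguerre mult_1)
  then show False using no[of g] no[of h] g deg * by (cases "2 * degree g \<le> k") auto
qed

text \<open>The minimal polynomial of a root has full degree, so all roots are conjugate over the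
  rationals.\<close>

lemma laguerre_transitive:
  assumes no: "\<And>g. g \<in> polys_over \<rat> \<Longrightarrow> lead_coeff g = 1 \<Longrightarrow> g dvd monic_laguerre k a \<Longrightarrow>
      1 \<le> degree g \<Longrightarrow> 2 * degree g \<le> k \<Longrightarrow> False"
    and x: "x \<in> croots (laguerre k a)" and y: "y \<in> croots (laguerre k a)"
  shows "\<exists>\<pi>\<in>galois_group (laguerre k a). \<pi> x = y"
proof -
  define f where "f = monic_laguerre k a"
  have f: "f \<in> polys_over \<rat>" "f \<noteq> 0" "poly f x = 0" "poly f y = 0"
    using x y monic_laguerre_over_subring[OF is_subfield_subring[OF Rats_subfield]] by (auto simp: f_def croots_laguerre)
  then have "algebraic_over \<rat> x" unfolding algebraic_over_def by blast
  then obtain g where g: "is_minpoly \<rat> x g" using minpoly_exists[OF Rats_subfield] by blast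
  obtain h where h: "h \<in> polys_over \<rat>" "f = h * g" using minpoly_dvd[OF Rats_subfield g f(1,3)] by blast
  have "degree g = 0 \<or> degree g = k"
  proof (rule laguerre_no_factor[OF no _ h(1)])
    show "monic_laguerre k a = g * h" using h(2) by (simp add: f_def mult.commute)
  qed (use g in \<open>auto simp: is_minpoly_def\<close>)
  then have dg: "degree g = k" using minpoly_degree_pos[OF g] by simp
  have "h \<noteq> 0" "g \<noteq> 0" using h f(2) by auto
  then have "degree h + degree g = k" by (metis degree_monic_laguerre degree_mult_eq f_def h(2))
  then obtain c where c: "h = [:c:]" using dg by (metis add_cancel_left_left degree_eq_zeroE)
  then have "poly g y = 0" using f(4) h(2) \<open>h \<noteq> 0\<close> by auto
  then show ?thesis using galois_group_move[OF laguerre_nonzero Rats_subfield x g] by blast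
qed

text \<open>A rational factorisation becomes one of \<open>monic_laguerre\<close> when the leading
  coefficient of \<open>A\<close> and the factor \<open>(-1) ^ k / k!\<close> are moved into the
  cofactor of the normalised \<open>A\<close>.\<close>

lemma laguerre_irreducible:
  assumes no: "\<And>g. g \<in> polys_over \<rat> \<Longrightarrow> lead_coeff g = 1 \<Longrightarrow> g dvd monic_laguerre k a \<Longrightarrow>
      1 \<le> degree g \<Longrightarrow> 2 * degree g \<le> k \<Longrightarrow> False"
    and k: "k \<ge> 1"
  shows "irreducible (laguerre k a)"
proof -
  let ?L = "laguerre k a"
  let ?c = "(-1) ^ k / fact k :: complex"
  have deg_map: "degree (map_poly of_rat q :: complex poly) = degree q" for q :: "rat poly"
    by (rule degree_map_poly) simp
  have map_mult: "map_poly of_rat (q * r) = (map_poly of_rat q * map_poly of_rat r :: complex poly)" for q r :: "rat poly"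
    by (rule poly_eqI) (simp add: coeff_map_poly coeff_mult of_rat_sum of_rat_mult)
  have degL: "degree ?L = k" using deg_map[of ?L] by (simp add: map_poly_laguerre)
  have "degree A = 0 \<or> degree A = k" if AB: "?L = A * B" for A B
  proof -
    have nz: "A \<noteq> 0" "B \<noteq> 0" using AB laguerre_nonzero by auto
    define l where "l = (of_rat (lead_coeff A) :: complex)"
    have l: "l \<noteq> 0" "l \<in> \<rat>" using nz by (auto simp: l_def)
    define g where "g = smult (inverse l) (map_poly of_rat A)"
    define h where "h = smult (l * inverse ?c) (map_poly of_rat B)"
    have "smult ?c (monic_laguerre k a) = map_poly of_rat A * map_poly of_rat B"
      using map_poly_laguerre[of k a] map_mult by (simp add: AB)
    then have "monic_laguerre k a = smult (inverse ?c) (map_poly of_rat A * map_poly of_rat B)"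
      by (metis (no_types, lifting) divide_eq_0_iff fact_nonzero left_inverse neg_equal_0_iff_equal power_eq_0_iff smult_1_left smult_smult zero_neq_one)
    then have eq: "monic_laguerre k a = g * h"
      using l(1) by (simp add: g_def h_def field_simps)
    have "?c \<in> \<rat>" 
      by (metis Rats_divide Rats_power Rats_minus_iff Rats_1 Rats_of_nat of_nat_fact)
    then have lc: "l * inverse ?c \<in> \<rat>" "inverse l \<in> \<rat>" by (rule Rats_mult[OF l(2) Rats_inverse]) (rule Rats_inverse[OF l(2)])
    have gQ: "g \<in> polys_over \<rat>" "h \<in> polys_over \<rat>"
      unfolding g_def h_def
      by (rule polys_over_smult[OF is_subfield_subring[OF Rats_subfield] _ map_poly_of_rat_over_Rats], rule lc)+
    have "lead_coeff g = 1" using l(1) by (simp add: g_def deg_map coeff_map_poly l_def)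
    with no gQ eq have "degree g = 0 \<or> degree g = k" by (rule laguerre_no_factor)
    then show ?thesis using l(1) by (simp add: g_def deg_map)
  qed
  then show ?thesis
  proof (intro irreducibleI)
    fix A B assume *: "\<And>A B. ?L = A * B \<Longrightarrow> degree A = 0 \<or> degree A = k" and AB: "?L = A * B"
    have nz: "A \<noteq> 0" "B \<noteq> 0" using AB laguerre_nonzero by auto
    have "degree A + degree B = k" using degL nz by (simp add: AB degree_mult_eq)
    then show "A dvd 1 \<or> B dvd 1" using *[OF AB] nz by (auto simp: is_unit_iff_degree)
  qed (use laguerre_nonzero degL k in \<open>auto simp: is_unit_iff_degree\<close>)
qed

section \<open>Typical parameters\<close>

lemma ln4_le: "ln 4 \<le> (1.4 :: real)"
proof -
  have "ln 4 = 2 * ln (2::real)" using ln_realpow[of 2 2] by simp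
  then show ?thesis using ln2_le_25_over_36 by simp
qed

text \<open>\<open>L\<close> stands for \<open>ln x\<close>. The 0.8 is 0.9, from
  \<open>a \<ge> x powr (9/10)\<close>, less three times the 1/30 allowed for square divisors. The
  cube bound is tuned to \<open>prime_for_degree\<close>: for \<open>l \<le> 4 * d * L\<close> it is
  at most \<open>d * L / 8\<close>, which the primes chosen there exceed.\<close>

locale typical_parameter =
  fixes K a :: nat and L :: real
  assumes L: "L \<ge> 1000" "ln L \<le> L / 100" and K: "K \<ge> 1" "ln (real K) \<le> L / 30"
    and a: "a > 0" "ln (real (a + K)) \<le> L + 1"
    and simple: "\<And>l. l \<in> {1..K} \<Longrightarrow> 0.8 * L \<le> (\<Sum>p\<in>simple_primes (a + l). ln (real p))"
    and cube: "\<And>l q. l \<in> {1..K} \<Longrightarrow> q ^ 3 dvd a + l \<Longrightarrow> real q \<le> (4 * L + real l) / 64"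
begin

text \<open>For \<open>1 \<le> j \<le> k\<close> this is what \<open>laguerre_jordan_set\<close>
  needs to produce a Jordan set of size \<open>j\<close>.\<close>

definition good :: "nat \<Rightarrow> nat \<Rightarrow> bool" where
  "good k j \<longleftrightarrow> (\<exists>p\<in>simple_primes (a + j). k < p)"

text \<open>For a bad \<open>j\<close> the simple primes of \<open>a + j\<close> are all at most
  \<open>k\<close>, so \<open>few_smooth_numbers\<close> applies with \<open>Q\<close> empty:
  \<open>0.8 * L\<close> times the number of bad \<open>j\<close> is less than
  \<open>k * L / 20\<close>.\<close>

lemma few_bad:
  assumes k: "1 \<le> k" "k \<le> K"
  shows "16 * card {j \<in> {1..k}. \<not> good k j} < k"
proof -
  define B where "B = {j \<in> {1..k}. \<not> good k j}"
  define T where "T = (\<lambda>j. a + j) ` B"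
  have cardT: "card T = card B" unfolding T_def by (rule card_image) (auto simp: inj_on_def)
  have "0.8 * L * real (card T) \<le> real k * (ln (real k) + ln 4) + real k * ln 4 + (\<Sum>p\<in>{}. ln (real p))"
  proof (rule few_smooth_numbers[where s = a])
    show "T \<subseteq> {a<..a + k}" by (auto simp: T_def B_def)
    show "k \<ge> 1" by (rule k)
    fix n assume "n \<in> T"
    then obtain j where j: "n = a + j" "j \<in> {1..k}" "\<not> good k j" by (auto simp: T_def B_def)
    show "0.8 * L \<le> (\<Sum>p\<in>simple_primes n. ln (real p))" using simple[of j] j k by auto
    show "simple_primes n \<subseteq> primes_le k \<union> {}"
      using j(3) unfolding good_def j(1) by (auto simp: primes_le_def simple_primes_def not_less)
  qed auto
  moreover have "ln (real k) \<le> L / 30"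
  proof -
    have "ln (real k) \<le> ln (real K)" using k by simp
    then show ?thesis using K by simp
  qed
  ultimately have "0.8 * L * real (card B) \<le> real k * (L / 30 + 1.4) + real k * 1.4"
    using ln4_le mult_left_mono[of "ln (real k) + ln 4" "L / 30 + 1.4" "real k"] mult_left_mono[OF ln4_le, of "real k"]
    by (simp add: cardT)
  also have "\<dots> = real k * (L / 30 + 2.8)" by (simp add: algebra_simps)
  also have "\<dots> < real k * (L / 20)" using L k by (intro mult_strict_left_mono) auto
  finally have "L * (0.8 * real (card B)) < L * (real k / 20)" by (simp add: mult_ac)
  then have "0.8 * real (card B) < real k / 20" using L by (simp add: mult_less_cancel_left)
  then show ?thesis unfolding B_def by simp
qed

text \<open>Compare the logarithmic size of \<open>d\<close> consecutive numbers with the contribution of the excluded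
  primes: those up to \<open>d L / 8\<close>, and those that also divide some \<open>a + l\<close> with \<open>l \<le> 10 d\<close>. The
  latter divide differences lying strictly between \<open>k - 11 d\<close> and \<open>k\<close>.\<close>

lemma large_prime_divisor:
  assumes d: "1 \<le> d" "16 * d < k" and k: "k \<le> K"
  shows "\<exists>p t. prime p \<and> t < d \<and> p dvd a + (k - t) \<and> real p > real d * L / 8 \<and> (\<forall>l\<in>{1..10 * d}. \<not> p dvd a + l)"
proof (rule ccontr)
  assume no: "\<not> ?thesis"
  define P where "P = nat \<lfloor>real d * L / 8\<rfloor>"
  have dL: "real d * L / 8 \<ge> real d * 125" using mult_left_mono[OF L(1), of "real d"] by simp
  moreover have "real d \<ge> 1" using d by simp
  ultimately have dL1: "real d * L / 8 \<ge> 125" by linarith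
  have P: "P \<ge> 1" "real P \<le> real d * L / 8"
    unfolding P_def using dL1 le_nat_floor[of 1 "real d * L / 8"] of_nat_floor[of "real d * L / 8"] by simp_all
  define Q where "Q = {p. prime p \<and> real p > real d * L / 8 \<and> (\<exists>l\<in>{1..10 * d}. p dvd a + l) \<and> (\<exists>t<d. p dvd a + (k - t))}"
  define T where "T = {a + (k - d)<..a + (k - d) + d}"
  have T: "\<exists>t<d. n = a + (k - t)" if "n \<in> T" for n
    using that d by (intro exI[of _ "a + k - n"]) (auto simp: T_def)
  have finQ: "finite Q"
  proof (rule finite_subset)
    show "Q \<subseteq> {..a + 10 * d}"
    proof
      fix p assume "p \<in> Q"
      then obtain l where l: "l \<in> {1..10 * d}" "p dvd a + l" unfolding Q_def by blast
      then have "p \<le> a + l" using a by (intro dvd_imp_le) auto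
      then show "p \<in> {..a + 10 * d}" using l by simp
    qed
  qed simp
  have Qd: "p > d" if "p \<in> Q" for p
  proof -
    have "real p > real d * L / 8" using that by (simp add: Q_def)
    then have "real p > real d" using dL by linarith
    then show ?thesis by simp
  qed
  have "0.8 * L * real (card T) \<le> real d * (ln (real P) + ln 4) + real P * ln 4 + (\<Sum>p\<in>Q. ln (real p))"
  proof (rule few_smooth_numbers)
    show "T \<subseteq> {a + (k - d)<..a + (k - d) + d}" by (simp add: T_def)
    fix n assume n: "n \<in> T"
    then obtain t where t: "t < d" "n = a + (k - t)" using T by blast
    have "k - t \<in> {1..K}" unfolding atLeastAtMost_iff using t(1) d k by linarith
    then show "0.8 * L \<le> (\<Sum>p\<in>simple_primes n. ln (real p))" unfolding t(2) by (rule simple)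
    show "simple_primes n \<subseteq> primes_le P \<union> Q"
    proof
      fix p assume p: "p \<in> simple_primes n"
      then have pp: "prime p" "p dvd n" by (auto simp: simple_primes_def)
      show "p \<in> primes_le P \<union> Q"
      proof (cases "real p > real d * L / 8")
        case True
        then have "\<exists>l\<in>{1..10 * d}. p dvd a + l" using no pp t by blast
        then show ?thesis using True pp t by (auto simp: Q_def)
      next
        case False
        then show ?thesis using pp by (auto simp: primes_le_def P_def le_nat_floor)
      qed
    qed
  next
    fix p assume p: "p \<in> Q"
    have "n = n'" if n: "n \<in> T" "p dvd n" "n' \<in> T" "p dvd n'" "n \<le> n'" for n n'
    proof (rule ccontr)
      assume "n \<noteq> n'"
      then have "0 < n' - n" "n' - n < d" using n by (auto simp: T_def)
      moreover have "p dvd n' - n" using n by (intro dvd_diff_nat)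
      ultimately show False using Qd[OF p] by (auto dest: dvd_imp_le)
    qed
    then have "n = n'" if "n \<in> {n \<in> T. p dvd n}" "n' \<in> {n \<in> T. p dvd n}" for n n'
      using that by (metis (mono_tags, lifting) mem_Collect_eq nat_le_linear)
    then have "card {n \<in> T. p dvd n} \<le> 1"
      by (subst One_nat_def, subst card_le_Suc0_iff_eq) (auto simp: T_def)
    then show "prime p \<and> card {n \<in> T. p dvd n} \<le> 1" using p by (simp add: Q_def)
  qed (use P finQ in auto)
  moreover have "card T = d" by (simp add: T_def)
  moreover have "(\<Sum>p\<in>Q. ln (real p)) \<le> 11 * real d * ln (real K)"
  proof -
    \<comment> \<open>\<open>V\<close> has fewer than \<open>11 * d\<close> elements, all at most
      \<open>K\<close>, and contains every difference of \<open>a + (k - t)\<close> and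
      \<open>a + l\<close> with \<open>t < d\<close> and \<open>1 \<le> l \<le> 10 * d\<close>; each
      prime in \<open>Q\<close> divides one of these.\<close>
    define V where "V = {k - 11 * d<..<k}"
    have V: "v > 0" "v \<le> K" if "v \<in> V" for v using that k d by (auto simp: V_def)
    have ex: "\<exists>v\<in>V. p dvd v" if pQ: "p \<in> Q" for p
    proof -
      obtain l t where lt: "l \<in> {1..10 * d}" "p dvd a + l" "t < d" "p dvd a + (k - t)" using pQ by (auto simp: Q_def)
      have "p dvd (a + (k - t)) - (a + l)" using lt by (intro dvd_diff_nat)
      moreover have "(a + (k - t)) - (a + l) = k - t - l" by simp
      moreover have "k - t - l \<in> V" using lt d by (auto simp: V_def)
      ultimately show ?thesis by metis
    qed
    have "(\<Sum>p\<in>Q. ln (real p)) \<le> (\<Sum>p\<in>Q. \<Sum>v\<in>{v \<in> V. p dvd v}. ln (real p))"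
    proof (rule sum_mono)
      fix p assume p: "p \<in> Q"
      have fin: "finite {v \<in> V. p dvd v}" by (simp add: V_def)
      have "card {v \<in> V. p dvd v} > 0" using ex[OF p] fin by (auto simp: card_gt_0_iff)
      then have "real (card {v \<in> V. p dvd v}) \<ge> 1" by simp
      moreover have "ln (real p) \<ge> 0" using Qd[OF p] d by simp
      ultimately have "1 * ln (real p) \<le> real (card {v \<in> V. p dvd v}) * ln (real p)" by (intro mult_right_mono)
      then show "ln (real p) \<le> (\<Sum>v\<in>{v \<in> V. p dvd v}. ln (real p))" by simp
    qed
    also have "\<dots> = (\<Sum>v\<in>V. \<Sum>p\<in>{p \<in> Q. p dvd v}. ln (real p))"
      by (rule sum.swap_restrict) (auto simp: finQ V_def)
    also have "\<dots> \<le> (\<Sum>v\<in>V. ln (real K))"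
    proof (rule sum_mono)
      fix v assume v: "v \<in> V"
      have "(\<Sum>p\<in>{p \<in> Q. p dvd v}. ln (real p)) \<le> ln (real v)"
        using V[OF v] finQ by (intro sum_ln_primes_le) (auto simp: Q_def)
      also have "\<dots> \<le> ln (real K)" using V[OF v] by simp
      finally show "(\<Sum>p\<in>{p \<in> Q. p dvd v}. ln (real p)) \<le> ln (real K)" .
    qed
    also have "\<dots> = real (card V) * ln (real K)" by simp
    also have "\<dots> \<le> 11 * real d * ln (real K)"
    proof (rule mult_right_mono)
      have "card V \<le> 11 * d" by (simp add: V_def)
      then show "real (card V) \<le> 11 * real d" by linarith
      show "0 \<le> ln (real K)" using K by simp
    qed
    finally show ?thesis .
  qed
  moreover have "ln (real P) \<le> ln (real K) + ln L"
  proof -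
    have "real P \<le> real K * L"
    proof -
      have "real d * L / 8 \<le> real d * L" using L by simp
      also have "\<dots> \<le> real K * L" using d k L by (intro mult_right_mono) auto
      finally show ?thesis using P by linarith
    qed
    then have "ln (real P) \<le> ln (real K * L)" using P by simp
    also have "\<dots> = ln (real K) + ln L" using K L by (simp add: ln_mult)
    finally show ?thesis .
  qed
  moreover have "real P * ln 4 \<le> real d * (0.175 * L)"
  proof -
    have "real P * ln 4 \<le> (real d * L / 8) * 1.4" using P ln4_le by (intro mult_mono) auto
    then show ?thesis by (simp add: mult_ac)
  qed
  ultimately have "0.8 * L * real d \<le> real d * (ln (real K) + ln L + ln 4) + real d * (0.175 * L) + 11 * real d * ln (real K)"
    using mult_left_mono[of "ln (real P) + ln 4" "ln (real K) + ln L + ln 4" "real d"] by (simp add: algebra_simps)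
  then have "real d * (0.8 * L) \<le> real d * (12 * ln (real K) + ln L + ln 4 + 0.175 * L)"
    by (simp add: algebra_simps)
  \<comment> \<open>The right side is at most \<open>(12/30 + 1/100 + 1.4/1000 + 0.175) * L\<close>,
    which is below \<open>0.6 * L\<close>.\<close>
  then have "0.8 * L \<le> 12 * ln (real K) + ln L + ln 4 + 0.175 * L" using d by simp
  then show False using K L ln4_le by simp
qed

text \<open>If \<open>16 * d < k\<close>, the prime exceeds \<open>d * L / 8\<close> but perhaps not
  \<open>k\<close>, and its multiplicities have to be bounded on all ranges of \<open>i\<close>.
  Otherwise the top \<open>d\<close> indices outnumber the bad ones, so one of them,
  \<open>j\<close>, is good; its prime divides the product at most once, and only from
  \<open>i \<ge> j > d\<close> on.\<close>

lemma prime_for_degree: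
  assumes d: "1 \<le> d" "2 * d \<le> k" and k: "k \<le> K"
  shows "\<exists>p t. prime p \<and> t < d \<and> p dvd a + (k - t) \<and> (\<forall>i\<in>{1..k}. d * multiplicity p (\<Prod>l\<in>{1..i}. l + a) < i)"
proof (cases "16 * d < k")
  case True
  obtain p t where p: "prime p" "t < d" "p dvd a + (k - t)" "real p > real d * L / 8"
    "\<And>l. l \<in> {1..10 * d} \<Longrightarrow> \<not> p dvd a + l"
    using large_prime_divisor[OF d(1) True k] by blast
  have "real d * L / 8 \<ge> real d * 125" using mult_left_mono[OF L(1), of "real d"] by simp
  then have pd: "real p > 125 * real d" using p(4) by linarith
  have d1: "real d \<ge> 1" using d by simp
  have "d * multiplicity p (\<Prod>l\<in>{1..i}. l + a) < i" if i: "i \<in> {1..k}" for i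
  proof -
    define v where "v = multiplicity p (\<Prod>l\<in>{1..i}. l + a)"
    \<comment> \<open>Up to \<open>10 * d\<close> no factor is divisible by \<open>p\<close>. Up to
      \<open>4 * d * L\<close> no factor is divisible by \<open>p ^ 3\<close>, and the error
      \<open>2 * d\<close> is small against \<open>i\<close>. Beyond that, the logarithmic error
      \<open>2 * d * (L + 1)\<close> is little more than \<open>i / 2\<close>.\<close>
    consider "i \<le> 10 * d" | "i > 10 * d" "real i \<le> 4 * real d * L" | "real i > 4 * real d * L" by linarith
    then have "real d * real v < real i"
    proof cases
      case 1
      have "v = (\<Sum>l\<in>{1..i}. multiplicity p (l + a))" unfolding v_def by (rule multiplicity_prod_shift[OF p(1) a(1)])
      also have "\<dots> = 0" using p(5) 1 by (auto simp: not_dvd_imp_multiplicity_0 add.commute)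
      finally show ?thesis using i by simp
    next
      case 2
      have "\<not> p ^ 3 dvd l + a" if l: "l \<in> {1..i}" for l
      proof
        assume "p ^ 3 dvd l + a"
        then have "real p \<le> (4 * L + real l) / 64" using cube[of l p] l i k by (simp add: add.commute)
        also have "\<dots> \<le> (4 * (real d * L) + 4 * (real d * L)) / 64"
        proof -
          define Y where "Y = real d * L"
          have "L \<le> Y" unfolding Y_def using mult_right_mono[OF d1, of L] L by simp
          moreover have "real l \<le> real i" using l by simp
          then have "real l \<le> 4 * Y" unfolding Y_def using 2(2) by simp
          ultimately show ?thesis unfolding Y_def[symmetric] by simp
        qed
        finally show False using p(4) by (simp add: mult.commute)
      qed
      then have "real v \<le> 2 * (real i / real p + 1)" unfolding v_def
        by (intro multiplicity_prod_shift_le_cubefree p a)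
      then have "real d * real v \<le> real d * (2 * (real i / real p + 1))" by (intro mult_left_mono) auto
      also have "\<dots> = 2 * (real d / real p) * real i + 2 * real d" by (simp add: algebra_simps)
      also have "real d / real p \<le> 1 / 125" using pd d1 by (simp add: field_simps)
      also have "2 * (1 / 125) * real i + 2 * real d < real i" using 2 by simp
      finally show ?thesis by (simp add: mult_right_mono)
    next
      case 3
      have "ln (real (i + a)) \<le> L + 1"
      proof -
        have "ln (real (i + a)) \<le> ln (real (a + K))" using i k a by simp
        then show ?thesis using a(2) by linarith
      qed
      then have N: "ln (real (i + a)) / ln 2 \<le> 2 * (L + 1)"
      proof -
        have "ln (real (i + a)) \<ge> 0" using a by simp
        have ln2: "ln (2::real) \<ge> 1 / 2" using ln2_ge_two_thirds by simp
        have "ln (real (i + a)) / ln 2 \<le> (L + 1) / (1 / 2)"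
          using \<open>ln (real (i + a)) \<le> L + 1\<close> \<open>ln (real (i + a)) \<ge> 0\<close> ln2 by (intro frac_le) auto
        then show ?thesis by simp
      qed
      have "real v \<le> real i / (real p - 1) + ln (real (i + a)) / ln 2" unfolding v_def
        by (rule multiplicity_prod_shift_le[OF p(1) a(1)])
      then have "real v \<le> real i / (real p - 1) + 2 * (L + 1)" using N by linarith
      then have "real d * real v \<le> real d * (real i / (real p - 1) + 2 * (L + 1))" by (intro mult_left_mono) auto
      also have "\<dots> = (real d / (real p - 1)) * real i + (2 * (real d * L) + 2 * real d)" by (simp add: algebra_simps)
      also have "real d / (real p - 1) \<le> 1 / 100" using pd d1 by (simp add: field_simps)
      also have "2 * real d \<le> 0.01 * (real d * L)" using L d1 by (simp add: field_simps)
      also have "(1 / 100) * real i + (2 * (real d * L) + 0.01 * (real d * L)) < real i"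
      proof -
        have "real d * L < real i / 4" using 3 by simp
        moreover have "real i > 0" using i by simp
        ultimately show ?thesis by (simp add: mult.commute)
      qed
      finally show ?thesis by (simp add: mult_right_mono)
    qed
    then show ?thesis unfolding v_def by (simp flip: of_nat_mult)
  qed
  then show ?thesis using p by blast
next
  case False
  have "\<exists>j\<in>{k - d<..k}. good k j"
  proof (rule ccontr)
    assume "\<not> ?thesis"
    then have "{k - d<..k} \<subseteq> {j \<in> {1..k}. \<not> good k j}" by auto
    then have "card {k - d<..k} \<le> card {j \<in> {1..k}. \<not> good k j}" by (intro card_mono) auto
    then show False using few_bad[of k] d k False by simp
  qed
  then obtain j p where j: "j \<in> {k - d<..k}" and p: "p \<in> simple_primes (a + j)" "k < p" by (auto simp: good_def)
  have pp: "prime p" "p dvd a + j" "\<not> p\<^sup>2 dvd a + j" using p by (auto simp: simple_primes_def)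
  have other: "\<not> p dvd l + a" if "l \<in> {1..k}" "l \<noteq> j" for l
    using prime_dvd_shift_unique[OF p(2) pp(2), of l] that j by (auto simp: add.commute)
  have one: "multiplicity p (j + a) \<le> 1"
  proof (rule ccontr)
    assume "\<not> ?thesis"
    then have "p\<^sup>2 dvd j + a" by (intro multiplicity_dvd') auto
    then show False using pp by (simp add: add.commute)
  qed
  have "d * multiplicity p (\<Prod>l\<in>{1..i}. l + a) < i" if i: "i \<in> {1..k}" for i
  proof -
    have "multiplicity p (\<Prod>l\<in>{1..i}. l + a) = (\<Sum>l\<in>{1..i}. multiplicity p (l + a))"
      by (rule multiplicity_prod_shift[OF pp(1) a(1)])
    also have "\<dots> \<le> (\<Sum>l\<in>{1..i}. if l = j then 1 else 0)"
      using other one i by (intro sum_mono) (auto simp: not_dvd_imp_multiplicity_0)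
    also have "\<dots> = (if j \<le> i then 1 else 0)" using j d by (auto simp: sum.delta')
    finally have "multiplicity p (\<Prod>l\<in>{1..i}. l + a) \<le> (if j \<le> i then 1 else 0)" .
    then have "d * multiplicity p (\<Prod>l\<in>{1..i}. l + a) \<le> d * (if j \<le> i then 1 else 0)" by (rule mult_left_mono) simp
    also have "\<dots> < i" using j d i by auto
    finally show ?thesis .
  qed
  moreover have "p dvd a + (k - (k - j))" "k - j < d" using pp j by auto
  ultimately show ?thesis using pp(1) by blast
qed

text \<open>A failing \<open>j\<close> between \<open>k / 2\<close> and \<open>k\<close> is bad or
  is followed by a bad index, so fewer than \<open>k / 8\<close> of these \<open>j\<close>
  fail.\<close>

lemma consecutive_good:
  assumes k: "8 \<le> k" "k \<le> K"
  shows "\<exists>j. 2 * j > k \<and> j + 1 \<le> k \<and> good k j \<and> good k (j + 1)"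
proof (rule ccontr)
  assume no: "\<not> ?thesis"
  define B where "B = {j \<in> {1..k}. \<not> good k j}"
  have fin: "finite B" by (simp add: B_def)
  have "{k div 2<..<k} \<subseteq> B \<union> (\<lambda>j. j - 1) ` B"
  proof
    fix j assume j: "j \<in> {k div 2<..<k}"
    then have "\<not> good k j \<or> \<not> good k (j + 1)" using no by auto
    then show "j \<in> B \<union> (\<lambda>j. j - 1) ` B"
    proof
      assume "\<not> good k (j + 1)"
      then have "j + 1 \<in> B" using j by (auto simp: B_def)
      then show ?thesis by (intro UnI2 image_eqI[of _ _ "j + 1"]) auto
    qed (use j in \<open>auto simp: B_def\<close>)
  qed
  then have "card {k div 2<..<k} \<le> card (B \<union> (\<lambda>j. j - 1) ` B)" using fin by (intro card_mono) auto
  also have "\<dots> \<le> card B + card ((\<lambda>j. j - 1) ` B)" by (rule card_Un_le)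
  also have "\<dots> \<le> 2 * card B" using card_image_le[OF fin] by (simp add: mult_2)
  finally have "k - Suc (k div 2) \<le> 2 * card B" by simp
  then show False using few_bad[of k] k unfolding B_def by linarith
qed

lemma good_jordan_set:
  assumes "good k j" "1 \<le> j" "j \<le> k"
  shows "\<exists>S. card S = j \<and> perm_group.jordan_set (galois_group (laguerre k a)) (croots (laguerre k a)) S"
proof -
  obtain p where p: "prime p" "p dvd a + j" "\<not> p\<^sup>2 dvd a + j" "k < p"
    using assms(1) by (auto simp: good_def simple_primes_def)
  obtain R where "valuation_ring p R" using valuation_ring_prime_exists[OF p(1)] by blast
  then show ?thesis using valuation_ring.laguerre_jordan_set[OF _ p(4) assms(2,3) p(2,3)] by blast
qed

theorem laguerre_symmetric:
  assumes k: "8 \<le> k" "k \<le> K" and two: "good k 2"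
  shows "irreducible (laguerre k a) \<and> galois_group (laguerre k a) = sym_group_on (croots (laguerre k a))"
proof -
  have no: False if g: "g \<in> polys_over \<rat>" "lead_coeff g = 1" "g dvd monic_laguerre k a" "1 \<le> degree g" "2 * degree g \<le> k" for g
  proof -
    obtain p t where p: "prime p" "t < degree g" "p dvd a + (k - t)"
      "\<And>i. i \<in> {1..k} \<Longrightarrow> degree g * multiplicity p (\<Prod>l\<in>{1..i}. l + a) < i"
      using prime_for_degree[OF g(4,5) k(2)] by blast
    obtain R where "valuation_ring p R" using valuation_ring_prime_exists[OF p(1)] by blast
    then show False using valuation_ring.no_rational_factor[OF _ p(2) _ p(3,4) g(1,2) refl g(3)] g(5) by simp
  qed
  interpret PG: perm_group "galois_group (laguerre k a)" "croots (laguerre k a)"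
    by (rule perm_group_galois[OF laguerre_nonzero])
  obtain j where j: "2 * j > k" "j + 1 \<le> k" "good k j" "good k (j + 1)" using consecutive_good[OF k] by blast
  obtain T where T: "card T = 2" "PG.jordan_set T" using good_jordan_set[OF two] k by auto
  obtain S where S: "card S = j" "PG.jordan_set S" using good_jordan_set[OF j(3)] j by auto
  obtain S' where S': "card S' = j + 1" "PG.jordan_set S'" using good_jordan_set[OF j(4)] j by auto
  have "card (croots (laguerre k a)) = k"
    using monic_dvd_laguerre_roots(2)[of "monic_laguerre k a" k a] by (simp add: croots_laguerre)
  then have "galois_group (laguerre k a) = {\<pi>. \<pi> permutes croots (laguerre k a)}"
    using laguerre_transitive[OF no] T S S' j
    by (intro PG.symmetric_if_jordan_sets[OF _ T(2,1) S(2) S'(2)]) auto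
  moreover have "irreducible (laguerre k a)" using no k by (intro laguerre_irreducible) auto
  ultimately show ?thesis by (simp add: sym_group_on_def)
qed

end

text \<open>With a cube threshold increasing in \<open>l\<close>, the exceptional densities add up
  to a multiple of \<open>1 / ln x\<close> whatever \<open>K\<close> is. The condition on
  \<open>a + 2\<close> is kept apart because its count presupposes the first two clauses.\<close>

definition typical :: "nat \<Rightarrow> nat \<Rightarrow> nat \<Rightarrow> bool" where
  "typical x K a \<longleftrightarrow> real x powr (9 / 10) \<le> real a \<and>
     (\<forall>l\<in>{1..K}. \<forall>q. q\<^sup>2 dvd a + l \<longrightarrow> real q \<le> real x powr (1 / 30)) \<and>
     (\<forall>l\<in>{1..K}. \<forall>q. q ^ 3 dvd a + l \<longrightarrow> real q \<le> (4 * ln (real x) + real l) / 64)"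

lemma typical_simple_primes:
  assumes x: "x \<ge> 1" and a: "real x powr (9 / 10) \<le> real a"
    and sq: "\<And>q. q\<^sup>2 dvd a + l \<Longrightarrow> real q \<le> real x powr (1 / 30)"
  shows "0.8 * ln (real x) \<le> (\<Sum>p\<in>simple_primes (a + l). ln (real p))"
proof -
  have xp: "real x powr (9 / 10) > 0" using x by simp
  then have a0: "a > 0" using a by linarith
  have "real x powr (9 / 10) \<le> real (a + l)" using a by simp
  then have "ln (real x powr (9 / 10)) \<le> ln (real (a + l))" using xp a0 by (subst ln_le_cancel_iff) auto
  moreover have "ln (real x powr (9 / 10)) = 0.9 * ln (real x)" using x by (simp add: ln_powr)
  moreover have "ln (real (a + l)) - 3 * ln (real x powr (1 / 30)) \<le> (\<Sum>p\<in>simple_primes (a + l). ln (real p))"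
    using a0 x sq by (intro sum_ln_simple_primes_ge) (auto intro: ge_one_powr_ge_zero)
  moreover have "3 * ln (real x powr (1 / 30)) = 0.1 * ln (real x)" using x by (simp add: ln_powr)
  ultimately show ?thesis by linarith
qed

lemma typical_imp:
  assumes x: "ln (real x) \<ge> 1000" "ln (ln (real x)) \<le> ln (real x) / 100" and K: "K \<ge> 1" "ln (real K) \<le> ln (real x) / 30"
    and a: "a \<in> {1..x}" "typical x K a" and p: "p \<in> simple_primes (a + 2)" "p > K" and k: "8 \<le> k" "k \<le> K"
  shows "irreducible (laguerre k a) \<and> galois_group (laguerre k a) = sym_group_on (croots (laguerre k a))"
proof -
  have x1: "x \<ge> 1" using a by simp
  interpret typical_parameter K a "ln (real x)"
  proof
    have "ln (real K) \<le> ln (real x)" using x K by simp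
    then have "K \<le> x" using K x1 by simp
    then have "real (a + K) \<le> 2 * real x" using a by simp
    then have "ln (real (a + K)) \<le> ln (2 * real x)" using a x1 by simp
    also have "\<dots> = ln 2 + ln (real x)" using x1 by (simp add: ln_mult)
    finally show "ln (real (a + K)) \<le> ln (real x) + 1" using ln2_le_25_over_36 by simp
    show "0.8 * ln (real x) \<le> (\<Sum>p\<in>simple_primes (a + l). ln (real p))" if "l \<in> {1..K}" for l
      using a that by (intro typical_simple_primes x1) (auto simp: typical_def)
    show "real q \<le> (4 * ln (real x) + real l) / 64" if "l \<in> {1..K}" "q ^ 3 dvd a + l" for l q
      using a that by (auto simp: typical_def)
  qed (use x K a in auto)
  have "good k 2" unfolding good_def using p k by (intro bexI[of _ p]) auto
  then show ?thesis using laguerre_symmetric[OF k] by blast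
qed

section \<open>Counting exceptional parameters\<close>

lemma count_multiples_le:
  assumes "l \<le> x" "q > 0" "x > 0"
  shows "real (card {a \<in> {1..x}. q dvd a + l}) \<le> 3 * real x / real q"
proof (cases "q \<le> 2 * x")
  \<comment> \<open>Here the rounding error 1 is at most \<open>2 * x / q\<close>. For larger
    \<open>q\<close> there is nothing to count, as \<open>0 < a + l \<le> 2 * x\<close>.\<close>
  case True
  have "real (card {a \<in> {1..x}. q dvd a + l}) \<le> real x / real q + 1" by (rule card_multiples_shift_le[OF assms(2)])
  also have "1 \<le> 2 * real x / real q" using True assms by (simp add: field_simps)
  finally show ?thesis by (simp add: field_simps)
next
  case False
  then have empty: "{a \<in> {1..x}. q dvd a + l} = {}" using assms by (auto dest!: dvd_imp_le)
  show ?thesis unfolding empty by simp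
qed

text \<open>Telescoping by means of
  \<open>1 / (y + 1) ^ 2 \<le> 1 / y - 1 / (y + 1)\<close>.\<close>

lemma sum_shifted_inverse_squares_le:
  assumes "c > 0" shows "(\<Sum>l\<in>{1..K}. 1 / (c + real l)\<^sup>2) \<le> 1 / c"
proof -
  have "(\<Sum>l\<in>{1..K}. 1 / (c + real l)\<^sup>2) \<le> 1 / c - 1 / (c + real K)"
  proof (induction K)
    case (Suc K)
    define y where "y = c + real K"
    have y: "y > 0" "c + real (Suc K) = y + 1" using assms by (auto simp: y_def)
    have "1 / y - 1 / (y + 1) = 1 / (y * (y + 1))" using y by (simp add: field_simps)
    moreover have "1 / (y + 1) ^ 2 \<le> 1 / (y * (y + 1))"
      using y by (intro divide_left_mono) (auto simp: power2_eq_square)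
    ultimately have "1 / (c + real (Suc K))\<^sup>2 \<le> 1 / (c + real K) - 1 / (c + real (Suc K))"
      unfolding y(2) y_def[symmetric] by simp
    then show ?case using Suc by simp
  qed simp
  moreover have "1 / (c + real K) \<ge> 0" using assms by simp
  ultimately show ?thesis by linarith
qed

lemma sum_inverse_squares_le:
  assumes "m > 0"
  shows "(\<Sum>q\<in>{m<..n}. 1 / real q ^ 2) \<le> 1 / real m"
proof -
  have "(\<Sum>q\<in>{m<..n}. 1 / real q ^ 2) = (\<Sum>l\<in>{1..n - m}. 1 / (real m + real l)\<^sup>2)"
    by (rule sum.reindex_bij_witness[of _ "\<lambda>l. m + l" "\<lambda>q. q - m"]) auto
  then show ?thesis using sum_shifted_inverse_squares_le[of "real m" "n - m"] assms by simp
qed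

text \<open>A union bound over \<open>l\<close> and \<open>q\<close>; the range of \<open>q\<close>
  may stop at \<open>2 * x\<close> because
  \<open>q \<le> q ^ e \<le> a + l \<le> 2 * x\<close>.\<close>

lemma count_power_multiples_le:
  assumes "x > 0" "K \<le> x" "\<And>l. l \<in> {1..K} \<Longrightarrow> m l > 0" "e > 0"
  shows "real (card {a \<in> {1..x}. \<exists>l\<in>{1..K}. \<exists>q>m l. q ^ e dvd a + l})
    \<le> (\<Sum>l\<in>{1..K}. \<Sum>q\<in>{m l<..2 * x}. 3 * real x / real q ^ e)"
proof -
  let ?A = "\<lambda>l q. {a \<in> {1..x}. q ^ e dvd a + l}"
  have "{a \<in> {1..x}. \<exists>l\<in>{1..K}. \<exists>q>m l. q ^ e dvd a + l} \<subseteq> (\<Union>l\<in>{1..K}. \<Union>q\<in>{m l<..2 * x}. ?A l q)"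
  proof
    fix a assume "a \<in> {a \<in> {1..x}. \<exists>l\<in>{1..K}. \<exists>q>m l. q ^ e dvd a + l}"
    then obtain l q where *: "a \<in> {1..x}" "l \<in> {1..K}" "q > m l" "q ^ e dvd a + l" by blast
    have "q \<le> q ^ e" using * assms(4) by (intro self_le_power) auto
    also have "\<dots> \<le> a + l" using * by (intro dvd_imp_le) auto
    also have "\<dots> \<le> 2 * x" using * assms(2) by auto
    finally show "a \<in> (\<Union>l\<in>{1..K}. \<Union>q\<in>{m l<..2 * x}. ?A l q)" using * by (intro UN_I[of l] UN_I[of q]) auto
  qed
  then have "card {a \<in> {1..x}. \<exists>l\<in>{1..K}. \<exists>q>m l. q ^ e dvd a + l} \<le> card (\<Union>l\<in>{1..K}. \<Union>q\<in>{m l<..2 * x}. ?A l q)"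
    by (intro card_mono) auto
  also have "\<dots> \<le> (\<Sum>l\<in>{1..K}. \<Sum>q\<in>{m l<..2 * x}. card (?A l q))"
    by (intro order_trans[OF card_UN_le] sum_mono card_UN_le) auto
  finally have "real (card {a \<in> {1..x}. \<exists>l\<in>{1..K}. \<exists>q>m l. q ^ e dvd a + l}) \<le>
      real (\<Sum>l\<in>{1..K}. \<Sum>q\<in>{m l<..2 * x}. card (?A l q))" by (simp only: of_nat_le_iff)
  also have "\<dots> = (\<Sum>l\<in>{1..K}. \<Sum>q\<in>{m l<..2 * x}. real (card (?A l q)))" by simp
  also have "\<dots> \<le> (\<Sum>l\<in>{1..K}. \<Sum>q\<in>{m l<..2 * x}. 3 * real x / real q ^ e)"
  proof (intro sum_mono)
    fix l q assume lq: "l \<in> {1..K}" "q \<in> {m l<..2 * x}"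
    then have "real (card (?A l q)) \<le> 3 * real x / real (q ^ e)"
      using assms by (intro count_multiples_le) auto
    then show "real (card (?A l q)) \<le> 3 * real x / real q ^ e" by simp
  qed
  finally show ?thesis .
qed

lemma count_square_multiples:
  assumes "x > 0" "K \<le> x" "w \<ge> 2"
  shows "real (card {a \<in> {1..x}. \<exists>l\<in>{1..K}. \<exists>q. q\<^sup>2 dvd a + l \<and> real q > w}) \<le> 6 * real x * real K / w"
proof -
  define m where "m = nat \<lfloor>w\<rfloor>"
  have m: "m > 0" "real m \<ge> w / 2" "\<And>q. real q > w \<longleftrightarrow> q > m"
    using assms(3) by (auto simp: m_def) linarith+
  have "{a \<in> {1..x}. \<exists>l\<in>{1..K}. \<exists>q. q\<^sup>2 dvd a + l \<and> real q > w} = {a \<in> {1..x}. \<exists>l\<in>{1..K}. \<exists>q>m. q\<^sup>2 dvd a + l}"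
    by (auto simp: m(3))
  then have "real (card {a \<in> {1..x}. \<exists>l\<in>{1..K}. \<exists>q. q\<^sup>2 dvd a + l \<and> real q > w}) \<le>
      (\<Sum>l\<in>{1..K}. \<Sum>q\<in>{m<..2 * x}. 3 * real x / real q ^ 2)"
    using count_power_multiples_le[of x K "\<lambda>_. m" 2] assms m by simp
  also have "\<dots> = real K * (3 * real x * (\<Sum>q\<in>{m<..2 * x}. 1 / real q ^ 2))"
    by (simp add: sum_distrib_left)
  also have "\<dots> \<le> real K * (3 * real x * (1 / real m))"
    using sum_inverse_squares_le[OF m(1)] by (intro mult_left_mono) auto
  also have "\<dots> \<le> real K * (3 * real x * (2 / w))"
    using m assms by (intro mult_left_mono) (auto simp: field_simps)
  finally show ?thesis by (simp add: mult_ac)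
qed

text \<open>One factor \<open>1 / q\<close> is bounded by \<open>1 / m l\<close>, and the remaining
  inverse squares sum to at most \<open>1 / m l\<close>. As \<open>m l\<close> grows linearly, the
  sum over \<open>l\<close> converges independently of \<open>K\<close>. The constant is
  \<open>3 * 128 ^ 2 / 4\<close>, with 128 instead of 64 to allow for rounding down.\<close>

lemma count_cube_multiples:
  assumes "x > 0" "K \<le> x" "L \<ge> 1000"
  shows "real (card {a \<in> {1..x}. \<exists>l\<in>{1..K}. \<exists>q. q ^ 3 dvd a + l \<and> real q > (4 * L + real l) / 64}) \<le> 12288 * real x / L"
proof -
  define m where "m l = nat \<lfloor>(4 * L + real l) / 64\<rfloor>" for l :: nat
  have m: "m l > 0" "real (m l) \<ge> (4 * L + real l) / 128" "\<And>q. real q > (4 * L + real l) / 64 \<longleftrightarrow> q > m l" for l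
  proof -
    have *: "(4 * L + real l) / 64 \<ge> 2" using assms(3) by simp
    show "m l > 0" using * by (simp add: m_def)
    show "real (m l) \<ge> (4 * L + real l) / 128" using * unfolding m_def by linarith
    show "real q > (4 * L + real l) / 64 \<longleftrightarrow> q > m l" for q using * unfolding m_def by linarith
  qed
  have "{a \<in> {1..x}. \<exists>l\<in>{1..K}. \<exists>q. q ^ 3 dvd a + l \<and> real q > (4 * L + real l) / 64} =
      {a \<in> {1..x}. \<exists>l\<in>{1..K}. \<exists>q>m l. q ^ 3 dvd a + l}"
    by (auto simp only: m(3))
  then have "real (card {a \<in> {1..x}. \<exists>l\<in>{1..K}. \<exists>q. q ^ 3 dvd a + l \<and> real q > (4 * L + real l) / 64}) \<le>
      (\<Sum>l\<in>{1..K}. \<Sum>q\<in>{m l<..2 * x}. 3 * real x / real q ^ 3)"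
    using count_power_multiples_le[of x K m 3] assms m by simp
  also have "\<dots> \<le> (\<Sum>l\<in>{1..K}. 3 * real x * (128\<^sup>2 * (1 / (4 * L + real l)\<^sup>2)))"
  proof (rule sum_mono)
    fix l
    have ml: "real (m l) > 0" using m(1)[of l] by simp
    have "(\<Sum>q\<in>{m l<..2 * x}. 3 * real x / real q ^ 3) \<le> (\<Sum>q\<in>{m l<..2 * x}. 3 * real x * (1 / real (m l)) * (1 / real q ^ 2))"
    proof (rule sum_mono)
      fix q assume q: "q \<in> {m l<..2 * x}"
      have "3 * real x / real q ^ 3 = 3 * real x * (1 / real q) * (1 / real q ^ 2)" by (simp add: power3_eq_cube power2_eq_square)
      also have "\<dots> \<le> 3 * real x * (1 / real (m l)) * (1 / real q ^ 2)"
        using q ml by (intro mult_right_mono mult_left_mono divide_left_mono) auto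
      finally show "3 * real x / real q ^ 3 \<le> 3 * real x * (1 / real (m l)) * (1 / real q ^ 2)" .
    qed
    also have "\<dots> = 3 * real x * (1 / real (m l)) * (\<Sum>q\<in>{m l<..2 * x}. 1 / real q ^ 2)" by (simp add: sum_distrib_left)
    also have "\<dots> \<le> 3 * real x * (1 / real (m l)) * (1 / real (m l))"
      using sum_inverse_squares_le[OF m(1)] by (intro mult_left_mono) auto
    also have "\<dots> = 3 * real x * (1 / real (m l) ^ 2)" by (simp add: power2_eq_square)
    also have "\<dots> \<le> 3 * real x * (1 / ((4 * L + real l) / 128)\<^sup>2)"
      using m(2)[of l] assms(3) ml by (intro mult_left_mono divide_left_mono power_mono) auto
    finally show "(\<Sum>q\<in>{m l<..2 * x}. 3 * real x / real q ^ 3) \<le> 3 * real x * (128\<^sup>2 * (1 / (4 * L + real l)\<^sup>2))"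
      by (simp add: power_divide)
  qed
  also have "\<dots> = 3 * real x * 128\<^sup>2 * (\<Sum>l\<in>{1..K}. 1 / (4 * L + real l)\<^sup>2)" by (simp add: sum_distrib_left)
  also have "\<dots> \<le> 3 * real x * 128\<^sup>2 * (1 / (4 * L))"
    using assms(3) by (intro mult_left_mono sum_shifted_inverse_squares_le) auto
  also have "\<dots> = 12288 * real x / L" using assms(3) by (simp add: field_simps)
  finally show ?thesis .
qed

text \<open>The four summands account for small \<open>a\<close>, large square divisors, large cube
  divisors and smooth \<open>a + 2\<close>. For the first three it is enough that
  \<open>ln K\<close> is a small fraction of \<open>ln x\<close>; the last tends to 0 only if the
  quotient does.\<close>

lemma count_atypical:
  assumes x: "ln (real x) \<ge> 1000" and K: "K \<ge> 2" "ln (real K) \<le> ln (real x) / 60"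
  shows "real (card {a \<in> {1..x}. \<not> (typical x K a \<and> (\<exists>p\<in>simple_primes (a + 2). p > K))}) \<le>
    real x * (real x powr (-1/10) + 6 * real x powr (-1/60) + 12288 / ln (real x) + (ln (real K) + 3) / (0.8 * ln (real x)))"
proof -
  define L where "L = ln (real x)"
  have x0: "x > 0" using x by (cases x) auto
  have "real K \<le> exp (L / 60)" using K x0 by (subst ln_le_cancel_iff[symmetric]) (auto simp: L_def)
  then have KL: "real K \<le> real x powr (1 / 60)" using x0 by (simp add: powr_def L_def)
  have x1: "real x \<ge> 1" using x0 by simp
  have "real x powr (1/60) \<le> real x powr 1" using x1 by (intro powr_mono) auto
  then have Kx: "K \<le> x" using KL x1 by simp
  define B0 where "B0 = {a \<in> {1..x}. real a < real x powr (9/10)}"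
  define B1 where "B1 = {a \<in> {1..x}. \<exists>l\<in>{1..K}. \<exists>q. q\<^sup>2 dvd a + l \<and> real q > real x powr (1/30)}"
  define B2 where "B2 = {a \<in> {1..x}. \<exists>l\<in>{1..K}. \<exists>q. q ^ 3 dvd a + l \<and> real q > (4 * L + real l) / 64}"
  \<comment> \<open>Leaving out \<open>B0\<close> and \<open>B1\<close> makes
    \<open>typical_simple_primes\<close> available for \<open>a + 2\<close>, where
    \<open>2 \<le> K\<close> is used.\<close>
  define B3 where "B3 = {a \<in> {1..x}. a \<notin> B0 \<and> a \<notin> B1 \<and> \<not> (\<exists>p\<in>simple_primes (a + 2). p > K)}"
  have B0: "real (card B0) \<le> real x * real x powr (-1/10)"
  proof -
    have "B0 \<subseteq> {1..nat \<lfloor>real x powr (9/10)\<rfloor>}" by (auto simp: B0_def le_nat_floor)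
    then have "card B0 \<le> nat \<lfloor>real x powr (9/10)\<rfloor>" using card_mono[of "{1..nat \<lfloor>real x powr (9/10)\<rfloor>}" B0] by simp
    then have "real (card B0) \<le> real (nat \<lfloor>real x powr (9/10)\<rfloor>)" by (simp only: of_nat_le_iff)
    also have "\<dots> \<le> real x powr (9/10)" by (rule of_nat_floor) simp
    also have "\<dots> = real x * real x powr (-1/10)"
      using powr_add[of "real x" 1 "-1/10"] x1 by simp
    finally show ?thesis .
  qed
  have B1: "real (card B1) \<le> real x * (6 * real x powr (-1/60))"
  proof -
    have w: "real x powr (1/30) \<ge> 2"
    proof -
      have "ln 2 \<le> L * (1/30)" using x ln2_le_25_over_36 by (simp add: L_def)
      then have "exp (ln 2) \<le> exp (L * (1/30))" by (simp only: exp_le_cancel_iff)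
      then show ?thesis using x0 by (simp add: powr_def L_def mult.commute)
    qed
    have "real (card B1) \<le> 6 * real x * real K / real x powr (1/30)"
      unfolding B1_def by (rule count_square_multiples[OF x0 Kx w])
    also have "\<dots> \<le> 6 * real x * real x powr (1/60) / real x powr (1/30)"
      using KL by (intro divide_right_mono mult_left_mono) auto
    also have "\<dots> = 6 * real x * real x powr (1/60 - 1/30)" unfolding powr_diff by simp
    finally show ?thesis by (simp add: mult_ac)
  qed
  have B2: "real (card B2) \<le> real x * (12288 / L)"
    using count_cube_multiples[OF x0 Kx, of L] x unfolding B2_def L_def by (simp add: mult_ac)
  have B3: "real (card B3) \<le> real x * ((ln (real K) + 3) / (0.8 * L))"
  proof -
    define T where "T = (\<lambda>a. a + 2) ` B3"
    have cardT: "card T = card B3" unfolding T_def by (rule card_image) (auto simp: inj_on_def)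
    have "0.8 * L * real (card T) \<le> real x * (ln (real K) + ln 4) + real K * ln 4 + (\<Sum>p\<in>{}. ln (real p))"
    proof (rule few_smooth_numbers[where s = 2])
      show "T \<subseteq> {2<..2 + x}" by (auto simp: T_def B3_def)
      show "K \<ge> 1" using K by simp
      fix n assume "n \<in> T"
      then obtain a where a: "n = a + 2" "a \<in> B3" by (auto simp: T_def)
      show "0.8 * L \<le> (\<Sum>p\<in>simple_primes n. ln (real p))" unfolding a(1) L_def
      proof (rule typical_simple_primes)
        show "real x powr (9/10) \<le> real a" using a(2) by (auto simp: B3_def B0_def)
        fix q assume q: "q\<^sup>2 dvd a + 2"
        have "a \<notin> B1" "a \<in> {1..x}" using a(2) by (auto simp: B3_def)
        then have "\<not> (\<exists>l\<in>{1..K}. \<exists>q. q\<^sup>2 dvd a + l \<and> real q > real x powr (1/30))" by (simp add: B1_def)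
        moreover have "2 \<in> {1..K}" using K by simp
        ultimately show "real q \<le> real x powr (1/30)" using q by (meson not_le)
      qed (use x0 in simp)
      show "simple_primes n \<subseteq> primes_le K \<union> {}"
        using a unfolding a(1) by (auto simp: B3_def primes_le_def simple_primes_def not_less)
    qed auto
    also have "\<dots> \<le> real x * (ln (real K) + 1.4) + real x * 1.4"
    proof -
      have "real x * (ln (real K) + ln 4) \<le> real x * (ln (real K) + 1.4)"
        using ln4_le by (intro mult_left_mono) auto
      moreover have "real K * ln 4 \<le> real x * 1.4" using ln4_le Kx by (intro mult_mono) auto
      ultimately show ?thesis by simp
    qed
    also have "\<dots> \<le> real x * (ln (real K) + 3)" by (simp add: algebra_simps)
    finally have "0.8 * L * real (card B3) \<le> real x * (ln (real K) + 3)" by (simp add: cardT)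
    then show ?thesis using x by (simp add: L_def field_simps)
  qed
  have "{a \<in> {1..x}. \<not> (typical x K a \<and> (\<exists>p\<in>simple_primes (a + 2). p > K))} \<subseteq> B0 \<union> B1 \<union> B2 \<union> B3"
    unfolding typical_def B0_def B1_def B2_def B3_def L_def by (auto simp: not_le)
  moreover have "finite (B0 \<union> B1 \<union> B2 \<union> B3)" by (auto simp: B0_def B1_def B2_def B3_def)
  ultimately have "card {a \<in> {1..x}. \<not> (typical x K a \<and> (\<exists>p\<in>simple_primes (a + 2). p > K))} \<le> card (B0 \<union> B1 \<union> B2 \<union> B3)"
    by (rule card_mono[rotated])
  also have "\<dots> \<le> card B0 + card B1 + card B2 + card B3"
    using card_Un_le[of "B0 \<union> B1 \<union> B2" B3] card_Un_le[of "B0 \<union> B1" B2] card_Un_le[of B0 B1] by linarith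
  finally have "real (card {a \<in> {1..x}. \<not> (typical x K a \<and> (\<exists>p\<in>simple_primes (a + 2). p > K))}) \<le>
      real (card B0) + real (card B1) + real (card B2) + real (card B3)" by linarith
  also have "\<dots> \<le> real x * (real x powr (-1/10)) + real x * (6 * real x powr (-1/60)) + real x * (12288 / L) +
      real x * ((ln (real K) + 3) / (0.8 * L))"
    using B0 B1 B2 B3 by linarith
  finally show ?thesis by (simp add: L_def distrib_left)
qed

theorem theorem2:
  fixes kmax :: "nat \<Rightarrow> nat"
  assumes "\<And>x. kmax x > 0"
    and "((\<lambda>x. ln (real (kmax x)) / ln (real x)) \<longlongrightarrow> 0) at_top"
  shows "((\<lambda>x. real (card {a \<in> {1..x}. \<forall>k. 8 \<le> k \<and> k \<le> kmax x \<longrightarrow>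
              irreducible (laguerre k a) \<and>
              galois_group (laguerre k a) = sym_group_on (croots (laguerre k a))})
            / real x) \<longlongrightarrow> 1) at_top"
proof -
  define good where "good x = {a \<in> {1..x}. \<forall>k. 8 \<le> k \<and> k \<le> kmax x \<longrightarrow>
              irreducible (laguerre k a) \<and>
              galois_group (laguerre k a) = sym_group_on (croots (laguerre k a))}" for x
  define r where "r x = ln (real (kmax x)) / ln (real x)" for x
  \<comment> \<open>The bound of \<open>count_atypical\<close> divided by \<open>x\<close>, with
    \<open>ln K / ln x\<close> written as \<open>r\<close>.\<close>
  define \<delta> where "\<delta> x = real x powr (-1/10) + 6 * real x powr (-1/60) + 12288 / ln (real x) +
      (r x + 3 / ln (real x)) / 0.8" for x :: nat
  have r: "(r \<longlongrightarrow> 0) at_top" using assms(2) by (simp add: r_def[abs_def])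
  have "((\<lambda>x::nat. real x powr (-1/10) + 6 * real x powr (-1/60) + 12288 / ln (real x)) \<longlongrightarrow> 0) at_top"
    by real_asymp
  moreover have "((\<lambda>x::nat. 3 / ln (real x)) \<longlongrightarrow> 0) at_top" by real_asymp
  ultimately have "(\<delta> \<longlongrightarrow> 0 + (0 + 0) / 0.8) at_top"
    unfolding \<delta>_def[abs_def] using r by (intro tendsto_intros) auto
  then have lower: "((\<lambda>x. 1 - \<delta> x) \<longlongrightarrow> 1) at_top" using tendsto_diff[OF tendsto_const[of 1]] by fastforce
  have "\<forall>\<^sub>F x::nat in at_top. ln (real x) \<ge> 1000" by real_asymp
  moreover have "\<forall>\<^sub>F x::nat in at_top. ln (ln (real x)) \<le> ln (real x) / 100" by real_asymp
  moreover have "\<forall>\<^sub>F x in at_top. r x < 1 / 60" using r by (rule order_tendstoD) simp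
  ultimately have "\<forall>\<^sub>F x in at_top. 1 - \<delta> x \<le> real (card (good x)) / real x"
  proof eventually_elim
    case (elim x)
    have x0: "x > 0" using elim by (cases x) auto
    show ?case
    proof (cases "kmax x \<ge> 2")
      \<comment> \<open>No \<open>k\<close> lies between 8 and \<open>kmax x\<close>, so every
        \<open>a\<close> qualifies; \<open>count_atypical\<close> takes over from
        \<open>kmax x = 2\<close> on.\<close>
      case False
      then have "good x = {1..x}" unfolding good_def by auto
      moreover have "\<delta> x \<ge> 0" using elim False assms(1)[of x] by (auto simp: \<delta>_def r_def intro!: add_nonneg_nonneg divide_nonneg_nonneg)
      ultimately show ?thesis using x0 by simp
    next
      case True
      have K: "ln (real (kmax x)) \<le> ln (real x) / 60" using elim by (simp add: r_def field_simps)
      define B where "B = {a \<in> {1..x}. \<not> (typical x (kmax x) a \<and> (\<exists>p\<in>simple_primes (a + 2). p > kmax x))}"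
      have eq: "(ln (real (kmax x)) + 3) / (0.8 * ln (real x)) = (r x + 3 / ln (real x)) / 0.8"
        using elim by (simp add: r_def field_simps)
      have B: "real (card B) \<le> real x * \<delta> x"
        using count_atypical[OF elim(1) True K] unfolding \<delta>_def B_def eq .
      have "{1..x} - B \<subseteq> good x"
      proof
        fix a assume "a \<in> {1..x} - B"
        then obtain p where a: "a \<in> {1..x}" "typical x (kmax x) a" and p: "p \<in> simple_primes (a + 2)" "p > kmax x"
          by (auto simp: B_def)
        have "ln (real (kmax x)) \<le> ln (real x) / 30" using K elim by simp
        then show "a \<in> good x"
          unfolding good_def using typical_imp[OF elim(1,2) _ _ a p] True a by auto
      qed
      moreover have "finite (good x)" by (simp add: good_def)
      ultimately have "card ({1..x} - B) \<le> card (good x)" by (intro card_mono)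
      moreover have "card ({1..x} - B) = x - card B" by (subst card_Diff_subset) (auto simp: B_def)
      moreover have "card B \<le> card {1..x}" by (rule card_mono) (auto simp: B_def)
      ultimately have "real x - real (card B) \<le> real (card (good x))" by simp
      then have "real x * (1 - \<delta> x) \<le> real (card (good x))" using B by (simp add: right_diff_distrib)
      then show ?thesis using x0 by (simp add: field_simps)
    qed
  qed
  moreover have "\<forall>\<^sub>F x in at_top. real (card (good x)) / real x \<le> 1"
  proof (rule always_eventually, rule allI)
    fix x
    have "card (good x) \<le> card {1..x}" by (rule card_mono) (auto simp: good_def)
    then show "real (card (good x)) / real x \<le> 1"
      by (cases "x = 0") (simp_all add: divide_le_eq_1)
  qed
  ultimately have "((\<lambda>x. real (card (good x)) / real x) \<longlongrightarrow> 1) at_top"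
    using lower tendsto_const by (rule real_tendsto_sandwich)
  then show ?thesis unfolding good_def .
qed

end
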